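(* Assume that $A_1$ has compact resolvent, is semibounded from below, and that $\bigl(\bigcup_{k=1}^m\Delta_k^0\bigr)\cap\sigma(A_1)$ is infinite (so that $\Delta_m^0=(\mu_m^{(1)},+\infty)$). Let $\lambda_1^{(A_1)}<\lambda_2^{(A_1)}<\dots$ be the eigenvalues of $A_1$ in increasing order, and assume $\lambda_{i+1}^{(A_1)}-\lambda_i^{(A_1)}\to\infty$ as $i\to\infty$. Let $r$ be fixed and $i_0$ be a number such that $$\lambda_i^{(A_1)}-\lambda_{i-1}^{(A_1)}>2r>4r_0(B)\qquad\text{for all } i\ge i_0 .$$ Let $\mathsf Q_i^{(l)}$, $i=0,i_0,i_0+1,\dots$, be the Riesz projections of $H_1^{(l)}$ for the circles $\gamma_i$ defined in the context. Then $$\operatorname*{s-lim}_{n\to\infty}\Bigl(\mathsf Q_0^{(l)}+\sum_{i=i_0}^n\mathsf Q_i^{(l)}\Bigr)=I_1 .\qquad( * )$$ If, additionally, $\sum_{i=1}^\infty(\lambda_{i+1}^{(A_1)}-\lambda_i^{(A_1)})^{-2}<\infty$, then $( * )$ remains true for any renumbering of the projections $\mathsf Q_i^{(l)}$; moreover, there is a constant $C$ such that $\bigl\|\sum_{i\in\mathcal I}\mathsf Q_i^{(l)}\bigr\|\le C$ for every finite set $\mathcal I\subset\{0\}\cup\{i\in\mathbb N:i\ge i_0\}$.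
   Context: Setting. $\mathcal H_0,\mathcal H_1$ are separable Hilbert spaces; $A_0$, $A_1$ are (possibly unbounded) self-adjoint operators in $\mathcal H_0$, $\mathcal H_1$; $B_{01}:\mathcal H_1\to\mathcal H_0$ is bounded and $B_{10}=B_{01}^*$. $E_0$ is the spectral measure of $A_0$, $E^0(\mu)=E_0((-\infty,\mu))$, and $K_B(\mu)=B_{10}E^0(\mu)B_{01}$. $I_1$ is the identity in $\mathcal H_1$. Spectral assumptions. There are finitely many pairwise disjoint open intervals $\Delta_k^0=(\mu_k^{(1)},\mu_k^{(2)})$, $k=1,\dots,m$ ($1\le m<\infty$, $-\infty\le\mu_1^{(1)}$, $\mu_m^{(2)}\le+\infty$), contained in the continuous spectrum $\sigma_c(A_0)$ (no eigenvalues of $A_0$ lie in them), with $\Delta_k^0\cap\sigma(A_1)\ne\emptyset$ for all $k$ and $\sigma(A_1)\cap\sigma'(A_0)=\emptyset$, where $\sigma'(A_0)=\sigma(A_0)\setminus\bigcup_{k=1}^m\Delta_k^0$. Analyticity assumptions. On each $\Delta_k^0$ the function $K_B(\mu)$ is differentiable in operator norm; $K_B'$ is continuous on $\overline{\Delta_k^0}$ and has an analytic continuation from $\Delta_k^0$ to a simply connected domain $D_k^-\subset\mathbb C^-$ whose boundary contains $\Delta_k^0$ (the $D_k^-$ are mutually disjoint for different $k$), hence also to $D_k^+=\{z:\bar z\in D_k^-\}$; the continuations are still denoted $K_B'$. At finite end points $\mu_k^{(i)}$, $\|K'_B(\mu)-K'_B(\mu_k^{(i)})\|\le C|\mu-\mu_k^{(i)}|^\gamma$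 for $\mu\in D_k^\pm$, with some $C,\gamma>0$. Contours. For $l=(l_1,\dots,l_m)$, $l_k=\pm1$, put $D_l=\bigcup_kD_k^{l_k}$, where $D_k^{\pm1}=D_k^\pm$. A contour $\Gamma_l=\bigcup_k\Gamma_k^{l_k}$ consists of rectifiable Jordan curves $\Gamma_k^{l_k}$ in $D_k^{l_k}$ obtained by continuous deformation of $\Delta_k^0$ with the (finite) end points kept fixed, whose closures have no points in common with $\sigma_c(A_0)$ other than end points. The modified variation is $$\mathcal V_0(B,\Gamma_l)=\sup_{\{\delta_k\}}\sum_k\|B_{10}E_0(\delta_k\cap\sigma'(A_0))B_{01}\|+\int_{\Gamma_l}|d\mu|\,\|K_B'(\mu)\|,$$ the supremum over finite or countable partitions of $\sigma(A_0)$ into disjoint Borel sets. $\Gamma_l$ is $K_B$-bounded if $\mathcal V_0(B,\Gamma_l)<\infty$. $d_0(\Gamma_l)=\operatorname{dist}\{\sigma(A_1),\sigma'(A_0)\cup\Gamma_l\}$. The operators $X^{(l)},H_1^{(l)}$. For $Y$ in $\mathcal H_1$ with spectrum separated from $\sigma'(A_0)\cup\Gamma_l$, put $V_1(Y,\Gamma_l)=\int_{\sigma'(A_0)}B_{10}E_0(d\mu)B_{01}(Y-\mu)^{-1}+\int_{\Gamma_l}d\mu\,K_B'(\mu)(Y-\mu)^{-1}$. It is assumed that there is a $K_B$-bounded contour $\Gamma_l\subset D_l$ with $\mathcal V_0(B,\Gamma_l)<\frac14d_0^2(\Gamma_l)$. Then $X=V_1(A_1+X,\Gamma_l)$ has a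 unique bounded solution $X^{(l)}$ with $\|X^{(l)}\|\le r_{\min}(\Gamma_l):=\frac{d_0(\Gamma_l)}2-\sqrt{\frac{d_0^2(\Gamma_l)}4-\mathcal V_0(B,\Gamma_l)}$; for fixed $l$ it is the same for all such contours, and $\|X^{(l)}\|\le r_0(B):=\inf r_{\min}(\Gamma_l)$, the infimum over all such contours in $D_l$ (its value does not depend on $l$). $H_1^{(l)}=A_1+X^{(l)}$. Circles and projections. $\gamma_0$ is the circle centered at $(\lambda_1^{(A_1)}+\lambda_{i_0-1}^{(A_1)})/2$ with radius $(\lambda_{i_0-1}^{(A_1)}-\lambda_1^{(A_1)})/2+r$; for $i\ge i_0$, $\gamma_i$ is the circle centered at $\lambda_i^{(A_1)}$ with radius $r$. $\mathsf Q_i^{(l)}=-\frac1{2\pi\mathrm i}\int_{\gamma_i}dz\,(H_1^{(l)}-z)^{-1}$, $i=0,i_0,i_0+1,\dots$. *)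

theory Defs
  imports "HOL-Complex_Analysis.Complex_Analysis"
begin

section \<open>Complex normed spaces and complex Hilbert spaces\<close>

class complex_normed_vector = real_normed_vector +
  fixes scaleC :: "complex \<Rightarrow> 'a \<Rightarrow> 'a"  (infixr "*\<^sub>C" 75)
  assumes scaleC_add_right: "c *\<^sub>C (x + y) = c *\<^sub>C x + c *\<^sub>C y"
    and scaleC_add_left: "(c + d) *\<^sub>C x = c *\<^sub>C x + d *\<^sub>C x"
    and scaleC_scaleC: "c *\<^sub>C d *\<^sub>C x = (c * d) *\<^sub>C x"
    and scaleC_of_real: "complex_of_real s *\<^sub>C x = s *\<^sub>R x"
    and norm_scaleC: "norm (c *\<^sub>C x) = cmod c * norm x"

text \<open>The inner product is linear in its first argument. Positivity and the relation to the
  norm are inherited from \<^class>\<open>real_inner\<close>, whose inner product is the real part.\<close>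

class complex_hilbert = complex_normed_vector + real_inner + complete_space +
  fixes cinner :: "'a \<Rightarrow> 'a \<Rightarrow> complex"
  assumes cinner_commute: "cinner x y = cnj (cinner y x)"
    and cinner_add_left: "cinner (x + y) z = cinner x z + cinner y z"
    and cinner_scaleC_left: "cinner (c *\<^sub>C x) y = c * cinner x y"
    and Re_cinner: "Re (cinner x y) = inner x y"

subclass (in complex_hilbert) banach ..

instantiation complex :: complex_hilbert
begin

definition scaleC_complex :: "complex \<Rightarrow> complex \<Rightarrow> complex"
  where "scaleC_complex c x = c * x"

definition cinner_complex :: "complex \<Rightarrow> complex \<Rightarrow> complex"
  where "cinner_complex x y = x * cnj y"

instance
  by standard (auto simp: scaleC_complex_def cinner_complex_def algebra_simps norm_mult
    scaleR_conv_of_real inner_complex_def)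

end

lemma bounded_linear_scaleC: "bounded_linear ((*\<^sub>C) c :: 'a::complex_normed_vector \<Rightarrow> 'a)"
proof (rule bounded_linear_intro[where K = "cmod c"])
  fix x y :: 'a and s :: real
  show "c *\<^sub>C (x + y) = c *\<^sub>C x + c *\<^sub>C y" by (rule scaleC_add_right)
  show "c *\<^sub>C s *\<^sub>R x = s *\<^sub>R c *\<^sub>C x"
    by (simp add: scaleC_of_real[symmetric] scaleC_scaleC mult.commute)
  show "norm (c *\<^sub>C x) \<le> norm x * cmod c" by (simp add: norm_scaleC mult.commute)
qed

instantiation blinfun :: (real_normed_vector, complex_normed_vector) complex_normed_vector
begin

lift_definition scaleC_blinfun :: "complex \<Rightarrow> 'a \<Rightarrow>\<^sub>L 'b \<Rightarrow> 'a \<Rightarrow>\<^sub>L 'b"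
  is "\<lambda>c T x. c *\<^sub>C T x"
  by (rule bounded_linear_compose[OF bounded_linear_scaleC])

instance
proof
  fix c d :: complex and s :: real and x y :: "'a \<Rightarrow>\<^sub>L 'b"
  show "c *\<^sub>C (x + y) = c *\<^sub>C x + c *\<^sub>C y" by transfer (simp add: scaleC_add_right)
  show "(c + d) *\<^sub>C x = c *\<^sub>C x + d *\<^sub>C x" by transfer (simp add: scaleC_add_left)
  show "c *\<^sub>C d *\<^sub>C x = (c * d) *\<^sub>C x" by transfer (simp add: scaleC_scaleC)
  show "complex_of_real s *\<^sub>C x = s *\<^sub>R x" by transfer (simp add: scaleC_of_real)
  have le: "norm (c *\<^sub>C T) \<le> cmod c * norm T" for c and T :: "'a \<Rightarrow>\<^sub>L 'b"
    by (rule norm_blinfun_bound)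
      (auto simp: scaleC_blinfun.rep_eq norm_scaleC mult.assoc intro!: mult_left_mono norm_blinfun)
  show "norm (c *\<^sub>C x) = cmod c * norm x"
  proof (cases "c = 0")
    case True
    then show ?thesis using le[of 0 x] by simp
  next
    case False
    have "inverse c *\<^sub>C c *\<^sub>C x = x"
      using False scaleC_of_real[of 1] by (intro blinfun_eqI) (simp add: scaleC_blinfun.rep_eq scaleC_scaleC)
    then have "norm x \<le> norm (c *\<^sub>C x) / cmod c"
      using le[of "inverse c" "c *\<^sub>C x"] by (simp add: norm_inverse divide_inverse mult.commute)
    then have "cmod c * norm x \<le> norm (c *\<^sub>C x)" using False by (simp add: field_simps)
    then show ?thesis using le[of c x] by simp
  qed
qed

end


section \<open>Operators in Hilbert space\<close>

definition complex_linear :: "('a::complex_normed_vector \<Rightarrow>\<^sub>L 'b::complex_normed_vector) \<Rightarrow> bool"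
  where "complex_linear T \<longleftrightarrow> (\<forall>c x. T (c *\<^sub>C x) = c *\<^sub>C T x)"

definition is_adjoint :: "('a::complex_hilbert \<Rightarrow>\<^sub>L 'b::complex_hilbert) \<Rightarrow> ('b \<Rightarrow>\<^sub>L 'a) \<Rightarrow> bool"
  where "is_adjoint T S \<longleftrightarrow> (\<forall>x y. cinner (T x) y = cinner x (S y))"

definition compact_operator :: "('a::real_normed_vector \<Rightarrow>\<^sub>L 'b::real_normed_vector) \<Rightarrow> bool"
  where "compact_operator T \<longleftrightarrow> compact (closure (T ` cball 0 1))"

text \<open>An unbounded operator is represented by its graph; its domain is \<^const>\<open>Domain\<close>. For
  a densely defined graph the right-hand side below describes the graph of the adjoint, which is
  linear and single-valued, so no separate linearity condition is needed.\<close>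

type_synonym 'a graph = "('a \<times> 'a) set"

definition self_adjoint :: "'a::complex_hilbert graph \<Rightarrow> bool"
  where "self_adjoint A \<longleftrightarrow> closure (Domain A) = UNIV \<and>
    A = {(y, z). \<forall>(x, w) \<in> A. cinner w y = cinner x z}"

definition semibounded_below :: "'a::complex_hilbert graph \<Rightarrow> bool"
  where "semibounded_below A \<longleftrightarrow> (\<exists>c. \<forall>(x, y) \<in> A. c * (norm x)\<^sup>2 \<le> Re (cinner y x))"

definition op_add :: "'a::real_normed_vector graph \<Rightarrow> ('a \<Rightarrow>\<^sub>L 'a) \<Rightarrow> 'a graph"
  where "op_add A X = {(x, y + X x) | x y. (x, y) \<in> A}"

definition is_resolvent :: "'a::complex_normed_vector graph \<Rightarrow> complex \<Rightarrow> ('a \<Rightarrow>\<^sub>L 'a) \<Rightarrow> bool"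
  where "is_resolvent A z R \<longleftrightarrow> complex_linear R \<and> (\<forall>x y. R y = x \<longleftrightarrow> (x, y + z *\<^sub>C x) \<in> A)"

definition resolvent :: "'a::complex_normed_vector graph \<Rightarrow> complex \<Rightarrow> 'a \<Rightarrow>\<^sub>L 'a"
  where "resolvent A z = (THE R. is_resolvent A z R)"

definition spectrum :: "'a::complex_normed_vector graph \<Rightarrow> complex set"
  where "spectrum A = {z. \<not> (\<exists>R. is_resolvent A z R)}"

definition real_spectrum :: "'a::complex_normed_vector graph \<Rightarrow> real set"
  where "real_spectrum A = {t. complex_of_real t \<in> spectrum A}"

definition eigenvalue :: "'a::complex_normed_vector graph \<Rightarrow> complex \<Rightarrow> bool"
  where "eigenvalue A z \<longleftrightarrow> (\<exists>x. x \<noteq> 0 \<and> (x, z *\<^sub>C x) \<in> A)"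

definition continuous_spectrum :: "'a::complex_normed_vector graph \<Rightarrow> complex set"
  where "continuous_spectrum A = {z \<in> spectrum A. \<not> eigenvalue A z \<and>
    (let rng = {y - z *\<^sub>C x | x y. (x, y) \<in> A} in rng \<noteq> UNIV \<and> closure rng = UNIV)}"

definition compact_resolvent :: "'a::complex_normed_vector graph \<Rightarrow> bool"
  where "compact_resolvent A \<longleftrightarrow> (\<exists>z. z \<notin> spectrum A \<and> compact_operator (resolvent A z))"


section \<open>Spectral measures\<close>

definition projection_valued_measure :: "(real set \<Rightarrow> 'a::complex_hilbert \<Rightarrow>\<^sub>L 'a) \<Rightarrow> bool"
  where "projection_valued_measure E \<longleftrightarrow>
    (\<forall>S \<in> sets borel. complex_linear (E S) \<and> is_adjoint (E S) (E S) \<and> E S o\<^sub>L E S = E S) \<and>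
    E UNIV = id_blinfun \<and>
    (\<forall>S x. range S \<subseteq> sets borel \<and> disjoint_family S \<longrightarrow> (\<lambda>n. E (S n) x) sums E (\<Union>n. S n) x)"

text \<open>The finite measure \<open>(E(\<cdot>)x, x)\<close>; note that \<open>(E(S)x, x) = \<parallel>E(S)x\<parallel>\<^sup>2\<close> for an orthogonal
  projection.\<close>

definition scalar_measure :: "(real set \<Rightarrow> 'a::complex_hilbert \<Rightarrow>\<^sub>L 'a) \<Rightarrow> 'a \<Rightarrow> real measure"
  where "scalar_measure E x = measure_of UNIV (sets borel) (\<lambda>S. ennreal ((norm (E S x))\<^sup>2))"

text \<open>\<open>A = \<integral> t dE(t)\<close> in the weak sense. The off-diagonal matrix elements of \<open>A\<close>
  follow from the diagonal ones by polarisation.\<close>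

definition is_spectral_measure ::
    "'a::complex_hilbert graph \<Rightarrow> (real set \<Rightarrow> 'a \<Rightarrow>\<^sub>L 'a) \<Rightarrow> bool"
  where "is_spectral_measure A E \<longleftrightarrow> projection_valued_measure E \<and>
    Domain A = {x. integrable (scalar_measure E x) (\<lambda>t. t\<^sup>2)} \<and>
    (\<forall>(x, y) \<in> A. cinner y x = complex_of_real (\<integral>t. t \<partial>scalar_measure E x))"


section \<open>Operator-valued functions and integrals\<close>

definition operator_analytic_on :: "(complex \<Rightarrow> 'a::complex_normed_vector) \<Rightarrow> complex set \<Rightarrow> bool"
  where "operator_analytic_on F S \<longleftrightarrow>
    (\<forall>z \<in> S. \<exists>F'. (F has_derivative (\<lambda>h. h *\<^sub>C F')) (at z))"

text \<open>\<open>\<integral>\<^sub>S K(dt) T(t) = J\<close>: norm limit of the sums \<open>\<Sum>\<^sub>q K(q) T(tag q)\<close> along the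
  finite Borel partitions of \<open>S\<close>, directed by refinement.\<close>

definition has_op_integral ::
    "(real set \<Rightarrow> 'b::real_normed_vector \<Rightarrow>\<^sub>L 'c::real_normed_vector) \<Rightarrow>
     (real \<Rightarrow> 'a::real_normed_vector \<Rightarrow>\<^sub>L 'b) \<Rightarrow> real set \<Rightarrow> ('a \<Rightarrow>\<^sub>L 'c) \<Rightarrow> bool"
  where "has_op_integral K T S J \<longleftrightarrow>
    (\<forall>\<epsilon>>0. \<exists>P. finite P \<and> P \<subseteq> sets borel \<and> partition_on S P \<and>
      (\<forall>P' tag. finite P' \<and> P' \<subseteq> sets borel \<and> refines S P' P \<and> (\<forall>q\<in>P'. tag q \<in> q) \<longrightarrow>
        norm ((\<Sum>q\<in>P'. K q o\<^sub>L T (tag q)) - J) < \<epsilon>))"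

text \<open>The integral of \<open>f dz\<close> along the curve \<open>g\<close>, parametrised over \<open>S\<close>.\<close>

definition has_line_integral ::
    "(complex \<Rightarrow> 'a::complex_normed_vector) \<Rightarrow> (real \<Rightarrow> complex) \<Rightarrow> real set \<Rightarrow> 'a \<Rightarrow> bool"
  where "has_line_integral f g S J \<longleftrightarrow>
    ((\<lambda>t. vector_derivative g (at t) *\<^sub>C f (g t)) has_integral J) S"

definition line_integral ::
    "(complex \<Rightarrow> 'a::complex_normed_vector) \<Rightarrow> (real \<Rightarrow> complex) \<Rightarrow> real set \<Rightarrow> 'a"
  where "line_integral f g S = integral S (\<lambda>t. vector_derivative g (at t) *\<^sub>C f (g t))"

definition riesz_projection :: "'a::complex_hilbert graph \<Rightarrow> complex \<Rightarrow> real \<Rightarrow> 'a \<Rightarrow>\<^sub>L 'a"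
  where "riesz_projection H c \<rho> =
    (- 1 / (2 * of_real pi * \<i>)) *\<^sub>C line_integral (resolvent H) (circlepath c \<rho>) {0..1}"

definition strongly_converges ::
    "(nat \<Rightarrow> 'a::real_normed_vector \<Rightarrow>\<^sub>L 'b::real_normed_vector) \<Rightarrow> ('a \<Rightarrow>\<^sub>L 'b) \<Rightarrow> bool"
  where "strongly_converges T L \<longleftrightarrow> (\<forall>x. (\<lambda>n. T n x) \<longlonglongrightarrow> L x)"


section \<open>Spectral and analyticity assumptions\<close>

definition K_measure ::
    "('a::complex_hilbert \<Rightarrow>\<^sub>L 'b::complex_hilbert) \<Rightarrow> (real set \<Rightarrow> 'a \<Rightarrow>\<^sub>L 'a) \<Rightarrow> ('b \<Rightarrow>\<^sub>L 'a) \<Rightarrow>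
     real set \<Rightarrow> 'b \<Rightarrow>\<^sub>L 'b"
  where "K_measure B10 E0 B01 S = B10 o\<^sub>L E0 S o\<^sub>L B01"

text \<open>\<open>\<sigma>'(A\<^sub>0)\<close>\<close>

definition outer_spectrum :: "'a::complex_hilbert graph \<Rightarrow> nat \<Rightarrow> (nat \<Rightarrow> real set) \<Rightarrow> real set"
  where "outer_spectrum A0 m \<Delta> = real_spectrum A0 - (\<Union>k\<in>{1..m}. \<Delta> k)"

definition spectral_assumptions ::
    "'a::complex_hilbert graph \<Rightarrow> 'b::complex_hilbert graph \<Rightarrow> nat \<Rightarrow> (nat \<Rightarrow> ereal) \<Rightarrow> (nat \<Rightarrow> ereal) \<Rightarrow>
     (nat \<Rightarrow> real set) \<Rightarrow> bool"
  where "spectral_assumptions A0 A1 m \<mu>1 \<mu>2 \<Delta> \<longleftrightarrow>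
    1 \<le> m \<and>
    (\<forall>k\<in>{1..m}. \<mu>1 k < \<mu>2 k \<and> \<Delta> k = einterval (\<mu>1 k) (\<mu>2 k)) \<and>
    (\<forall>k\<in>{1..<m}. \<mu>2 k \<le> \<mu>1 (Suc k)) \<and>
    (\<forall>k\<in>{1..m}. of_real ` \<Delta> k \<subseteq> continuous_spectrum A0 \<and>
       (\<forall>t\<in>\<Delta> k. \<not> eigenvalue A0 (of_real t)) \<and>
       of_real ` \<Delta> k \<inter> spectrum A1 \<noteq> {}) \<and>
    spectrum A1 \<inter> of_real ` outer_spectrum A0 m \<Delta> = {}"

text \<open>\<open>DK k\<close> is \<open>K\<^sub>B'\<close> on the closure of \<open>\<Delta>\<^sub>k\<close>, together with its continuations to
  \<open>D\<^sub>k\<^sup>-\<close> (\<open>Dm k\<close>) and, by reflection, to the mirror image of \<open>D\<^sub>k\<^sup>-\<close>. It depends on \<open>k\<close> because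
  neighbouring intervals may share an end point, where the one-sided limits differ. The finite
  end points of \<open>\<Delta> k\<close> are the elements of its frontier.\<close>

definition analyticity_assumptions ::
    "(real set \<Rightarrow> 'b::complex_hilbert \<Rightarrow>\<^sub>L 'b) \<Rightarrow> nat \<Rightarrow> (nat \<Rightarrow> real set) \<Rightarrow> (nat \<Rightarrow> complex set) \<Rightarrow>
     (nat \<Rightarrow> complex \<Rightarrow> 'b \<Rightarrow>\<^sub>L 'b) \<Rightarrow> bool"
  where "analyticity_assumptions K m \<Delta> Dm DK \<longleftrightarrow>
    (\<forall>k\<in>{1..m}.
      open (Dm k) \<and> connected (Dm k) \<and> simply_connected (Dm k) \<and>
      Dm k \<subseteq> {z. Im z < 0} \<and> of_real ` \<Delta> k \<subseteq> frontier (Dm k) \<and>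
      (\<forall>t\<in>\<Delta> k. ((\<lambda>s. K {..<s}) has_vector_derivative DK k (of_real t)) (at t)) \<and>
      continuous_on (closure (\<Delta> k)) (\<lambda>t. DK k (of_real t)) \<and>
      operator_analytic_on (DK k) (Dm k) \<and>
      continuous_on (Dm k \<union> of_real ` \<Delta> k) (DK k) \<and>
      (\<forall>z\<in>Dm k. is_adjoint (DK k z) (DK k (cnj z))) \<and>
      (\<forall>e\<in>frontier (\<Delta> k). \<exists>C>0. \<exists>\<gamma>>0. \<forall>z\<in>Dm k \<union> cnj ` Dm k.
         norm (DK k z - DK k (of_real e)) \<le> C * cmod (z - of_real e) powr \<gamma>)) \<and>
    disjoint_family_on Dm {1..m}"


section \<open>Contours\<close>

text \<open>\<open>D\<^sub>k\<^sup>\<plusminus>\<close> according to the sign \<open>l k\<close>\<close>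

definition signed_domain :: "(nat \<Rightarrow> complex set) \<Rightarrow> (nat \<Rightarrow> int) \<Rightarrow> nat \<Rightarrow> complex set"
  where "signed_domain Dm l k = (if l k = 1 then cnj ` Dm k else Dm k)"

text \<open>A rectifiable Jordan curve in \<open>D\<close> obtained by deforming the interval \<open>\<Delta>\<close>. The curve
  is parametrised over \<open>closure \<Delta>\<close> by a Lipschitz map, which is no restriction: a (locally)
  rectifiable curve can be parametrised proportionally to arc length. During the deformation the
  finite end points stay fixed, and infinite ends stay at infinity.\<close>

definition ends_fixed :: "real set \<Rightarrow> (real \<Rightarrow> complex) \<Rightarrow> bool"
  where "ends_fixed \<Delta> g \<longleftrightarrow> (\<forall>e\<in>frontier \<Delta>. g e = of_real e) \<and>
    (\<not> bdd_above \<Delta> \<longrightarrow> filterlim g at_infinity at_top) \<and>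
    (\<not> bdd_below \<Delta> \<longrightarrow> filterlim g at_infinity at_bot)"

definition contour_in :: "complex set \<Rightarrow> real set \<Rightarrow> (real \<Rightarrow> complex) \<Rightarrow> bool"
  where "contour_in D \<Delta> g \<longleftrightarrow>
    (\<exists>C. C-lipschitz_on (closure \<Delta>) g) \<and> inj_on g (closure \<Delta>) \<and> g ` \<Delta> \<subseteq> D \<and>
    homotopic_with_canon (ends_fixed \<Delta>) (closure \<Delta>) (D \<union> of_real ` closure \<Delta>) of_real g"

definition contour_image :: "nat \<Rightarrow> (nat \<Rightarrow> real set) \<Rightarrow> (nat \<Rightarrow> real \<Rightarrow> complex) \<Rightarrow> complex set"
  where "contour_image m \<Delta> G = (\<Union>k\<in>{1..m}. G k ` \<Delta> k)"

definition is_contour ::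
    "'a::complex_hilbert graph \<Rightarrow> nat \<Rightarrow> (nat \<Rightarrow> real set) \<Rightarrow> (nat \<Rightarrow> complex set) \<Rightarrow>
     (nat \<Rightarrow> real \<Rightarrow> complex) \<Rightarrow> bool"
  where "is_contour A0 m \<Delta> D G \<longleftrightarrow>
    (\<forall>k\<in>{1..m}. contour_in (D k) (\<Delta> k) (G k) \<and>
      closure (G k ` \<Delta> k) \<inter> continuous_spectrum A0 \<subseteq> of_real ` frontier (\<Delta> k))"

text \<open>Finite partitions are included, since members of a partition sequence may be empty.\<close>

definition borel_partitions :: "real set \<Rightarrow> (nat \<Rightarrow> real set) set"
  where "borel_partitions S =
    {P. range P \<subseteq> sets borel \<and> disjoint_family P \<and> (\<Union>j. P j) = S}"

definition modified_variation ::
    "'a::complex_hilbert graph \<Rightarrow> (real set \<Rightarrow> 'b::complex_hilbert \<Rightarrow>\<^sub>L 'b) \<Rightarrow> nat \<Rightarrow> (nat \<Rightarrow> real set) \<Rightarrow>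
     (nat \<Rightarrow> complex \<Rightarrow> 'b \<Rightarrow>\<^sub>L 'b) \<Rightarrow> (nat \<Rightarrow> real \<Rightarrow> complex) \<Rightarrow> ennreal"
  where "modified_variation A0 K m \<Delta> DK G =
    (SUP P\<in>borel_partitions (real_spectrum A0).
       \<Sum>j. ennreal (norm (K (P j \<inter> outer_spectrum A0 m \<Delta>)))) +
    (\<Sum>k=1..m. \<integral>\<^sup>+t\<in>\<Delta> k.
       ennreal (cmod (vector_derivative (G k) (at t)) * norm (DK k (G k t))) \<partial>lebesgue)"

definition contour_dist ::
    "'a::complex_hilbert graph \<Rightarrow> 'b::complex_hilbert graph \<Rightarrow> nat \<Rightarrow> (nat \<Rightarrow> real set) \<Rightarrow>
     (nat \<Rightarrow> real \<Rightarrow> complex) \<Rightarrow> real"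
  where "contour_dist A0 A1 m \<Delta> G =
    setdist (spectrum A1) (of_real ` outer_spectrum A0 m \<Delta> \<union> contour_image m \<Delta> G)"

definition admissible_contour ::
    "'a::complex_hilbert graph \<Rightarrow> 'b::complex_hilbert graph \<Rightarrow> (real set \<Rightarrow> 'b \<Rightarrow>\<^sub>L 'b) \<Rightarrow> nat \<Rightarrow>
     (nat \<Rightarrow> real set) \<Rightarrow> (nat \<Rightarrow> complex set) \<Rightarrow> (nat \<Rightarrow> complex \<Rightarrow> 'b \<Rightarrow>\<^sub>L 'b) \<Rightarrow>
     (nat \<Rightarrow> real \<Rightarrow> complex) \<Rightarrow> bool"
  where "admissible_contour A0 A1 K m \<Delta> D DK G \<longleftrightarrow>
    is_contour A0 m \<Delta> D G \<and> modified_variation A0 K m \<Delta> DK G < \<infinity> \<and>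
    modified_variation A0 K m \<Delta> DK G < ennreal (1/4 * (contour_dist A0 A1 m \<Delta> G)\<^sup>2)"

definition r_min ::
    "'a::complex_hilbert graph \<Rightarrow> 'b::complex_hilbert graph \<Rightarrow> (real set \<Rightarrow> 'b \<Rightarrow>\<^sub>L 'b) \<Rightarrow> nat \<Rightarrow>
     (nat \<Rightarrow> real set) \<Rightarrow> (nat \<Rightarrow> complex \<Rightarrow> 'b \<Rightarrow>\<^sub>L 'b) \<Rightarrow> (nat \<Rightarrow> real \<Rightarrow> complex) \<Rightarrow> real"
  where "r_min A0 A1 K m \<Delta> DK G =
    contour_dist A0 A1 m \<Delta> G / 2 -
    sqrt ((contour_dist A0 A1 m \<Delta> G)\<^sup>2 / 4 - enn2real (modified_variation A0 K m \<Delta> DK G))"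

definition r_zero ::
    "'a::complex_hilbert graph \<Rightarrow> 'b::complex_hilbert graph \<Rightarrow> (real set \<Rightarrow> 'b \<Rightarrow>\<^sub>L 'b) \<Rightarrow> nat \<Rightarrow>
     (nat \<Rightarrow> real set) \<Rightarrow> (nat \<Rightarrow> complex set) \<Rightarrow> (nat \<Rightarrow> complex \<Rightarrow> 'b \<Rightarrow>\<^sub>L 'b) \<Rightarrow> real"
  where "r_zero A0 A1 K m \<Delta> D DK =
    (INF G\<in>{G. admissible_contour A0 A1 K m \<Delta> D DK G}. r_min A0 A1 K m \<Delta> DK G)"


section \<open>The basic equation\<close>

definition has_V1 ::
    "'a::complex_hilbert graph \<Rightarrow> (real set \<Rightarrow> 'b::complex_hilbert \<Rightarrow>\<^sub>L 'b) \<Rightarrow> nat \<Rightarrow> (nat \<Rightarrow> real set) \<Rightarrow>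
     (nat \<Rightarrow> complex \<Rightarrow> 'b \<Rightarrow>\<^sub>L 'b) \<Rightarrow> 'b graph \<Rightarrow> (nat \<Rightarrow> real \<Rightarrow> complex) \<Rightarrow> ('b \<Rightarrow>\<^sub>L 'b) \<Rightarrow> bool"
  where "has_V1 A0 K m \<Delta> DK Y G V \<longleftrightarrow>
    (\<exists>d>0. \<forall>z\<in>spectrum Y. \<forall>w\<in>of_real ` outer_spectrum A0 m \<Delta> \<union> contour_image m \<Delta> G.
       d \<le> dist z w) \<and>
    (\<exists>J L. has_op_integral K (\<lambda>t. resolvent Y (of_real t)) (outer_spectrum A0 m \<Delta>) J \<and>
       (\<forall>k\<in>{1..m}. has_line_integral (\<lambda>z. DK k z o\<^sub>L resolvent Y z) (G k) (\<Delta> k) (L k)) \<and>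
       V = J + (\<Sum>k=1..m. L k))"

text \<open>The solution of \<open>X = V\<^sub>1(A\<^sub>1 + X, \<Gamma>)\<close> in the ball of radius \<open>r_min \<Gamma>\<close> (where it is unique),
  the same operator for all admissible contours \<open>\<Gamma>\<close> in the domains \<open>D\<close>.\<close>

definition is_basic_solution ::
    "'a::complex_hilbert graph \<Rightarrow> 'b::complex_hilbert graph \<Rightarrow> (real set \<Rightarrow> 'b \<Rightarrow>\<^sub>L 'b) \<Rightarrow> nat \<Rightarrow>
     (nat \<Rightarrow> real set) \<Rightarrow> (nat \<Rightarrow> complex set) \<Rightarrow> (nat \<Rightarrow> complex \<Rightarrow> 'b \<Rightarrow>\<^sub>L 'b) \<Rightarrow> ('b \<Rightarrow>\<^sub>L 'b) \<Rightarrow> bool"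
  where "is_basic_solution A0 A1 K m \<Delta> D DK X \<longleftrightarrow> complex_linear X \<and>
    (\<forall>G. admissible_contour A0 A1 K m \<Delta> D DK G \<longrightarrow>
       has_V1 A0 K m \<Delta> DK (op_add A1 X) G X \<and> norm X \<le> r_min A0 A1 K m \<Delta> DK G)"

end

theory Submission
  imports Defs
begin

text \<open>Only two facts about \<open>X\<close> enter: it is bounded and complex linear, and \<open>2 \<parallel>X\<parallel> < r\<close>. The
  eigenprojections \<open>P\<^sub>j\<close> of \<open>A\<^sub>1\<close> resolve the identity, and \<open>H - z\<close>, where \<open>H = A\<^sub>1 + X\<close>, is
  invertible by a Neumann series argument as soon as \<open>z\<close> has distance more than \<open>\<parallel>X\<parallel>\<close> from all
  eigenvalues, with \<open>R\<^sub>H - R\<^sub>A = - R\<^sub>A X R\<^sub>H\<close>.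

  For the strong limit, Cauchy's theorem replaces the circles by one rectangle whose right side lies
  in the middle of the gap above \<open>\<lambda>\<^sub>n\<close>; there \<open>R\<^sub>H - R\<^sub>A\<close> is \<open>O(1 / (d\<^sup>2 + y\<^sup>2))\<close> with \<open>2d\<close> the gap
  length, so that the partial sums for \<open>H\<close> and \<open>A\<^sub>1\<close> differ by \<open>O(1 / d)\<close> in norm.

  For unconditional convergence, put \<open>L\<^sub>i = I - P\<^sub>i\<close> and let \<open>\<delta>\<^sub>i\<close> be the distance of \<open>\<lambda>\<^sub>i\<close> from the
  other eigenvalues. On the circle \<open>\<gamma>\<^sub>i\<close> itself one reads off that \<open>L\<^sub>iQ\<^sub>i\<close> and \<open>Q\<^sub>iL\<^sub>i\<close> are
  \<open>O(1 / \<delta>\<^sub>i)\<close> and \<open>L\<^sub>iQ\<^sub>iL\<^sub>i\<close> is \<open>O(1 / \<delta>\<^sub>i\<^sup>2)\<close>. Hence \<open>Q\<^sub>ix\<close> is the sum of the terms \<open>P\<^sub>iQ\<^sub>ix\<close>, which are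
  orthogonal and square summable, and the terms \<open>L\<^sub>iQ\<^sub>ix\<close>, which are absolutely summable.\<close>

section \<open>Complex Hilbert spaces\<close>

text \<open>The factor 2 in the bound on \<open>X\<close> keeps \<open>norm (RH z)\<close> below
  \<open>2 / r\<close> on every circle, so that all constants are uniform in \<open>i\<close>; it
  comes from \<open>norm X \<le> r_zero\<close> together with \<open>2 * r > 4 * r_zero\<close>. The
  obstacle to unconditional convergence is that the off-diagonal parts of Q_i - P_i are controlled
  only at order 1 / \<delta>_i, which is square summable but in general not summable, so norms of
  Q_i - P_i cannot simply be added. Splitting the argument as well, x = P_i x + L_i x, repairs this.
  In L_i Q_i x a single factor 1 / \<delta>_i always meets norm (P_i x), which is square summable by
  Bessel, and the part coming from L_i x carries a second factor 1 / \<delta>_i. In P_i Q_i x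
  orthogonality of the ranges makes square summability enough. Cauchy's theorem is applied to matrix
  elements only; the norm is recovered by duality because the bounds are uniform in both
  vectors.\<close>

lemma bounded_bilinear_scaleC:
  "bounded_bilinear (scaleC :: complex \<Rightarrow> 'a::complex_normed_vector \<Rightarrow> 'a)"
proof
  fix a a' :: complex and b b' :: 'a and s :: real
  show "(a + a') *\<^sub>C b = a *\<^sub>C b + a' *\<^sub>C b" by (rule scaleC_add_left)
  show "a *\<^sub>C (b + b') = a *\<^sub>C b + a *\<^sub>C b'" by (rule scaleC_add_right)
  show "(s *\<^sub>R a) *\<^sub>C b = s *\<^sub>R a *\<^sub>C b"
    by (metis scaleC_of_real scaleC_scaleC scaleR_conv_of_real)
  show "a *\<^sub>C s *\<^sub>R b = s *\<^sub>R a *\<^sub>C b"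
    by (metis scaleC_of_real scaleC_scaleC mult.commute)
  show "\<exists>K. \<forall>a (b::'a). norm (a *\<^sub>C b) \<le> norm a * norm b * K"
    by (intro exI[of _ 1]) (simp add: norm_scaleC)
qed

interpretation scaleC: bounded_bilinear "scaleC :: complex \<Rightarrow> 'a::complex_normed_vector \<Rightarrow> 'a"
  by (rule bounded_bilinear_scaleC)

lemma scaleC_one [simp]: "1 *\<^sub>C (x::'a::complex_normed_vector) = x"
  using scaleC_of_real[of 1 x] by simp

lemma scaleC_eq_0_iff [simp]: "c *\<^sub>C (x::'a::complex_normed_vector) = 0 \<longleftrightarrow> c = 0 \<or> x = 0"
  by (metis norm_scaleC norm_eq_zero mult_eq_0_iff)

lemma scaleR_scaleC: "s *\<^sub>R c *\<^sub>C (x::'a::complex_normed_vector) = c *\<^sub>C s *\<^sub>R x"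
  by (simp add: scaleC.scaleR_right)

lemma cinner_add_right: "cinner (x::'a::complex_hilbert) (y + z) = cinner x y + cinner x z"
  by (metis cinner_commute cinner_add_left complex_cnj_add)

lemma cinner_scaleC_right: "cinner (x::'a::complex_hilbert) (c *\<^sub>C y) = cnj c * cinner x y"
  by (metis cinner_commute cinner_scaleC_left complex_cnj_mult)

text \<open>Multiplying \<open>x\<close> by a phase makes the inner product real and nonnegative,
  which reduces the claim to the Cauchy-Schwarz inequality for its real part.\<close>

lemma cmod_cinner_le: "cmod (cinner (x::'a::complex_hilbert) y) \<le> norm x * norm y"
proof -
  define c where "c = cnj (sgn (cinner x y))"
  have "c * cinner x y = of_real (cmod (cinner x y))"
  proof (cases "cinner x y = 0")
    case False
    have "c * cinner x y = (cinner x y * cnj (cinner x y)) / of_real (cmod (cinner x y))"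
      by (simp add: c_def sgn_eq)
    also have "\<dots> = of_real ((cmod (cinner x y))\<^sup>2) / of_real (cmod (cinner x y))"
      by (simp only: complex_norm_square)
    finally show ?thesis using False by (simp add: power2_eq_square)
  qed simp
  then have "cmod (cinner x y) = Re (cinner (c *\<^sub>C x) y)"
    by (simp add: cinner_scaleC_left)
  also have "\<dots> = inner (c *\<^sub>C x) y" by (rule Re_cinner)
  also have "\<dots> \<le> norm (c *\<^sub>C x) * norm y" by (rule norm_cauchy_schwarz)
  also have "\<dots> \<le> norm x * norm y"
    by (intro mult_right_mono) (auto simp: norm_scaleC c_def norm_sgn)
  finally show ?thesis .
qed

lemma bounded_bilinear_cinner: "bounded_bilinear (cinner :: 'a::complex_hilbert \<Rightarrow> 'a \<Rightarrow> complex)"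
proof
  fix a a' b b' :: 'a and s :: real
  show "cinner (a + a') b = cinner a b + cinner a' b" by (rule cinner_add_left)
  show "cinner a (b + b') = cinner a b + cinner a b'" by (rule cinner_add_right)
  show "cinner (s *\<^sub>R a) b = s *\<^sub>R cinner a b"
    by (metis scaleC_of_real cinner_scaleC_left scaleR_conv_of_real)
  show "cinner a (s *\<^sub>R b) = s *\<^sub>R cinner a b"
    by (metis scaleC_of_real cinner_scaleC_right scaleR_conv_of_real complex_cnj_complex_of_real)
  show "\<exists>K. \<forall>a (b::'a). norm (cinner a b) \<le> norm a * norm b * K"
    by (intro exI[of _ 1]) (simp add: cmod_cinner_le)
qed

interpretation cinner: bounded_bilinear "cinner :: 'a::complex_hilbert \<Rightarrow> 'a \<Rightarrow> complex"
  by (rule bounded_bilinear_cinner)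

declare cinner.zero_left [simp] cinner.zero_right [simp] scaleC.zero_left [simp] scaleC.zero_right [simp]

lemma cinner_self: "cinner x x = of_real ((norm (x::'a::complex_hilbert))\<^sup>2)"
proof -
  have "Im (cinner x x) = 0" by (metis cinner_commute complex_cnj complex.sel(2) cnj.sel(2)
        equal_neg_zero)
  moreover have "Re (cinner x x) = (norm x)\<^sup>2" by (simp add: Re_cinner power2_norm_eq_inner)
  ultimately show ?thesis by (simp add: complex_eq_iff)
qed

lemma cinner_eq_0_swap: "cinner x y = 0 \<longleftrightarrow> cinner y (x::'a::complex_hilbert) = 0"
  by (metis cinner_commute complex_cnj_zero)

text \<open>Testing with \<open>y = x\<close> suffices. This is the duality step by which scalar
  contour bounds become norm bounds.\<close>

lemma norm_le_of_cinner_le: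
  fixes x :: "'a::complex_hilbert"
  assumes "0 \<le> K" and "\<And>y. cmod (cinner x y) \<le> K * norm y"
  shows "norm x \<le> K"
proof (cases "x = 0")
  case False
  have "norm x * norm x \<le> K * norm x"
    using assms(2)[of x] by (simp add: cinner_self power2_eq_square norm_mult)
  then show ?thesis using False by simp
qed (use assms(1) in simp)

lemma norm_add_sq_orthogonal:
  fixes x y :: "'a::complex_hilbert"
  assumes "cinner x y = 0"
  shows "(norm (x + y))\<^sup>2 = (norm x)\<^sup>2 + (norm y)\<^sup>2"
proof -
  have "inner x y = 0" using assms by (metis Re_cinner zero_complex.sel(1))
  then show ?thesis by (simp add: power2_norm_eq_inner inner_add inner_commute)
qed

text \<open>A minimising sequence for the distance is Cauchy by the parallelogram law, and its limit
  is orthogonal by a first-variation argument. With the real inner product the result serves complex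
  subspaces and also, in \<open>semibounded_solvable\<close>, a range that is treated only as a real
  subspace.\<close>

lemma orthogonal_projection_exists:
  fixes M :: "'a::{real_inner,complete_space} set"
  assumes M: "subspace M" "closed M"
  shows "\<exists>p\<in>M. \<forall>y\<in>M. inner (x - p) y = 0"
proof -
  define d where "d = infdist x M"
  have ne: "M \<noteq> {}" using M(1) subspace_0 by blast
  have dle: "d \<le> norm (x - y)" if "y \<in> M" for y
    using infdist_le[OF that, of x] by (simp add: d_def dist_norm)
  have d0: "0 \<le> d" by (simp add: d_def infdist_nonneg)
  have "\<exists>p\<in>M. norm (x - p) < d + 1 / real (Suc n)" for n
    using infdist_attains_inf ne unfolding d_def infdist_notempty[OF ne] dist_norm[symmetric]
    by (subst cINF_less_iff[symmetric]) auto
  then obtain p where pM: "\<And>n. p n \<in> M" and pd: "\<And>n. norm (x - p n) < d + 1 / real (Suc n)"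
    by metis
  have par: "(norm (p n - p k))\<^sup>2 \<le> 2 * (norm (x - p n))\<^sup>2 + 2 * (norm (x - p k))\<^sup>2 - 4 * d\<^sup>2" for n k
  proof -
    have "(1/2) *\<^sub>R (p n + p k) \<in> M" using M(1) pM by (simp add: subspace_add subspace_scale)
    from dle[OF this] have "d\<^sup>2 \<le> (norm (x - (1/2) *\<^sub>R (p n + p k)))\<^sup>2" using d0 by (simp add: power_mono)
    moreover have "(norm (p n - p k))\<^sup>2 = 2 * (norm (x - p n))\<^sup>2 + 2 * (norm (x - p k))\<^sup>2
        - 4 * (norm (x - (1/2) *\<^sub>R (p n + p k)))\<^sup>2"
      by (simp add: power2_norm_eq_inner inner_diff inner_add inner_commute algebra_simps)
    ultimately show ?thesis by linarith
  qed
  have lim: "(\<lambda>n. d + 1 / real (Suc n)) \<longlonglongrightarrow> d"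
    using tendsto_add[OF tendsto_const LIMSEQ_inverse_real_of_nat, of d] by (simp add: inverse_eq_divide)
  note lim_sq = tendsto_power[OF lim, of 2]
  have "Cauchy p"
  proof (rule metric_CauchyI)
    fix e :: real assume e: "0 < e"
    have "\<forall>\<^sub>F n in sequentially. (d + 1 / real (Suc n))\<^sup>2 < d\<^sup>2 + e\<^sup>2 / 4"
      using order_tendstoD(2)[OF lim_sq, of "d\<^sup>2 + e\<^sup>2 / 4"] e by simp
    then obtain N where N: "\<And>n. n \<ge> N \<Longrightarrow> (d + 1 / real (Suc n))\<^sup>2 < d\<^sup>2 + e\<^sup>2 / 4"
      by (auto simp: eventually_sequentially)
    have sq: "(norm (x - p n))\<^sup>2 < d\<^sup>2 + e\<^sup>2 / 4" if "n \<ge> N" for n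
      using N[OF that] power_mono[OF less_imp_le[OF pd[of n]], of 2] by simp
    have "dist (p n) (p k) < e" if "n \<ge> N" "k \<ge> N" for n k
    proof -
      have "(norm (p n - p k))\<^sup>2 < e\<^sup>2" using par[of n k] sq[OF that(1)] sq[OF that(2)] by simp
      then show ?thesis using e by (simp add: dist_norm power2_less_imp_less)
    qed
    then show "\<exists>M. \<forall>m\<ge>M. \<forall>n\<ge>M. dist (p m) (p n) < e" by blast
  qed
  then obtain q where q: "p \<longlonglongrightarrow> q" using Cauchy_convergent_iff convergent_def by blast
  have qM: "q \<in> M" using closed_sequentially[OF M(2)] pM q by blast
  have "norm (x - q) \<le> d"
  proof (rule LIMSEQ_le)
    show "(\<lambda>n. norm (x - p n)) \<longlonglongrightarrow> norm (x - q)" by (intro tendsto_intros q)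
    show "(\<lambda>n. d + 1 / real (Suc n)) \<longlonglongrightarrow> d" by (rule lim)
    show "\<exists>N. \<forall>n\<ge>N. norm (x - p n) \<le> d + 1 / real (Suc n)" using pd less_imp_le by blast
  qed
  then have min: "norm (x - q) \<le> norm (x - y)" if "y \<in> M" for y using dle[OF that] by simp
  have "inner (x - q) y = 0" if y: "y \<in> M" for y
  proof (cases "y = 0")
    case False
    \<comment> \<open>The value of \<open>s\<close> at which the squared distance from
      \<open>x\<close> to \<open>q + s *\<^sub>R y\<close> is smallest; the decrease there is
      \<open>(inner (x - q) y)\<^sup>2 / inner y y\<close>.\<close>
    define s where "s = inner (x - q) y / inner y y"
    have "q + s *\<^sub>R y \<in> M" using M(1) qM y by (simp add: subspace_add subspace_scale)
    from min[OF this] have "(norm (x - q))\<^sup>2 \<le> (norm (x - (q + s *\<^sub>R y)))\<^sup>2" by (simp add: power_mono)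
    also have "\<dots> = (norm (x - q))\<^sup>2 - 2 * s * inner (x - q) y + s * (s * inner y y)"
      by (simp add: power2_norm_eq_inner inner_diff inner_add inner_commute algebra_simps)
    also have "s * inner y y = inner (x - q) y" using False by (simp add: s_def)
    finally have "s * inner (x - q) y \<le> 0" by simp
    then have "(inner (x - q) y)\<^sup>2 / inner y y \<le> 0" by (simp add: s_def power2_eq_square)
    then show ?thesis using False
      by (metis inner_gt_zero_iff divide_le_0_iff not_le power2_less_eq_zero_iff less_le_not_le)
  qed simp
  then show ?thesis using qM by blast
qed

text \<open>Linearity: the nearest point is characterised by a linear condition.\<close>

lemma orthogonal_projector_exists:
  fixes M :: "'a::complex_hilbert set"
  assumes M: "subspace M" "closed M" and C: "\<And>c x. x \<in> M \<Longrightarrow> c *\<^sub>C x \<in> M"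
  shows "\<exists>P :: 'a \<Rightarrow>\<^sub>L 'a. complex_linear P \<and> (\<forall>x. P x \<in> M) \<and> (\<forall>x\<in>M. P x = x) \<and>
    (\<forall>x. \<forall>y\<in>M. cinner (x - P x) y = 0)"
proof -
  obtain p where pM: "\<And>x. p x \<in> M" and pr: "\<And>x y. y \<in> M \<Longrightarrow> inner (x - p x) y = 0"
    using orthogonal_projection_exists[OF M] by metis
  have po: "cinner (x - p x) y = 0" if "y \<in> M" for x y
  proof -
    have "Re (cinner (x - p x) y) = 0" using pr[OF that] by (simp add: Re_cinner)
    \<comment> \<open>Replacing \<open>y\<close> by \<open>\<i> *\<^sub>C y\<close> turns the real
      part into the imaginary part.\<close>
    moreover have "Re (cinner (x - p x) (\<i> *\<^sub>C y)) = 0" using pr[OF C[OF that]] by (simp add: Re_cinner)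
    ultimately show ?thesis by (simp add: cinner_scaleC_right complex_eq_iff)
  qed
  have uniq: "p x = q" if "q \<in> M" "\<And>y. y \<in> M \<Longrightarrow> cinner (x - q) y = 0" for x q
  proof -
    have "p x - q \<in> M" using M(1) pM that(1) by (simp add: subspace_diff)
    from po[OF this, of x] that(2)[OF this] have "cinner ((x - q) - (x - p x)) (p x - q) = 0"
      by (simp only: cinner.diff_left diff_self)
    then show ?thesis by (simp add: cinner_self)
  qed
  have add: "p (x + y) = p x + p y" for x y
    by (rule uniq) (use M(1) pM po in \<open>auto simp: subspace_add add_diff_add cinner.add_left\<close>)
  have scC: "p (c *\<^sub>C x) = c *\<^sub>C p x" for c x
    by (rule uniq) (use C pM po in \<open>auto simp: scaleC.diff_right[symmetric] cinner_scaleC_left\<close>)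
  have fixM: "p x = x" if "x \<in> M" for x by (rule uniq) (use that in auto)
  have nrm: "norm (p x) \<le> norm x" for x
  proof -
    have "cinner (x - p x) (p x) = 0" using po pM by blast
    from norm_add_sq_orthogonal[OF this] have "(norm (p x))\<^sup>2 \<le> (norm x)\<^sup>2" by simp
    then show ?thesis by (rule power2_le_imp_le) simp
  qed
  have bl: "bounded_linear p"
    by (rule bounded_linear_intro[where K = 1])
      (use add scC nrm scaleC_of_real in \<open>auto simp flip: scaleC_of_real\<close>)
  show ?thesis
    by (rule exI[of _ "Blinfun p"])
      (auto simp: complex_linear_def bounded_linear_Blinfun_apply[OF bl] scC pM fixM po)
qed

section \<open>Self-adjoint operators with compact resolvent\<close>

lemma self_adjoint_symmetric:
  assumes "self_adjoint A" "(x, w) \<in> A" "(y, z) \<in> A"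
  shows "cinner w y = cinner x z"
proof -
  have "A = {(y, z). \<forall>(x, w) \<in> A. cinner w y = cinner x z}"
    using assms(1) by (simp add: self_adjoint_def)
  then have "(y, z) \<in> {(y, z). \<forall>(x, w) \<in> A. cinner w y = cinner x z}" using assms(3) by simp
  then show ?thesis using assms(2) by auto
qed

text \<open>Maximality of a self-adjoint graph: the defining equality read from right to left.
  Linearity and closedness of the graph, which the definition does not postulate, are obtained from
  it.\<close>

lemma self_adjoint_memI:
  assumes "self_adjoint A" "\<And>x w. (x, w) \<in> A \<Longrightarrow> cinner w y = cinner x z"
  shows "(y, z) \<in> A"
proof -
  have "A = {(y, z). \<forall>(x, w) \<in> A. cinner w y = cinner x z}"
    using assms(1) by (simp add: self_adjoint_def)
  moreover have "(y, z) \<in> {(y, z). \<forall>(x, w) \<in> A. cinner w y = cinner x z}" using assms(2) by auto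
  ultimately show ?thesis by simp
qed

lemma self_adjoint_add:
  assumes "self_adjoint A" "(x, y) \<in> A" "(x', y') \<in> A"
  shows "(x + x', y + y') \<in> A"
  by (rule self_adjoint_memI[OF assms(1)])
    (simp add: cinner.add_right self_adjoint_symmetric[OF assms(1) _ assms(2)]
      self_adjoint_symmetric[OF assms(1) _ assms(3)])

lemma self_adjoint_scaleC:
  assumes "self_adjoint A" "(x, y) \<in> A"
  shows "(c *\<^sub>C x, c *\<^sub>C y) \<in> A"
  by (rule self_adjoint_memI[OF assms(1)])
    (simp add: cinner_scaleC_right self_adjoint_symmetric[OF assms(1) _ assms(2)])

lemma self_adjoint_scaleR:
  assumes "self_adjoint A" "(x, y) \<in> A"
  shows "(s *\<^sub>R x, s *\<^sub>R y) \<in> A"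
  using self_adjoint_scaleC[OF assms, of "of_real s"] by (simp add: scaleC_of_real)

lemma self_adjoint_diff:
  assumes "self_adjoint A" "(x, y) \<in> A" "(x', y') \<in> A"
  shows "(x - x', y - y') \<in> A"
  using self_adjoint_add[OF assms(1,2) self_adjoint_scaleR[OF assms(1,3), of "-1"]] by simp

lemma self_adjoint_closed:
  assumes A: "self_adjoint A" and "\<And>n. (x n, y n) \<in> A" and x: "x \<longlonglongrightarrow> a" and y: "y \<longlonglongrightarrow> b"
  shows "(a, b) \<in> A"
proof (rule self_adjoint_memI[OF A])
  fix u w assume "(u, w) \<in> A"
  then have "cinner w (x n) = cinner u (y n)" for n using self_adjoint_symmetric[OF A] assms(2) by blast
  then have "(\<lambda>n. cinner w (x n)) = (\<lambda>n. cinner u (y n))" by blast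
  moreover have "(\<lambda>n. cinner w (x n)) \<longlonglongrightarrow> cinner w a" by (intro cinner.tendsto tendsto_const x)
  moreover have "(\<lambda>n. cinner u (y n)) \<longlonglongrightarrow> cinner u b" by (intro cinner.tendsto tendsto_const y)
  ultimately show "cinner w a = cinner u b" using LIMSEQ_unique by metis
qed

text \<open>Density of the domain makes the graph single-valued; this yields injectivity of the
  inverse of A - t in \<open>eigenvectors_complete\<close>.\<close>

lemma self_adjoint_zero_left:
  fixes A :: "'a::complex_hilbert graph"
  assumes "self_adjoint A" "(0, z) \<in> A"
  shows "z = 0"
proof -
  have "cinner x z = 0" if "x \<in> Domain A" for x
    using self_adjoint_symmetric[OF assms(1) _ assms(2)] that by (auto simp: cinner.zero_right)
  then have "Domain A \<subseteq> {x. cinner x z = 0}" by blast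
  moreover have "closed {x. cinner x z = 0}"
    by (intro closed_Collect_eq continuous_intros cinner.continuous_on)
  ultimately have "closure (Domain A) \<subseteq> {x. cinner x z = 0}" by (rule closure_minimal)
  then have "cinner z z = 0" using assms(1) by (auto simp: self_adjoint_def)
  then show ?thesis by (simp add: cinner_self)
qed

section \<open>Solvability below the form bound\<close>

lemma semibounded_lower_bound:
  fixes A :: "'a::complex_hilbert graph"
  assumes "\<And>x y. (x, y) \<in> A \<Longrightarrow> c * (norm x)\<^sup>2 \<le> Re (cinner y x)" and "(x, y) \<in> A"
  shows "(c - t) * norm x \<le> norm (y - t *\<^sub>R x)"
proof (cases "x = 0")
  case False
  have "(c - t) * (norm x)\<^sup>2 \<le> Re (cinner (y - t *\<^sub>R x) x)"
    using assms(1)[OF assms(2)] by (simp add: cinner.diff_left cinner.scaleR_left cinner_self algebra_simps)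
  also have "\<dots> \<le> norm (y - t *\<^sub>R x) * norm x"
    by (rule order_trans[OF complex_Re_le_cmod cmod_cinner_le])
  finally show ?thesis using False by (simp add: power2_eq_square)
qed simp

text \<open>The lower bound makes the range of A - t closed. A vector orthogonal to this range is,
  by maximality of the graph, in the kernel of A - t, and the lower bound forces it to
  vanish.\<close>

lemma semibounded_solvable:
  fixes A :: "'a::complex_hilbert graph"
  assumes A: "self_adjoint A" and lb: "\<And>x y. (x, y) \<in> A \<Longrightarrow> c * (norm x)\<^sup>2 \<le> Re (cinner y x)"
    and t: "t < c"
  shows "\<exists>x. (x, w + t *\<^sub>R x) \<in> A"
proof -
  define W where "W = {y - t *\<^sub>R x | x y. (x, y) \<in> A}"
  have "subspace W"
  proof (rule subspaceI)
    have "(0, 0) \<in> A" by (rule self_adjoint_memI[OF A]) simp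
    then have "0 - t *\<^sub>R 0 \<in> W" unfolding W_def by blast
    then show "0 \<in> W" by simp
  next
    fix a b assume "a \<in> W" "b \<in> W"
    then obtain x y x' y' where "(x, y) \<in> A" "a = y - t *\<^sub>R x" "(x', y') \<in> A" "b = y' - t *\<^sub>R x'"
      unfolding W_def by blast
    then have "(x + x', y + y') \<in> A" "a + b = (y + y') - t *\<^sub>R (x + x')"
      by (simp_all only: self_adjoint_add[OF A]) (simp add: scaleR_add_right)
    then show "a + b \<in> W" unfolding W_def by blast
  next
    fix s a assume "a \<in> W"
    then obtain x y where "(x, y) \<in> A" "a = y - t *\<^sub>R x" unfolding W_def by blast
    then have "(s *\<^sub>R x, s *\<^sub>R y) \<in> A" "s *\<^sub>R a = s *\<^sub>R y - t *\<^sub>R (s *\<^sub>R x)"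
      by (simp_all only: self_adjoint_scaleR[OF A]) (simp add: scaleR_diff_right mult.commute)
    then show "s *\<^sub>R a \<in> W" unfolding W_def by blast
  qed
  moreover have "closed W"
    unfolding closed_sequential_limits
  proof (intro allI impI, elim conjE)
    fix f l assume "\<forall>n. f n \<in> W" and l: "f \<longlonglongrightarrow> l"
    then obtain x y where xy: "\<And>n. (x n, y n) \<in> A" and f: "\<And>n. f n = y n - t *\<^sub>R x n"
      unfolding W_def mem_Collect_eq by metis
    have le: "(c - t) * dist (x n) (x k) \<le> dist (f n) (f k)" for n k
      using semibounded_lower_bound[OF lb self_adjoint_diff[OF A xy xy], where t = t, of n k]
      by (simp add: dist_norm f algebra_simps)
    have "Cauchy x"
    proof (rule metric_CauchyI)
      fix e :: real assume "e > 0"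
      then have "(c - t) * e > 0" using t by simp
      then obtain M where M: "\<And>m n. m \<ge> M \<Longrightarrow> n \<ge> M \<Longrightarrow> dist (f m) (f n) < (c - t) * e"
        using LIMSEQ_imp_Cauchy[OF l] metric_CauchyD by blast
      have "dist (x m) (x n) < e" if "m \<ge> M" "n \<ge> M" for m n
        using le[of m n] M[OF that] t by (smt (verit, ccfv_SIG) mult_le_cancel_left)
      then show "\<exists>M. \<forall>m\<ge>M. \<forall>n\<ge>M. dist (x m) (x n) < e" by blast
    qed
    then obtain a where a: "x \<longlonglongrightarrow> a" using Cauchy_convergent_iff convergent_def by blast
    have "(\<lambda>n. f n + t *\<^sub>R x n) \<longlonglongrightarrow> l + t *\<^sub>R a" by (intro tendsto_intros a l)
    then have "(a, l + t *\<^sub>R a) \<in> A" using self_adjoint_closed[OF A xy a] f by simp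
    then have "(l + t *\<^sub>R a) - t *\<^sub>R a \<in> W" unfolding W_def by blast
    then show "l \<in> W" by simp
  qed
  ultimately obtain p where pW: "p \<in> W" and p: "\<And>y. y \<in> W \<Longrightarrow> inner (w - p) y = 0"
    using orthogonal_projection_exists by metis
  define v where "v = w - p"
  have "(v, t *\<^sub>R v) \<in> A"
  proof (rule self_adjoint_memI[OF A])
    fix x y assume xy: "(x, y) \<in> A"
    have re: "Re (cinner v (y - t *\<^sub>R x)) = 0" if "(x, y) \<in> A" for x y
      using p that unfolding v_def W_def Re_cinner by blast
    have "Re (cinner v (\<i> *\<^sub>C (y - t *\<^sub>R x))) = 0"
      using re[OF self_adjoint_scaleC[OF A xy, of \<i>]] by (simp add: scaleC.diff_right scaleR_scaleC)
    with re[OF xy] have "cinner v (y - t *\<^sub>R x) = 0"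
      by (simp add: cinner_scaleC_right complex_eq_iff)
    then have "cinner (y - t *\<^sub>R x) v = 0" using cinner_eq_0_swap by blast
    then show "cinner y v = cinner x (t *\<^sub>R v)"
      by (simp add: cinner.diff_left cinner.scaleR_left cinner.scaleR_right)
  qed
  from semibounded_lower_bound[OF lb this, of t] t have "v = 0"
    by (simp add: mult_le_0_iff)
  then have "w \<in> W" using pW v_def by simp
  then obtain x y where "(x, y) \<in> A" "w = y - t *\<^sub>R x" unfolding W_def by blast
  then show ?thesis by (intro exI[of _ x]) simp
qed

section \<open>Uniqueness and compactness of the resolvent\<close>

lemma is_resolvent_unique:
  assumes "is_resolvent A z R" "is_resolvent A z S"
  shows "R = S"
  using assms unfolding is_resolvent_def by (metis blinfun_eqI)

lemma resolvent_eq: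
  assumes "is_resolvent A z R"
  shows "resolvent A z = R"
  unfolding resolvent_def using assms is_resolvent_unique by blast

text \<open>Since x_n = R (y_n - z x_n), compactness of \<open>R\<close> at one unspecified point
  \<open>z\<close> becomes compactness of graph-norm balls. In this form it can be used at any other
  point, such as the real \<open>t\<close> of \<open>eigenvectors_complete\<close>.\<close>

lemma compact_resolvent_subsequence:
  fixes A :: "'a::complex_hilbert graph"
  assumes "compact_resolvent A" and xy: "\<And>n. (x n, y n) \<in> A"
    and bx: "\<And>n. norm (x n) \<le> B" and "by": "\<And>n. norm (y n) \<le> B"
  shows "\<exists>l s. strict_mono (s :: nat \<Rightarrow> nat) \<and> (x \<circ> s) \<longlonglongrightarrow> l"
proof -
  obtain z R where R: "is_resolvent A z R" and "compact_operator R"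
    using assms(1) resolvent_eq unfolding compact_resolvent_def spectrum_def by fastforce
  then have co: "compact (closure (R ` cball 0 1))" by (simp add: compact_operator_def)
  \<comment> \<open>A bound for the arguments of \<open>R\<close>, used to scale them into the unit
    ball; the summand 1 keeps it positive when \<open>B = 0\<close>.\<close>
  define b where "b = (1 + cmod z) * B + 1"
  have B0: "0 \<le> B" using bx[of 0] norm_ge_zero order_trans by blast
  then have b: "b > 0" by (simp add: b_def add_nonneg_pos)
  have xR: "x n = R (y n - z *\<^sub>C x n)" for n
    using R xy[of n] unfolding is_resolvent_def by (metis diff_add_cancel)
  define u where "u n = (1/b) *\<^sub>R (y n - z *\<^sub>C x n)" for n
  have "norm (u n) \<le> 1" for n
  proof -
    have "norm (y n - z *\<^sub>C x n) \<le> B + cmod z * B"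
      by (rule order_trans[OF norm_triangle_ineq4 add_mono[OF "by"]])
        (simp add: norm_scaleC bx mult_left_mono)
    also have "\<dots> \<le> b" by (simp add: b_def algebra_simps)
    finally show ?thesis using b by (simp add: u_def)
  qed
  then have "R (u n) \<in> closure (R ` cball 0 1)" for n
    by (intro closure_subset[THEN subsetD] imageI) simp
  then obtain l and s :: "nat \<Rightarrow> nat" where s: "strict_mono s" and l: "((\<lambda>n. R (u n)) \<circ> s) \<longlonglongrightarrow> l"
    using co unfolding compact_def by (metis (no_types, lifting))
  have "x n = b *\<^sub>R R (u n)" for n
    using b xR[of n] by (simp add: u_def blinfun.scaleR_right)
  then have "x \<circ> s = (\<lambda>n. b *\<^sub>R ((\<lambda>n. R (u n)) \<circ> s) n)" by auto
  moreover have "(\<lambda>n. b *\<^sub>R ((\<lambda>n. R (u n)) \<circ> s) n) \<longlonglongrightarrow> b *\<^sub>R l" by (intro tendsto_intros l)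
  ultimately show ?thesis using s by metis
qed

text \<open>On the orthogonal complement \<open>N\<close> of all eigenvectors, a maximising sequence for the norm of
  the compact operator \<open>T = (A - t)\<^sup>-\<^sup>1\<close> would converge to a vector \<open>v\<close> with \<open>T\<^sup>2v = \<alpha>\<^sup>2v\<close>, and then
  \<open>v\<close> or \<open>Tv + \<alpha>v\<close> would be an eigenvector of \<open>A\<close> in \<open>N\<close>.\<close>

lemma eigenvectors_complete:
  fixes A :: "'a::complex_hilbert graph"
  assumes A: "self_adjoint A" and co: "compact_resolvent A" and sb: "semibounded_below A"
    and u: "\<And>s e. (e, s *\<^sub>R e) \<in> A \<Longrightarrow> cinner u e = 0"
  shows "u = 0"
proof (rule ccontr)
  assume u0: "u \<noteq> 0"
  obtain c where lb: "\<And>x y. (x, y) \<in> A \<Longrightarrow> c * (norm x)\<^sup>2 \<le> Re (cinner y x)"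
    using sb unfolding semibounded_below_def by blast
  \<comment> \<open>Distance 1 from the form bound makes the inverse \<open>T\<close> of A - t a
    contraction.\<close>
  define t where "t = c - 1"
  have t: "t < c" by (simp add: t_def)
  obtain T where T: "\<And>w. (T w, w + t *\<^sub>R T w) \<in> A"
    using semibounded_solvable[OF A lb t] by metis
  have T_le: "norm x \<le> norm (y - t *\<^sub>R x)" if "(x, y) \<in> A" for x y
    using semibounded_lower_bound[OF lb that, of t] by (simp add: t_def)
  have T_eqI: "T w = x" if "(x, w + t *\<^sub>R x) \<in> A" for w x
    using T_le[OF self_adjoint_diff[OF A T[of w] that]] by (simp add: algebra_simps)
  have T_norm: "norm (T w) \<le> norm w" for w using T_le[OF T[of w]] by simp
  have T_add: "T (a + b) = T a + T b" for a b
    by (rule T_eqI) (use self_adjoint_add[OF A T[of a] T[of b]] in \<open>simp add: algebra_simps\<close>)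
  have T_scale: "T (s *\<^sub>R a) = s *\<^sub>R T a" for s a
    by (rule T_eqI) (use self_adjoint_scaleR[OF A T[of a], of s] in \<open>simp add: algebra_simps\<close>)
  interpret T: bounded_linear T
    by (rule bounded_linear_intro[where K = 1]) (simp_all add: T_add T_scale T_norm)
  have T_sym: "cinner (T a) b = cinner a (T b)" for a b
    using self_adjoint_symmetric[OF A T[of a] T[of b]]
    by (simp add: cinner.add_left cinner.add_right cinner.scaleR_left cinner.scaleR_right)
  have T_inj: "w = 0" if "T w = 0" for w
    using T[of w] self_adjoint_zero_left[OF A, of w] that by simp
  define N where "N = {x. \<forall>s e. (e, s *\<^sub>R e) \<in> A \<longrightarrow> cinner x e = 0}"
  have N_T: "T x \<in> N" if x: "x \<in> N" for x
    unfolding N_def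
  proof (intro CollectI allI impI)
    fix s e assume e: "(e, s *\<^sub>R e) \<in> A"
    have "cinner x e = 0" using x e unfolding N_def by blast
    then have "cinner e x = 0" by (rule cinner_eq_0_swap[THEN iffD1])
    with self_adjoint_symmetric[OF A e T[of x]] have "of_real (s - t) * cinner e (T x) = 0"
      by (simp add: cinner.scaleR_left cinner.add_right cinner.scaleR_right scaleR_conv_of_real algebra_simps)
    \<comment> \<open>By the lower bound \<open>T_le\<close> the point \<open>t\<close> is not an
      eigenvalue.\<close>
    moreover have "s \<noteq> t" if "e \<noteq> 0" using T_le[OF e] that by auto
    ultimately have "cinner e (T x) = 0" by (cases "e = 0") auto
    then show "cinner (T x) e = 0" by (rule cinner_eq_0_swap[THEN iffD1])
  qed
  have N_scale: "s *\<^sub>R x \<in> N" if "x \<in> N" for s x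
    using that unfolding N_def by (auto simp: cinner.scaleR_left)
  have N_add: "x + y \<in> N" if "x \<in> N" "y \<in> N" for x y
    using that unfolding N_def by (auto simp: cinner.add_left)
  have N_lim: "a \<in> N" if "\<And>n. f n \<in> N" "f \<longlonglongrightarrow> a" for f a
    unfolding N_def
  proof (intro CollectI allI impI)
    fix s e assume e: "(e, s *\<^sub>R e) \<in> A"
    have "(\<lambda>n. cinner (f n) e) \<longlonglongrightarrow> cinner a e" by (intro cinner.tendsto tendsto_const that)
    moreover have "cinner (f n) e = 0" for n using that(1)[of n] e unfolding N_def by blast
    ultimately show "cinner a e = 0" by (simp add: LIMSEQ_const_iff)
  qed
  define U where "U = {x \<in> N. norm x = 1}"
  define \<alpha> where "\<alpha> = (SUP x\<in>U. norm (T x))"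
  have uU: "(1 / norm u) *\<^sub>R u \<in> U" using u u0 by (auto simp: U_def N_def cinner.scaleR_left)
  have bdd: "bdd_above ((\<lambda>x. norm (T x)) ` U)"
    by (rule bdd_aboveI[of _ 1]) (use T_norm in \<open>auto simp: U_def\<close>, metis T_norm)
  have le_alpha: "norm (T x) \<le> \<alpha> * norm x" if "x \<in> N" for x
  proof (cases "x = 0")
    case False
    have "(1 / norm x) *\<^sub>R x \<in> U" using that False by (simp add: U_def N_scale)
    then have "norm (T ((1 / norm x) *\<^sub>R x)) \<le> \<alpha>" unfolding \<alpha>_def by (rule cSUP_upper[OF _ bdd])
    then show ?thesis using False by (simp add: T_scale field_simps)
  qed (simp add: T.zero)
  have "0 < norm (T ((1 / norm u) *\<^sub>R u))" using T_inj uU u0 by fastforce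
  also have "\<dots> \<le> \<alpha>" unfolding \<alpha>_def by (rule cSUP_upper[OF uU bdd])
  finally have a0: "\<alpha> > 0" .
  have "\<exists>x\<in>U. \<alpha> - 1 / real (Suc n) < norm (T x)" for n
    using less_cSUP_iff[OF _ bdd, of "\<alpha> - 1 / real (Suc n)"] uU unfolding \<alpha>_def[symmetric] by force
  then obtain x where xU: "\<And>n. x n \<in> U" and xa: "\<And>n. \<alpha> - 1 / real (Suc n) < norm (T (x n))" by metis
  have xN: "x n \<in> N" and x1: "norm (x n) = 1" for n using xU[of n] by (auto simp: U_def)
  have Tx_lim: "(\<lambda>n. norm (T (x n))) \<longlonglongrightarrow> \<alpha>"
  proof (rule tendsto_sandwich[OF _ _ _ tendsto_const])
    show "(\<lambda>n. \<alpha> - 1 / real (Suc n)) \<longlonglongrightarrow> \<alpha>"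
      using tendsto_diff[OF tendsto_const LIMSEQ_inverse_real_of_nat, of \<alpha>] by (simp add: inverse_eq_divide)
    show "\<forall>\<^sub>F n in sequentially. \<alpha> - 1 / real (Suc n) \<le> norm (T (x n))"
      by (intro always_eventually allI less_imp_le xa)
    show "\<forall>\<^sub>F n in sequentially. norm (T (x n)) \<le> \<alpha>"
      using le_alpha[OF xN] x1 by (intro always_eventually allI) simp
  qed
  \<comment> \<open>Expand the square, using that (T^2 x, x) is the squared norm of T x and that
    \<open>\<alpha>\<close> bounds \<open>T\<close> on \<open>N\<close>. Along the maximising
    sequence the right-hand side tends to 0.\<close>
  have sq_le: "(norm (T (T (x n)) - \<alpha>\<^sup>2 *\<^sub>R x n))\<^sup>2 \<le> \<alpha>\<^sup>2 * (\<alpha>\<^sup>2 - (norm (T (x n)))\<^sup>2)" for n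
  proof -
    have "inner (T (T (x n))) (x n) = (norm (T (x n)))\<^sup>2"
      by (metis T_sym Re_cinner power2_norm_eq_inner)
    then have "(norm (T (T (x n)) - \<alpha>\<^sup>2 *\<^sub>R x n))\<^sup>2
        = (norm (T (T (x n))))\<^sup>2 - 2 * \<alpha>\<^sup>2 * (norm (T (x n)))\<^sup>2 + \<alpha>\<^sup>2 * \<alpha>\<^sup>2 * (norm (x n))\<^sup>2"
      by (simp add: power2_norm_eq_inner inner_diff inner_commute)
    moreover have "(norm (T (T (x n))))\<^sup>2 \<le> \<alpha>\<^sup>2 * (norm (T (x n)))\<^sup>2"
      using power_mono[OF le_alpha[OF N_T[OF xN[of n]]], where n = 2] by (simp add: power_mult_distrib)
    ultimately show ?thesis using x1[of n] by (simp add: algebra_simps)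
  qed
  have "(\<lambda>n. \<alpha>\<^sup>2 * (\<alpha>\<^sup>2 - (norm (T (x n)))\<^sup>2)) \<longlonglongrightarrow> \<alpha>\<^sup>2 * (\<alpha>\<^sup>2 - \<alpha>\<^sup>2)" by (intro tendsto_intros Tx_lim)
  then have lim0: "(\<lambda>n. \<alpha>\<^sup>2 * (\<alpha>\<^sup>2 - (norm (T (x n)))\<^sup>2)) \<longlonglongrightarrow> 0" by simp
  have "(\<lambda>n. (norm (T (T (x n)) - \<alpha>\<^sup>2 *\<^sub>R x n))\<^sup>2) \<longlonglongrightarrow> 0"
    by (rule tendsto_sandwich[OF _ _ tendsto_const lim0]) (use sq_le in simp_all)
  then have "(\<lambda>n. sqrt ((norm (T (T (x n)) - \<alpha>\<^sup>2 *\<^sub>R x n))\<^sup>2)) \<longlonglongrightarrow> sqrt 0" by (rule tendsto_real_sqrt)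
  then have diff0: "(\<lambda>n. T (T (x n)) - \<alpha>\<^sup>2 *\<^sub>R x n) \<longlonglongrightarrow> 0"
    by (simp add: tendsto_norm_zero_iff)
  have nT: "norm (T (x n)) \<le> 1" "norm (T (T (x n))) \<le> 1" for n
    using T_norm[of "x n"] T_norm[of "T (x n)"] x1[of n] by linarith+
  have "norm (T (x n) + t *\<^sub>R T (T (x n))) \<le> 1 + \<bar>t\<bar>" for n
    by (rule order_trans[OF norm_triangle_ineq add_mono]) (use nT in \<open>simp_all add: mult_left_le\<close>)
  with compact_resolvent_subsequence[OF co T, of "\<lambda>n. T (x n)" "1 + \<bar>t\<bar>"] nT(2)
  obtain l and s :: "nat \<Rightarrow> nat" where s: "strict_mono s" and l: "((\<lambda>n. T (T (x n))) \<circ> s) \<longlonglongrightarrow> l"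
    by (smt (verit, best) abs_ge_zero)
  define v where "v = (1 / \<alpha>\<^sup>2) *\<^sub>R l"
  \<comment> \<open>Compactness acts on T^2 x_n. As T^2 x_n - \<alpha>^2 x_n tends to 0 and
    \<open>\<alpha>\<close> is nonzero, convergence passes back to x_n itself, so the limit has norm
    1.\<close>
  have "(\<lambda>n. (1 / \<alpha>\<^sup>2) *\<^sub>R (T (T (x (s n))) - (T (T (x (s n))) - \<alpha>\<^sup>2 *\<^sub>R x (s n)))) \<longlonglongrightarrow> (1 / \<alpha>\<^sup>2) *\<^sub>R (l - 0)"
    by (intro tendsto_intros l[unfolded o_def] LIMSEQ_subseq_LIMSEQ[OF diff0 s, unfolded o_def])
  then have xv: "(\<lambda>n. x (s n)) \<longlonglongrightarrow> v" using a0 by (simp add: v_def)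
  have vN: "v \<in> N" by (rule N_lim[OF _ xv]) (rule xN)
  have "(\<lambda>n. norm (x (s n))) \<longlonglongrightarrow> norm v" by (intro tendsto_intros xv)
  then have v1: "norm v = 1" using x1 by (simp add: LIMSEQ_const_iff)
  have "(\<lambda>n. T (T (x (s n)))) \<longlonglongrightarrow> T (T v)" by (intro T.tendsto xv)
  then have "T (T v) = l" using l unfolding o_def by (rule LIMSEQ_unique)
  then have TTv: "T (T v) = \<alpha>\<^sup>2 *\<^sub>R v" using a0 by (simp add: v_def)
  have "\<exists>w \<beta>. w \<in> N \<and> w \<noteq> 0 \<and> \<beta> \<noteq> 0 \<and> T w = \<beta> *\<^sub>R w"
  proof (cases "T v + \<alpha> *\<^sub>R v = 0")
    case True
    then have "T v = (- \<alpha>) *\<^sub>R v" by (simp add: eq_neg_iff_add_eq_0)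
    moreover have "- \<alpha> \<noteq> 0" "v \<noteq> 0" using a0 v1 by auto
    ultimately show ?thesis using vN by blast
  next
    case False
    have "T (T v + \<alpha> *\<^sub>R v) = \<alpha> *\<^sub>R (T v + \<alpha> *\<^sub>R v)"
      by (simp add: T_add T_scale TTv power2_eq_square algebra_simps)
    moreover have "T v + \<alpha> *\<^sub>R v \<in> N" using vN N_T N_add N_scale by blast
    ultimately show ?thesis using False a0 by (metis less_irrefl)
  qed
  then obtain w \<beta> where w: "w \<in> N" "w \<noteq> 0" "\<beta> \<noteq> 0" "T w = \<beta> *\<^sub>R w" by blast
  have "((1 / \<beta>) *\<^sub>R T w, (1 / \<beta>) *\<^sub>R (w + t *\<^sub>R T w)) \<in> A" by (rule self_adjoint_scaleR[OF A T])
  then have "(w, (1 / \<beta> + t) *\<^sub>R w) \<in> A" using w(3,4) by (simp add: algebra_simps)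
  then have "cinner w w = 0" using w(1) unfolding N_def by blast
  then show False using w(2) by (simp add: cinner_self)
qed

section \<open>Orthogonal families and diagonal operators\<close>

text \<open>Comparing with the fixed set \<open>F0\<close>, instead of two arbitrary large sets with
  each other, leaves only the difference \<open>F - F0\<close> to estimate in applications.\<close>

lemma summable_on_CauchyI:
  fixes f :: "'i \<Rightarrow> 'a::banach"
  assumes "\<And>e. e > 0 \<Longrightarrow> \<exists>F0. finite F0 \<and> F0 \<subseteq> A \<and>
    (\<forall>F. finite F \<longrightarrow> F0 \<subseteq> F \<longrightarrow> F \<subseteq> A \<longrightarrow> dist (sum f F) (sum f F0) < e)"
  shows "f summable_on A"
proof -
  have "\<exists>P. eventually P (finite_subsets_at_top A) \<and>
      (\<forall>F F'. P F \<and> P F' \<longrightarrow> dist (sum f F) (sum f F') < e)" if e: "e > 0" for e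
  proof -
    obtain F0 where F0: "finite F0" "F0 \<subseteq> A"
      and d: "\<And>F. finite F \<Longrightarrow> F0 \<subseteq> F \<Longrightarrow> F \<subseteq> A \<Longrightarrow> dist (sum f F) (sum f F0) < e / 2"
      using assms[of "e / 2"] e by auto
    show ?thesis
    proof (intro exI[of _ "\<lambda>F. finite F \<and> F0 \<subseteq> F \<and> F \<subseteq> A"] conjI allI impI)
      show "\<forall>\<^sub>F F in finite_subsets_at_top A. finite F \<and> F0 \<subseteq> F \<and> F \<subseteq> A"
        using F0 unfolding eventually_finite_subsets_at_top by blast
      fix F F' assume "(finite F \<and> F0 \<subseteq> F \<and> F \<subseteq> A) \<and> finite F' \<and> F0 \<subseteq> F' \<and> F' \<subseteq> A"
      then show "dist (sum f F) (sum f F') < e"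
        using d[of F] d[of F'] dist_triangle_half_l by blast
    qed
  qed
  then have "cauchy_filter (filtermap (sum f) (finite_subsets_at_top A))"
    by (simp add: cauchy_filter_metric_filtermap)
  moreover have "complete (UNIV::'a set)"
    by (meson Cauchy_convergent UNIV_I complete_def convergent_def)
  ultimately obtain l where "(sum f \<longlongrightarrow> l) (finite_subsets_at_top A)"
    using complete_uniform[where S = UNIV] by (force simp add: filterlim_def)
  then show ?thesis unfolding summable_on_def has_sum_def by blast
qed

lemma norm_sum_sq_orthogonal:
  fixes v :: "'i \<Rightarrow> 'a::complex_hilbert"
  assumes "finite F" and "\<And>i j. i \<in> F \<Longrightarrow> j \<in> F \<Longrightarrow> i \<noteq> j \<Longrightarrow> cinner (v i) (v j) = 0"
  shows "(norm (sum v F))\<^sup>2 = (\<Sum>i\<in>F. (norm (v i))\<^sup>2)"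
  using assms
proof (induction F rule: finite_induct)
  case (insert i F)
  have "cinner (v i) (sum v F) = (\<Sum>j\<in>F. cinner (v i) (v j))" by (rule cinner.sum_right)
  also have "\<dots> = 0" using insert by (intro sum.neutral) auto
  finally show ?case using insert by (simp add: norm_add_sq_orthogonal)
qed simp

text \<open>By Pythagoras the squared norm of the sum over \<open>F - F0\<close> is the
  corresponding scalar sum, so scalar convergence carries over although the norms themselves need
  not be summable.\<close>

lemma orthogonal_summable_on:
  fixes v :: "'i \<Rightarrow> 'a::complex_hilbert"
  assumes orth: "\<And>i j. i \<in> A \<Longrightarrow> j \<in> A \<Longrightarrow> i \<noteq> j \<Longrightarrow> cinner (v i) (v j) = 0"
    and sq: "(\<lambda>i. (norm (v i))\<^sup>2) summable_on A"
  shows "v summable_on A"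
proof (rule summable_on_CauchyI)
  fix e :: real assume e: "e > 0"
  define q where "q i = (norm (v i))\<^sup>2" for i
  obtain S where "(q has_sum S) A" using sq unfolding q_def summable_on_def by blast
  then have "\<forall>\<^sub>F F in finite_subsets_at_top A. dist (sum q F) S < e\<^sup>2 / 2"
    unfolding has_sum_def by (rule tendstoD) (use e in simp)
  then obtain F0 where F0: "finite F0" "F0 \<subseteq> A"
    and d: "\<And>F. finite F \<Longrightarrow> F0 \<subseteq> F \<Longrightarrow> F \<subseteq> A \<Longrightarrow> dist (sum q F) S < e\<^sup>2 / 2"
    unfolding eventually_finite_subsets_at_top by metis
  have "dist (sum v F) (sum v F0) < e" if F: "finite F" "F0 \<subseteq> F" "F \<subseteq> A" for F
  proof -
    have "(norm (sum v F - sum v F0))\<^sup>2 = (norm (sum v (F - F0)))\<^sup>2"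
      using F by (simp add: sum_diff)
    also have "\<dots> = sum q (F - F0)"
      unfolding q_def by (rule norm_sum_sq_orthogonal) (use F in simp, use F orth in blast)
    also have "\<dots> = sum q F - sum q F0" using F by (simp add: sum_diff)
    also have "\<dots> < e\<^sup>2" using d[OF F] d[OF F0(1) order_refl F0(2)] unfolding dist_real_def by linarith
    finally show ?thesis using e by (simp add: dist_norm power2_less_imp_less)
  qed
  then show "\<exists>F0. finite F0 \<and> F0 \<subseteq> A \<and>
      (\<forall>F. finite F \<longrightarrow> F0 \<subseteq> F \<longrightarrow> F \<subseteq> A \<longrightarrow> dist (sum v F) (sum v F0) < e)"
    using F0 by blast
qed

text \<open>Completeness is stated as totality: only the zero vector has all components zero.
  Equalities of vectors can then be checked component by component (\<open>P_eqI\<close>), and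
  convergence of the expansion becomes a consequence (\<open>has_sum_P\<close>).\<close>

locale orthogonal_resolution =
  fixes P :: "nat \<Rightarrow> 'b::complex_hilbert \<Rightarrow>\<^sub>L 'b"
  assumes P_scaleC: "P j (c *\<^sub>C x) = c *\<^sub>C P j x"
    and P_symmetric: "cinner (P j x) y = cinner x (P j y)"
    and P_P: "P j (P k x) = (if j = k then P j x else 0)"
    and P_complete: "(\<And>j. P j x = 0) \<Longrightarrow> x = 0"
begin

lemma P_eqI:
  assumes "\<And>j. P j x = P j y"
  shows "x = y"
  using P_complete[of "x - y"] assms by (simp add: blinfun.diff_right)

lemma P_orthogonal:
  assumes "j \<noteq> k"
  shows "cinner (P j x) (P k y) = 0"
  using assms by (simp add: P_symmetric P_P)

lemma bessel:
  assumes "finite F"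
  shows "(\<Sum>j\<in>F. (norm (P j x))\<^sup>2) \<le> (norm x)\<^sup>2"
proof -
  define s where "s = (\<Sum>j\<in>F. P j x)"
  have "cinner (x - s) s = (\<Sum>j\<in>F. cinner (P j (x - s)) (P j x))"
    unfolding s_def by (simp add: cinner.sum_right P_symmetric P_P)
  also have "\<dots> = 0"
  proof (rule sum.neutral, intro ballI)
    fix j assume j: "j \<in> F"
    have "P j s = P j x"
      unfolding s_def using j assms by (simp add: blinfun.sum_right P_P sum.delta)
    then show "cinner (P j (x - s)) (P j x) = 0" by (simp add: blinfun.diff_right)
  qed
  finally have "(norm s)\<^sup>2 \<le> (norm x)\<^sup>2" using norm_add_sq_orthogonal[of "x - s" s] by simp
  moreover have "(norm s)\<^sup>2 = (\<Sum>j\<in>F. (norm (P j x))\<^sup>2)"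
    unfolding s_def by (rule norm_sum_sq_orthogonal[OF assms P_orthogonal])
  ultimately show ?thesis by simp
qed

lemma norm_P_le: "norm (P j x) \<le> norm x"
  using bessel[of "{j}" x] by (auto intro: power2_le_imp_le)

lemma square_summable: "(\<lambda>j. (norm (P j x))\<^sup>2) summable_on I"
proof (rule nonneg_bdd_above_summable_on)
  show "bdd_above (sum (\<lambda>j. (norm (P j x))\<^sup>2) ` {F. F \<subseteq> I \<and> finite F})"
    using bessel by (intro bdd_aboveI[of _ "(norm x)\<^sup>2"]) auto
qed simp

text \<open>The functional calculus of a diagonal operator. The infinite sum has the default value 0
  when it diverges, which is why every fact about it carries a bound on
  \<open>\<phi>\<close>.\<close>

definition mult_sum :: "(nat \<Rightarrow> complex) \<Rightarrow> 'b \<Rightarrow> 'b"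
  where "mult_sum \<phi> x = (\<Sum>\<^sub>\<infinity>j. \<phi> j *\<^sub>C P j x)"

lemma has_sum_mult_sum:
  assumes "\<And>j. cmod (\<phi> j) \<le> B"
  shows "((\<lambda>j. \<phi> j *\<^sub>C P j x) has_sum mult_sum \<phi> x) UNIV"
  unfolding mult_sum_def
proof (rule has_sum_infsum, rule orthogonal_summable_on)
  fix i j :: nat assume "i \<noteq> j"
  then show "cinner (\<phi> i *\<^sub>C P i x) (\<phi> j *\<^sub>C P j x) = 0"
    by (simp add: cinner_scaleC_left cinner_scaleC_right P_orthogonal)
next
  have B: "B \<ge> 0" using assms norm_ge_zero order_trans by blast
  show "(\<lambda>j. (norm (\<phi> j *\<^sub>C P j x))\<^sup>2) summable_on UNIV"
  proof (rule summable_on_comparison_test)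
    show "(\<lambda>j. B\<^sup>2 * (norm (P j x))\<^sup>2) summable_on UNIV"
      by (rule summable_on_cmult_right[OF square_summable])
    show "(norm (\<phi> j *\<^sub>C P j x))\<^sup>2 \<le> B\<^sup>2 * (norm (P j x))\<^sup>2" for j
      using assms[of j] B by (simp add: norm_scaleC power_mult_distrib mult_right_mono power_mono)
  qed simp
qed

lemma P_mult_sum:
  assumes "\<And>j. cmod (\<phi> j) \<le> B"
  shows "P k (mult_sum \<phi> x) = \<phi> k *\<^sub>C P k x"
proof -
  have "((\<lambda>j. P k (\<phi> j *\<^sub>C P j x)) has_sum P k (mult_sum \<phi> x)) UNIV"
    by (rule has_sum_bounded_linear[OF blinfun.bounded_linear_right has_sum_mult_sum[OF assms]])
  moreover have "((\<lambda>j. P k (\<phi> j *\<^sub>C P j x)) has_sum \<phi> k *\<^sub>C P k x) UNIV"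
    by (rule has_sum_finite_neutralI[of "{k}"]) (auto simp: P_scaleC P_P)
  ultimately show ?thesis by (rule has_sum_unique)
qed

lemma norm_mult_sum:
  assumes "\<And>j. cmod (\<phi> j) \<le> B"
  shows "norm (mult_sum \<phi> x) \<le> B * norm x"
proof -
  have B: "B \<ge> 0" using assms norm_ge_zero order_trans by blast
  show ?thesis
  proof (rule tendsto_upperbound)
    show "((\<lambda>F. norm (\<Sum>j\<in>F. \<phi> j *\<^sub>C P j x)) \<longlongrightarrow> norm (mult_sum \<phi> x)) (finite_subsets_at_top UNIV)"
      using has_sum_mult_sum[OF assms] unfolding has_sum_def by (rule tendsto_norm)
    have "norm (\<Sum>j\<in>F. \<phi> j *\<^sub>C P j x) \<le> B * norm x" if "finite F" for F
    proof (rule power2_le_imp_le)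
      have "(norm (\<Sum>j\<in>F. \<phi> j *\<^sub>C P j x))\<^sup>2 = (\<Sum>j\<in>F. (norm (\<phi> j *\<^sub>C P j x))\<^sup>2)"
        by (rule norm_sum_sq_orthogonal[OF that])
          (simp add: cinner_scaleC_left cinner_scaleC_right P_orthogonal)
      also have "\<dots> \<le> (\<Sum>j\<in>F. B\<^sup>2 * (norm (P j x))\<^sup>2)"
        using assms B
        by (intro sum_mono) (simp add: norm_scaleC power_mult_distrib mult_right_mono power_mono)
      also have "\<dots> \<le> B\<^sup>2 * (norm x)\<^sup>2"
        using bessel[OF that] by (simp add: sum_distrib_left[symmetric] mult_left_mono)
      finally show "(norm (\<Sum>j\<in>F. \<phi> j *\<^sub>C P j x))\<^sup>2 \<le> (B * norm x)\<^sup>2" by (simp add: power_mult_distrib)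
    qed (use B in simp)
    then show "\<forall>\<^sub>F F in finite_subsets_at_top UNIV. norm (\<Sum>j\<in>F. \<phi> j *\<^sub>C P j x) \<le> B * norm x"
      by (intro eventually_finite_subsets_at_top_weakI)
  qed simp
qed

definition diag :: "(nat \<Rightarrow> complex) \<Rightarrow> 'b \<Rightarrow>\<^sub>L 'b"
  where "diag \<phi> = Blinfun (mult_sum \<phi>)"

lemma diag_apply:
  assumes "\<And>j. cmod (\<phi> j) \<le> B"
  shows "diag \<phi> x = mult_sum \<phi> x"
proof -
  note P = P_mult_sum[of \<phi> B, OF assms]
  have "bounded_linear (mult_sum \<phi>)"
  proof (rule bounded_linear_intro[where K = B])
    show "mult_sum \<phi> (x + y) = mult_sum \<phi> x + mult_sum \<phi> y" for x y
      by (rule P_eqI) (simp add: P blinfun.add_right scaleC_add_right)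
    show "mult_sum \<phi> (s *\<^sub>R x) = s *\<^sub>R mult_sum \<phi> x" for s x
      by (rule P_eqI) (simp add: P blinfun.scaleR_right scaleR_scaleC)
    show "norm (mult_sum \<phi> x) \<le> norm x * B" for x
      using norm_mult_sum[of \<phi> B x, OF assms] by (simp add: mult.commute)
  qed
  then show ?thesis by (simp add: diag_def bounded_linear_Blinfun_apply)
qed

lemma P_diag:
  assumes "\<And>j. cmod (\<phi> j) \<le> B"
  shows "P k (diag \<phi> x) = \<phi> k *\<^sub>C P k x"
  using P_mult_sum[of \<phi> B k x, OF assms] diag_apply[of \<phi> B x, OF assms] by simp

lemma norm_diag:
  assumes "\<And>j. cmod (\<phi> j) \<le> B"
  shows "norm (diag \<phi>) \<le> B"
proof (rule norm_blinfun_bound)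
  show "0 \<le> B" using assms norm_ge_zero order_trans by blast
  show "norm (diag \<phi> x) \<le> B * norm x" for x
    using norm_mult_sum[of \<phi> B x, OF assms] diag_apply[of \<phi> B x, OF assms] by simp
qed

lemma has_sum_P: "((\<lambda>j. P j x) has_sum x) UNIV"
proof -
  have b: "cmod ((\<lambda>_. 1) j) \<le> 1" for j :: nat by simp
  have "mult_sum (\<lambda>_. 1) x = x" by (rule P_eqI) (use P_mult_sum[OF b] in simp)
  then show ?thesis using has_sum_mult_sum[OF b, of x] by simp
qed

end

section \<open>Resolvents and bounded perturbations\<close>

lemma resolvent_identity:
  assumes R: "is_resolvent G z R" and S: "is_resolvent G w S"
  shows "R - S = (z - w) *\<^sub>C (S o\<^sub>L R)"
proof (rule blinfun_eqI)
  fix y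
  have "(R y, y + z *\<^sub>C R y) \<in> G" using R unfolding is_resolvent_def by blast
  then have "(R y, (y + (z - w) *\<^sub>C R y) + w *\<^sub>C R y) \<in> G" by (simp add: scaleC.diff_left)
  then have "S (y + (z - w) *\<^sub>C R y) = R y" using S unfolding is_resolvent_def by blast
  then show "(R - S) y = ((z - w) *\<^sub>C (S o\<^sub>L R)) y"
    using S by (simp add: is_resolvent_def complex_linear_def blinfun.add_right blinfun.diff_left
        scaleC_blinfun.rep_eq algebra_simps)
qed

text \<open>No bound on \<open>R\<close> is known beforehand. The resolvent identity and the
  closeness of \<open>z\<close> to \<open>w\<close> give
  \<open>norm (R - S) \<le> norm R / 2\<close>, hence \<open>norm R \<le> 2 * norm S\<close>, and
  this is inserted into the identity once more.\<close>

lemma norm_resolvent_diff_le: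
  assumes R: "is_resolvent G z R" and S: "is_resolvent G w S" and c: "cmod (z - w) * norm S \<le> 1 / 2"
  shows "norm (R - S) \<le> 2 * (norm S)\<^sup>2 * cmod (z - w)"
proof -
  have le: "norm (R - S) \<le> cmod (z - w) * (norm S * norm R)"
    unfolding resolvent_identity[OF R S] norm_scaleC by (intro mult_left_mono norm_blinfun_compose) simp
  also have "\<dots> = (cmod (z - w) * norm S) * norm R" by simp
  also have "\<dots> \<le> 1 / 2 * norm R" by (intro mult_right_mono c) simp
  finally have "norm (R - S) \<le> norm R / 2" by simp
  moreover have "norm R \<le> norm S + norm (R - S)" using norm_triangle_ineq[of S "R - S"] by simp
  ultimately have "norm R \<le> 2 * norm S" by simp
  then have "cmod (z - w) * (norm S * norm R) \<le> cmod (z - w) * (norm S * (2 * norm S))"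
    by (intro mult_left_mono) auto
  with le show ?thesis by (simp add: power2_eq_square algebra_simps)
qed

lemma isCont_resolvent:
  assumes U: "open U" "w \<in> U" and F: "\<And>z. z \<in> U \<Longrightarrow> is_resolvent G z (F z)"
  shows "isCont F w"
proof -
  have ev: "\<forall>\<^sub>F z in at w. norm (F z - F w) \<le> 2 * (norm (F w))\<^sup>2 * cmod (z - w)"
  proof -
    have "((\<lambda>z. cmod (z - w) * norm (F w)) \<longlongrightarrow> cmod (w - w) * norm (F w)) (at w)" by (intro tendsto_intros)
    then have "\<forall>\<^sub>F z in at w. cmod (z - w) * norm (F w) < 1 / 2" by (rule order_tendstoD) simp
    moreover have "\<forall>\<^sub>F z in at w. z \<in> U" using U by (rule eventually_at_in_open')
    ultimately show ?thesis
      by eventually_elim (rule norm_resolvent_diff_le[OF F F[OF U(2)]], auto)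
  qed
  have "((\<lambda>z. 2 * (norm (F w))\<^sup>2 * cmod (z - w)) \<longlongrightarrow> 2 * (norm (F w))\<^sup>2 * cmod (w - w)) (at w)"
    by (intro tendsto_intros)
  then have "((\<lambda>z. 2 * (norm (F w))\<^sup>2 * cmod (z - w)) \<longlongrightarrow> 0) (at w)" by simp
  with ev have "((\<lambda>z. F z - F w) \<longlongrightarrow> 0) (at w)" by (rule Lim_null_comparison)
  then show ?thesis unfolding isCont_def by (rule Lim_null[THEN iffD2])
qed

text \<open>The resolvent identity turns the difference quotient into the matrix element of
  \<open>F w (F z x)\<close>, so differentiability reduces to continuity of the resolvent.\<close>

lemma holomorphic_resolvent:
  fixes F :: "complex \<Rightarrow> 'a::complex_hilbert \<Rightarrow>\<^sub>L 'a"
  assumes U: "open U" and F: "\<And>z. z \<in> U \<Longrightarrow> is_resolvent G z (F z)"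
  shows "(\<lambda>z. cinner (F z x) y) holomorphic_on U"
  unfolding holomorphic_on_open[OF U]
proof (intro ballI)
  fix w assume w: "w \<in> U"
  have "((\<lambda>z. (cinner (F z x) y - cinner (F w x) y) / (z - w)) \<longlongrightarrow> cinner (F w (F w x)) y) (at w)"
  proof (rule Lim_transform_eventually)
    show "((\<lambda>z. cinner (F w (F z x)) y) \<longlongrightarrow> cinner (F w (F w x)) y) (at w)"
      using isCont_resolvent[OF U w F] unfolding isCont_def
      by (intro cinner.tendsto tendsto_const blinfun.tendsto) auto
    have "\<forall>\<^sub>F z in at w. z \<in> U" "\<forall>\<^sub>F z in at w. z \<noteq> w"
      using U w by (auto intro: eventually_at_in_open' eventually_neq_at_within)
    then show "\<forall>\<^sub>F z in at w. cinner (F w (F z x)) y = (cinner (F z x) y - cinner (F w x) y) / (z - w)"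
    proof eventually_elim
      fix z assume "z \<in> U" "z \<noteq> w"
      from resolvent_identity[OF F[OF \<open>z \<in> U\<close>] F[OF w]]
      have "F z x - F w x = (z - w) *\<^sub>C F w (F z x)"
        by (metis blinfun.diff_left blinfun_apply_blinfun_compose scaleC_blinfun.rep_eq)
      then have "cinner (F z x) y - cinner (F w x) y = (z - w) * cinner (F w (F z x)) y"
        by (metis cinner.diff_left cinner_scaleC_left)
      then show "cinner (F w (F z x)) y = (cinner (F z x) y - cinner (F w x) y) / (z - w)"
        using \<open>z \<noteq> w\<close> by simp
    qed
  qed
  then show "\<exists>f'. ((\<lambda>z. cinner (F z x) y) has_field_derivative f') (at w)"
    unfolding has_field_derivative_iff by blast
qed

lemma op_add_iff: "(x, w) \<in> op_add A X \<longleftrightarrow> (x, w - X x) \<in> A"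
proof
  assume "(x, w - X x) \<in> A"
  then show "(x, w) \<in> op_add A X" unfolding op_add_def by force
qed (auto simp: op_add_def)

lemma scaleC_divide_eq: "a \<noteq> 0 \<Longrightarrow> (1 / a) *\<^sub>C p = q \<longleftrightarrow> p = a *\<^sub>C q"
  by (auto simp: scaleC_scaleC)

text \<open>The solution operator of \<open>x = R (y - X x)\<close> is the resolvent of the perturbed operator.\<close>

lemma resolvent_op_add:
  fixes A :: "'a::complex_hilbert graph"
  assumes R: "is_resolvent A z R" and X: "complex_linear X" and c: "norm (R o\<^sub>L X) < 1"
  obtains S where "is_resolvent (op_add A X) z S" "S = R - (R o\<^sub>L X o\<^sub>L S)" "S = R - (S o\<^sub>L X o\<^sub>L R)"
proof -
  \<comment> \<open>Banach's fixed point theorem in the space of bounded operators replaces the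
    summation of a Neumann series; the contraction constant is
    \<open>norm (R o\<^sub>L X)\<close>.\<close>
  have "\<exists>!S. R - (R o\<^sub>L X o\<^sub>L S) = S"
  proof (rule banach_fix_type[OF norm_ge_zero c], intro allI)
    fix S T :: "'a \<Rightarrow>\<^sub>L 'a"
    have "dist (R - (R o\<^sub>L X o\<^sub>L S)) (R - (R o\<^sub>L X o\<^sub>L T)) = norm ((R o\<^sub>L X) o\<^sub>L (T - S))"
      by (simp add: dist_norm bounded_bilinear.diff_right[OF bounded_bilinear_blinfun_compose])
    also have "\<dots> \<le> norm (R o\<^sub>L X) * dist S T"
      unfolding dist_norm norm_minus_commute[of S T] by (rule norm_blinfun_compose)
    finally show "dist (R - (R o\<^sub>L X o\<^sub>L S)) (R - (R o\<^sub>L X o\<^sub>L T)) \<le> norm (R o\<^sub>L X) * dist S T" .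
  qed
  then obtain S where S: "R - (R o\<^sub>L X o\<^sub>L S) = S" by blast
  have lin: "R (c *\<^sub>C x) = c *\<^sub>C R x" "X (c *\<^sub>C x) = c *\<^sub>C X x" for c x
    using R X by (auto simp: is_resolvent_def complex_linear_def)
  have Sy: "S y = R (y - X (S y))" for y
  proof -
    have "(R - (R o\<^sub>L X o\<^sub>L S)) y = S y" using S by simp
    then show ?thesis by (simp add: blinfun.diff_left blinfun.diff_right)
  qed
  have uniq: "S y = x" if "x = R (y - X x)" for x y
  proof -
    have "S y - x = R (y - X (S y)) - R (y - X x)"
      by (rule arg_cong2[where f = minus, OF Sy that])
    also have "\<dots> = (R o\<^sub>L X) (x - S y)" by (simp add: blinfun.diff_right)
    finally have "S y - x = (R o\<^sub>L X) (x - S y)" .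
    then have "norm (S y - x) \<le> norm (R o\<^sub>L X) * norm (S y - x)"
      by (metis norm_blinfun norm_minus_commute)
    then have "norm (S y - x) = 0"
      using c by (metis mult_le_cancel_right1 norm_ge_zero not_less order_antisym)
    then show ?thesis by simp
  qed
  have "is_resolvent (op_add A X) z S"
    unfolding is_resolvent_def complex_linear_def
  proof (intro conjI allI)
    fix c x
    show "S (c *\<^sub>C x) = c *\<^sub>C S x"
    proof (rule uniq)
      have "R (c *\<^sub>C x - X (c *\<^sub>C S x)) = c *\<^sub>C R (x - X (S x))"
        by (simp add: lin scaleC.diff_right[symmetric])
      then show "c *\<^sub>C S x = R (c *\<^sub>C x - X (c *\<^sub>C S x))" using Sy[of x] by simp
    qed
  next
    fix x y
    have "(x, y + z *\<^sub>C x) \<in> op_add A X \<longleftrightarrow> (x, (y - X x) + z *\<^sub>C x) \<in> A"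
      by (simp add: op_add_iff algebra_simps)
    also have "\<dots> \<longleftrightarrow> R (y - X x) = x" using R by (simp add: is_resolvent_def)
    also have "\<dots> \<longleftrightarrow> S y = x" using uniq Sy by metis
    finally show "S y = x \<longleftrightarrow> (x, y + z *\<^sub>C x) \<in> op_add A X" by simp
  qed
  moreover have "S = R - (S o\<^sub>L X o\<^sub>L R)"
  proof (rule blinfun_eqI)
    fix y
    \<comment> \<open>With right-hand side \<open>y + X (R y)\<close> the vector \<open>R y\<close>
      solves the fixed point equation; this gives the identity with the factors in the other
      order.\<close>
    have "S (y + X (R y)) = R y" by (rule uniq) simp
    then show "S y = (R - (S o\<^sub>L X o\<^sub>L R)) y"
      by (simp add: blinfun.diff_left blinfun.add_right algebra_simps)
  qed
  ultimately show ?thesis using that S by simp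
qed

text \<open>Eigenvalues are numbered from 1 as in the theorem; the index 0 is a dummy with \<open>P 0 = 0\<close>.\<close>

locale perturbed_diagonal = orthogonal_resolution P
  for P :: "nat \<Rightarrow> 'b::complex_hilbert \<Rightarrow>\<^sub>L 'b" +
  fixes A :: "'b graph" and lam :: "nat \<Rightarrow> real" and X :: "'b \<Rightarrow>\<^sub>L 'b"
  assumes P_0: "P 0 = 0"
    and A_iff: "(x, y) \<in> A \<longleftrightarrow> (\<forall>j. P j y = lam j *\<^sub>R P j x)"
    and X_scaleC: "complex_linear X"
begin

text \<open>The value 0 at the dummy index makes the bound \<open>1 / d\<close> hold at every index,
  whatever \<open>lam 0\<close> is.\<close>

definition symbol :: "complex \<Rightarrow> nat \<Rightarrow> complex"
  where "symbol z j = (if j = 0 then 0 else 1 / (of_real (lam j) - z))"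

definition RA :: "complex \<Rightarrow> 'b \<Rightarrow>\<^sub>L 'b"
  where "RA z = diag (symbol z)"

definition RH :: "complex \<Rightarrow> 'b \<Rightarrow>\<^sub>L 'b"
  where "RH = resolvent (op_add A X)"

definition L :: "nat \<Rightarrow> 'b \<Rightarrow>\<^sub>L 'b"
  where "L i = id_blinfun - P i"

definition separated :: "real \<Rightarrow> complex \<Rightarrow> bool"
  where "separated d z \<longleftrightarrow> 0 < d \<and> (\<forall>j\<ge>1. d \<le> cmod (of_real (lam j) - z))"

lemma cmod_symbol_le: "separated d z \<Longrightarrow> cmod (symbol z j) \<le> 1 / d"
  unfolding separated_def symbol_def by (simp add: norm_divide frac_le)

lemma P_RA: "separated d z \<Longrightarrow> P k (RA z x) = symbol z k *\<^sub>C P k x"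
  unfolding RA_def using P_diag[of "symbol z" "1 / d"] cmod_symbol_le by blast

lemma norm_RA: "separated d z \<Longrightarrow> norm (RA z) \<le> 1 / d"
  unfolding RA_def using norm_diag[of "symbol z" "1 / d"] cmod_symbol_le by blast

lemma RA_P:
  assumes "separated d z"
  shows "RA z (P k x) = symbol z k *\<^sub>C P k x"
  by (rule P_eqI) (simp add: P_RA[OF assms] P_P P_scaleC)

lemma RA_L:
  assumes "separated d z"
  shows "RA z o\<^sub>L L i = L i o\<^sub>L RA z"
  by (rule blinfun_eqI)
    (simp add: L_def blinfun.diff_left blinfun.diff_right RA_P[OF assms] P_RA[OF assms])

text \<open>Projecting off the i-th eigenspace deletes \<open>lam i\<close> from the symbol, so the
  bound sees only the distance \<open>d'\<close> of \<open>z\<close> to the other eigenvalues, which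
  may far exceed \<open>d\<close>.\<close>

lemma norm_L_RA:
  assumes s: "separated d z" and d': "0 < d'" "\<And>j. j \<ge> 1 \<Longrightarrow> j \<noteq> i \<Longrightarrow> d' \<le> cmod (of_real (lam j) - z)"
  shows "norm (L i o\<^sub>L RA z) \<le> 1 / d'"
proof -
  define \<phi> where "\<phi> j = (if j = i then 0 else symbol z j)" for j
  have b: "cmod (\<phi> j) \<le> 1 / d'" for j
    using d'(1) d'(2)[of j] unfolding \<phi>_def symbol_def by (simp add: norm_divide frac_le)
  have "L i o\<^sub>L RA z = diag \<phi>"
    by (rule blinfun_eqI, rule P_eqI)
      (simp add: P_diag[of \<phi>, OF b] L_def blinfun.diff_left blinfun.diff_right P_RA[OF s] P_P P_scaleC \<phi>_def)
  then show ?thesis using norm_diag[of \<phi>, OF b] by simp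
qed

lemma RA_is_resolvent:
  assumes s: "separated d z"
  shows "is_resolvent A z (RA z)"
  unfolding is_resolvent_def complex_linear_def
proof (intro conjI allI)
  fix c x
  show "RA z (c *\<^sub>C x) = c *\<^sub>C RA z x"
    by (rule P_eqI) (simp add: P_RA[OF s] P_scaleC scaleC_scaleC mult.commute)
next
  fix x y
  have ne: "of_real (lam k) - z \<noteq> 0" if "k \<ge> 1" for k using s that unfolding separated_def by force
  have "symbol z k *\<^sub>C P k y = P k x \<longleftrightarrow> P k y = (of_real (lam k) - z) *\<^sub>C P k x" if "k \<noteq> 0" for k
    using ne[of k] that by (simp add: symbol_def scaleC_divide_eq)
  moreover have "P k y = (of_real (lam k) - z) *\<^sub>C P k x \<longleftrightarrow> P k (y + z *\<^sub>C x) = lam k *\<^sub>R P k x" for k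
    by (auto simp: blinfun.add_right P_scaleC scaleC.diff_left scaleC_of_real algebra_simps)
  ultimately have "symbol z k *\<^sub>C P k y = P k x \<longleftrightarrow> P k (y + z *\<^sub>C x) = lam k *\<^sub>R P k x" for k
    by (cases "k = 0") (auto simp: P_0)
  then have "(\<forall>k. P k (RA z y) = P k x) \<longleftrightarrow> (x, y + z *\<^sub>C x) \<in> A"
    by (simp add: P_RA[OF s] A_iff)
  then show "RA z y = x \<longleftrightarrow> (x, y + z *\<^sub>C x) \<in> A" using P_eqI by metis
qed

text \<open>The norm bound is read off the fixed point equation by absorbing the term with
  \<open>norm S\<close>. Both orders of the identity are recorded because an outer factor
  \<open>L i\<close> gains decay only when it stands next to \<open>RA z\<close>.\<close>

lemma RH:
  assumes s: "separated d z" and d: "norm X < d"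
  shows RH_is_resolvent: "is_resolvent (op_add A X) z (RH z)"
    and RH_left: "RH z = RA z - (RA z o\<^sub>L X o\<^sub>L RH z)"
    and RH_right: "RH z = RA z - (RH z o\<^sub>L X o\<^sub>L RA z)"
    and norm_RH: "norm (RH z) \<le> 1 / (d - norm X)"
proof -
  have d0: "d > 0" using s by (simp add: separated_def)
  have nle: "norm (RA z o\<^sub>L X) \<le> norm X / d"
    using order_trans[OF norm_blinfun_compose mult_right_mono[OF norm_RA[OF s]]] by simp
  also have "\<dots> < 1" using d d0 by simp
  finally obtain S where S: "is_resolvent (op_add A X) z S" "S = RA z - (RA z o\<^sub>L X o\<^sub>L S)"
      "S = RA z - (S o\<^sub>L X o\<^sub>L RA z)"
    using resolvent_op_add[OF RA_is_resolvent[OF s] X_scaleC] by metis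
  have SH: "S = RH z" unfolding RH_def using resolvent_eq[OF S(1)] by simp
  show "is_resolvent (op_add A X) z (RH z)" "RH z = RA z - (RA z o\<^sub>L X o\<^sub>L RH z)"
    "RH z = RA z - (RH z o\<^sub>L X o\<^sub>L RA z)" using S SH by simp_all
  have "norm S \<le> norm (RA z) + norm (RA z o\<^sub>L X o\<^sub>L S)"
    using norm_triangle_ineq4[of "RA z" "RA z o\<^sub>L X o\<^sub>L S"] S(2) by simp
  also have "\<dots> \<le> 1 / d + norm X / d * norm S"
    by (intro add_mono norm_RA[OF s] order_trans[OF norm_blinfun_compose] mult_right_mono nle) simp
  finally have "norm S * d \<le> 1 + norm X * norm S" using d0 by (simp add: field_simps)
  then have "norm S * (d - norm X) \<le> 1" by (simp add: algebra_simps)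
  then show "norm (RH z) \<le> 1 / (d - norm X)" using d SH by (simp add: field_simps)
qed

end

section \<open>Contour integrals\<close>

lemma vector_derivative_circlepath_at:
  "vector_derivative (circlepath c \<rho>) (at t) = 2 * pi * \<i> * \<rho> * exp (2 * of_real pi * \<i> * t)"
  by (rule vector_derivative_at) (rule has_vector_derivative_circlepath)

lemma cmod_vector_derivative_circlepath:
  "\<rho> \<ge> 0 \<Longrightarrow> cmod (vector_derivative (circlepath c \<rho>) (at t)) = 2 * pi * \<rho>"
  unfolding vector_derivative_circlepath_at by (simp add: norm_mult)

lemma circlepath_in_sphere: "\<rho> \<ge> 0 \<Longrightarrow> circlepath c \<rho> t \<in> sphere c \<rho>"
  unfolding circlepath by (simp add: dist_norm norm_mult)

lemma continuous_on_circle_integrand: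
  assumes "0 \<le> \<rho>" "continuous_on (sphere c \<rho>) F"
  shows "continuous_on {0..1} (\<lambda>t. vector_derivative (circlepath c \<rho>) (at t) *\<^sub>C F (circlepath c \<rho> t))"
proof (rule scaleC.continuous_on)
  show "continuous_on {0..1} (\<lambda>t. vector_derivative (circlepath c \<rho>) (at t))"
    unfolding vector_derivative_circlepath_at by (intro continuous_intros)
  show "continuous_on {0..1} (\<lambda>t. F (circlepath c \<rho> t))"
    by (rule continuous_on_compose2[OF assms(2)])
      (auto simp: circlepath intro!: continuous_intros circlepath_in_sphere[OF assms(1), unfolded circlepath])
qed

lemma line_integral_circle_linear:
  fixes F :: "complex \<Rightarrow> 'a::{complex_normed_vector,banach}" and h :: "'a \<Rightarrow> 'b::{complex_normed_vector,banach}"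
  assumes "0 \<le> \<rho>" "continuous_on (sphere c \<rho>) F" and h: "bounded_linear h" "\<And>a T. h (a *\<^sub>C T) = a *\<^sub>C h T"
  shows "h (line_integral F (circlepath c \<rho>) {0..1}) = line_integral (\<lambda>z. h (F z)) (circlepath c \<rho>) {0..1}"
  unfolding line_integral_def
  using integral_linear[OF integrable_continuous_interval[OF continuous_on_circle_integrand[OF assms(1,2)]] h(1)]
  by (simp add: o_def h(2))

lemma norm_line_integral_circle_le:
  fixes F :: "complex \<Rightarrow> 'a::{complex_normed_vector,banach}"
  assumes "0 \<le> \<rho>" "continuous_on (sphere c \<rho>) F" and B: "\<And>z. z \<in> sphere c \<rho> \<Longrightarrow> norm (F z) \<le> B"
  shows "norm (line_integral F (circlepath c \<rho>) {0..1}) \<le> 2 * pi * \<rho> * B"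
proof -
  have "norm (line_integral F (circlepath c \<rho>) {0..1}) \<le> (2 * pi * \<rho> * B) * (1 - 0)"
    unfolding line_integral_def
  proof (rule integral_bound)
    show "continuous_on {0..1} (\<lambda>t. vector_derivative (circlepath c \<rho>) (at t) *\<^sub>C F (circlepath c \<rho> t))"
      by (rule continuous_on_circle_integrand[OF assms(1,2)])
    show "norm (vector_derivative (circlepath c \<rho>) (at t) *\<^sub>C F (circlepath c \<rho> t)) \<le> 2 * pi * \<rho> * B" for t
      unfolding norm_scaleC cmod_vector_derivative_circlepath[OF assms(1)]
      by (intro mult_left_mono B circlepath_in_sphere assms(1)) (use assms(1) in simp)
  qed simp
  then show ?thesis by simp
qed

lemma line_integral_complex: "line_integral f g {0..1} = contour_integral g (f :: complex \<Rightarrow> complex)"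
  unfolding line_integral_def contour_integral_integral scaleC_complex_def by (simp add: mult.commute)

text \<open>Walking from \<open>b\<close> to each loop, around it and back, one obtains a single loop.\<close>

lemma concatenate_loops:
  fixes g :: "'i \<Rightarrow> real \<Rightarrow> complex"
  assumes S: "open S" "b \<in> S" and "finite I"
    and "\<And>i. i \<in> I \<Longrightarrow> valid_path (g i) \<and> path_image (g i) \<subseteq> S \<and> pathfinish (g i) = pathstart (g i)"
    and "\<And>i. i \<in> I \<Longrightarrow> \<exists>p. valid_path p \<and> path_image p \<subseteq> S \<and> pathstart p = b \<and> pathfinish p = pathstart (g i)"
  shows "\<exists>h. valid_path h \<and> path_image h \<subseteq> S \<and> pathstart h = b \<and> pathfinish h = b \<and>
    (\<forall>f. f holomorphic_on S \<longrightarrow> contour_integral h f = (\<Sum>i\<in>I. contour_integral (g i) f))"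
  using assms(3-5)
proof (induction I rule: finite_induct)
  case empty
  show ?case
    by (rule exI[of _ "linepath b b"])
      (use S in \<open>simp only: valid_path_linepath pathstart_linepath pathfinish_linepath path_image_linepath
        closed_segment_idem contour_integral_trivial sum.empty, simp\<close>)
next
  case (insert i I)
  obtain h where h: "valid_path h" "path_image h \<subseteq> S" "pathstart h = b" "pathfinish h = b"
    and hf: "\<And>f. f holomorphic_on S \<Longrightarrow> contour_integral h f = (\<Sum>i\<in>I. contour_integral (g i) f)"
    using insert.IH insert.prems by (metis insertCI)
  obtain p where p: "valid_path p" "path_image p \<subseteq> S" "pathstart p = b" "pathfinish p = pathstart (g i)"
    using insert.prems(2)[of i] by auto
  have g: "valid_path (g i)" "path_image (g i) \<subseteq> S" "pathfinish (g i) = pathstart (g i)"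
    using insert.prems(1)[of i] by auto
  have eq: "contour_integral (h +++ (p +++ (g i +++ reversepath p))) f
      = contour_integral h f + contour_integral (g i) f" if f: "f holomorphic_on S" for f
  proof -
    note ci = contour_integrable_holomorphic_simple[OF f S(1)]
    have "f contour_integrable_on h" "f contour_integrable_on p" "f contour_integrable_on g i"
      using ci h p g by blast+
    then show ?thesis
      using h p g by (simp add: contour_integral_reversepath contour_integrable_reversepath)
  qed
  have S': "path_image (h +++ (p +++ (g i +++ reversepath p))) \<subseteq> S"
    using h p g by (intro subset_path_image_join) auto
  have "valid_path (h +++ (p +++ (g i +++ reversepath p)))"
    using h p g by (intro valid_path_join) auto
  then show ?case
    using insert.hyps h p g S'
    by (intro exI[of _ "h +++ (p +++ (g i +++ reversepath p))"]) (auto simp: eq hf)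
qed

text \<open>The homology form of Cauchy's theorem is applied to one closed path, the concatenated
  loops followed by the reverse of \<open>G\<close>. Its winding number about a point
  \<open>w\<close> outside \<open>S\<close> is the integral of the function 1 / (z - w), which is
  holomorphic on \<open>S\<close>, so the additivity of integrals also computes winding
  numbers.\<close>

lemma Cauchy_theorem_loops:
  fixes g :: "'i \<Rightarrow> real \<Rightarrow> complex"
  assumes S: "open S" and f: "f holomorphic_on S" and I: "finite I"
    and g: "\<And>i. i \<in> I \<Longrightarrow> valid_path (g i) \<and> path_image (g i) \<subseteq> S \<and> pathfinish (g i) = pathstart (g i)"
    and G: "valid_path G" "path_image G \<subseteq> S" "pathfinish G = pathstart G"
    and conn: "\<And>i. i \<in> I \<Longrightarrow>
      \<exists>p. valid_path p \<and> path_image p \<subseteq> S \<and> pathstart p = pathstart G \<and> pathfinish p = pathstart (g i)"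
    and winding: "\<And>w. w \<notin> S \<Longrightarrow> (\<Sum>i\<in>I. winding_number (g i) w) = winding_number G w"
  shows "(\<Sum>i\<in>I. contour_integral (g i) f) = contour_integral G f"
proof -
  have b: "pathstart G \<in> S" using G(2) by auto
  have "\<exists>h. valid_path h \<and> path_image h \<subseteq> S \<and> pathstart h = pathstart G \<and> pathfinish h = pathstart G \<and>
      (\<forall>f. f holomorphic_on S \<longrightarrow> contour_integral h f = (\<Sum>i\<in>I. contour_integral (g i) f))"
    by (rule concatenate_loops[OF S b I g conn])
  then obtain h where h: "valid_path h" "path_image h \<subseteq> S" "pathstart h = pathstart G" "pathfinish h = pathstart G"
    and hf: "\<And>f. f holomorphic_on S \<Longrightarrow> contour_integral h f = (\<Sum>i\<in>I. contour_integral (g i) f)"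
    by blast
  define k where "k = h +++ reversepath G"
  have k: "valid_path k" "path_image k \<subseteq> S" "pathfinish k = pathstart k"
    using h G unfolding k_def by (auto simp: path_image_join intro!: valid_path_join)
  have kf: "contour_integral k q = (\<Sum>i\<in>I. contour_integral (g i) q) - contour_integral G q"
    if q: "q holomorphic_on S" for q
  proof -
    note ci = contour_integrable_holomorphic_simple[OF q S]
    have "q contour_integrable_on h" "q contour_integrable_on G" using ci h G by blast+
    then show ?thesis unfolding k_def
      using h G hf[OF q] by (simp add: contour_integral_reversepath contour_integrable_reversepath)
  qed
  have "winding_number k w = 0" if w: "w \<notin> S" for w
  proof -
    have wn: "contour_integral p (\<lambda>z. 1 / (z - w)) = 2 * pi * \<i> * winding_number p w"
      if "valid_path p" "path_image p \<subseteq> S" for p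
    proof -
      have "w \<notin> path_image p" using that(2) w by blast
      from winding_number_valid_path[OF that(1) this] show ?thesis by simp
    qed
    have "(\<lambda>z. 1 / (z - w)) holomorphic_on S" using w by (intro holomorphic_intros) auto
    from kf[OF this] have "2 * pi * \<i> * winding_number k w
        = (\<Sum>i\<in>I. 2 * pi * \<i> * winding_number (g i) w) - 2 * pi * \<i> * winding_number G w"
      using g k G by (simp add: wn)
    also have "\<dots> = 0" using winding[OF w] by (simp add: sum_distrib_left[symmetric])
    finally show ?thesis by simp
  qed
  with Cauchy_theorem_global[OF S f k(1,3,2)] have "contour_integral k f = 0"
    by (simp add: contour_integral_unique)
  with kf[OF f] show ?thesis by simp
qed

text \<open>The majorant has the primitive (K / D) arctan (y / D), whose total variation is at most
  K pi / D however long the segment is.\<close>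

lemma vertical_segment_integral_bound:
  fixes f :: "complex \<Rightarrow> complex"
  assumes cont: "continuous_on (closed_segment (Complex a (-Y)) (Complex a Y)) f"
    and D: "D > 0" and K: "K \<ge> 0" and Y: "Y > 0"
    and le: "\<And>y. \<bar>y\<bar> \<le> Y \<Longrightarrow> cmod (f (Complex a y)) \<le> K / (D\<^sup>2 + y\<^sup>2)"
  shows "cmod (contour_integral (linepath (Complex a (-Y)) (Complex a Y)) f) \<le> K * pi / D"
proof -
  let ?l = "linepath (Complex a (-Y)) (Complex a Y)"
  define y where "y t = Y * (2 * t - 1)" for t
  define \<phi> where "\<phi> t = K / D * arctan (y t / D)" for t
  define \<psi> where "\<psi> t = 2 * Y * (K / (D\<^sup>2 + (y t)\<^sup>2))" for t
  have l: "?l t = Complex a (y t)" for t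
    by (simp add: linepath_def y_def complex_eq_iff algebra_simps)
  have "(\<phi> has_vector_derivative \<psi> t) (at t within {0..1})" for t
  proof -
    have "D\<^sup>2 + (y t)\<^sup>2 > 0" using D by (simp add: add_pos_nonneg)
    moreover have "1 + (y t / D)\<^sup>2 = (D\<^sup>2 + (y t)\<^sup>2) / D\<^sup>2" using D by (simp add: field_simps)
    ultimately have eq: "K / D * (inverse (1 + (y t / D)\<^sup>2) * (Y * 2 / D)) = \<psi> t"
      using D unfolding \<psi>_def by (simp add: power2_eq_square field_simps)
    have "(\<phi> has_field_derivative K / D * (inverse (1 + (y t / D)\<^sup>2) * (Y * 2 / D))) (at t within {0..1})"
      unfolding \<phi>_def y_def using D by (auto intro!: derivative_eq_intros)
    then show ?thesis unfolding eq by (simp add: has_real_derivative_iff_has_vector_derivative)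
  qed
  then have \<psi>: "(\<psi> has_integral \<phi> 1 - \<phi> 0) {0..1}"
    by (intro fundamental_theorem_of_calculus) auto
  have "(f has_contour_integral contour_integral ?l f) ?l"
    using cont by (simp add: contour_integrable_continuous_linepath has_contour_integral_integral)
  then have "((\<lambda>t. f (?l t) * (Complex a Y - Complex a (-Y))) has_integral contour_integral ?l f) {0..1}"
    by (simp add: has_contour_integral_linepath)
  moreover have "cmod (f (?l t) * (Complex a Y - Complex a (-Y))) \<le> \<psi> t" if "t \<in> {0..1}" for t
  proof -
    have "\<bar>2 * t - 1\<bar> \<le> 1" using that by (auto simp: abs_le_iff)
    then have "\<bar>y t\<bar> \<le> Y" using Y by (simp add: y_def abs_mult mult_left_le)
    moreover have "Complex a Y - Complex a (-Y) = of_real (2 * Y) * \<i>" by (simp add: complex_eq_iff)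
    then have "cmod (Complex a Y - Complex a (-Y)) = 2 * Y" using Y by (simp only: norm_mult) simp
    moreover have "cmod (f (Complex a (y t))) * (2 * Y) \<le> K / (D\<^sup>2 + (y t)\<^sup>2) * (2 * Y)"
      using le[OF \<open>\<bar>y t\<bar> \<le> Y\<close>] Y by (intro mult_right_mono) auto
    ultimately show ?thesis unfolding norm_mult l \<psi>_def by (simp only: mult.commute)
  qed
  ultimately have "cmod (contour_integral ?l f) \<le> \<phi> 1 - \<phi> 0"
    using integral_norm_bound_integral[of "\<lambda>t. f (?l t) * (Complex a Y - Complex a (-Y))" "{0..1}" \<psi>] \<psi>
    by (metis has_integral_integrable integral_unique)
  also have "\<dots> = K / D * (arctan (Y / D) - arctan (- (Y / D)))"
    by (simp add: \<phi>_def y_def algebra_simps)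
  also have "\<dots> \<le> K / D * pi"
    using arctan_bounded[of "Y / D"] K D by (intro mult_left_mono) (auto simp: arctan_minus)
  finally show ?thesis by simp
qed

lemma rectpath_integral_bound:
  fixes f :: "complex \<Rightarrow> complex"
  assumes cont: "continuous_on (path_image (rectpath (Complex a (-Y)) (Complex b Y))) f"
    and D: "D > 0" and K: "K \<ge> 0" and Y: "Y > 0" and ab: "a \<le> b"
    and lea: "\<And>y. \<bar>y\<bar> \<le> Y \<Longrightarrow> cmod (f (Complex a y)) \<le> K / (D\<^sup>2 + y\<^sup>2)"
    and leb: "\<And>y. \<bar>y\<bar> \<le> Y \<Longrightarrow> cmod (f (Complex b y)) \<le> K / (D\<^sup>2 + y\<^sup>2)"
    and leY: "\<And>x y. \<bar>y\<bar> = Y \<Longrightarrow> cmod (f (Complex x y)) \<le> K / Y\<^sup>2"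
  shows "cmod (contour_integral (rectpath (Complex a (-Y)) (Complex b Y)) f)
    \<le> 2 * K * pi / D + 2 * K * (b - a) / Y\<^sup>2"
proof -
  let ?p = "Complex a (-Y)" and ?q = "Complex b (-Y)" and ?u = "Complex b Y" and ?v = "Complex a Y"
  have img: "path_image (rectpath ?p ?u) = closed_segment ?p ?q \<union> closed_segment ?q ?u \<union>
      closed_segment ?u ?v \<union> closed_segment ?v ?p"
    by (simp add: rectpath_def Let_def path_image_join Un_assoc)
  have c: "continuous_on (closed_segment ?p ?q) f" "continuous_on (closed_segment ?q ?u) f"
    "continuous_on (closed_segment ?u ?v) f" "continuous_on (closed_segment ?v ?p) f"
    by (rule continuous_on_subset[OF cont]; auto simp: img)+
  note i = contour_integrable_continuous_linepath
  have eq: "contour_integral (rectpath ?p ?u) f = contour_integral (linepath ?p ?q) f +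
      contour_integral (linepath ?q ?u) f + contour_integral (linepath ?u ?v) f + contour_integral (linepath ?v ?p) f"
    using c[THEN i] by (simp add: rectpath_def Let_def contour_integrable_join)
  have h: "cmod (contour_integral (linepath (Complex s y) (Complex t y)) f) \<le> K / Y\<^sup>2 * \<bar>t - s\<bar>"
    if y: "\<bar>y\<bar> = Y" and "continuous_on (closed_segment (Complex s y) (Complex t y)) f" for s t y
  proof -
    have "cmod (contour_integral (linepath (Complex s y) (Complex t y)) f)
        \<le> K / Y\<^sup>2 * cmod (Complex t y - Complex s y)"
    proof (rule contour_integral_bound_linepath[OF i[OF that(2)]])
      fix z assume "z \<in> closed_segment (Complex s y) (Complex t y)"
      then have "z = Complex (Re z) y"
        by (auto simp: closed_segment_def complex_eq_iff algebra_simps)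
      then show "cmod (f z) \<le> K / Y\<^sup>2" using leY[OF y] by metis
    qed (use K in simp)
    then show ?thesis by (simp add: cmod_def)
  qed
  have "contour_integral (linepath ?v ?p) f = - contour_integral (linepath ?p ?v) f"
    using c(4) contour_integral_reverse_linepath[of ?p ?v f] by (simp add: closed_segment_commute)
  then have v1: "cmod (contour_integral (linepath ?v ?p) f) \<le> K * pi / D"
    using vertical_segment_integral_bound[OF _ D K Y lea] c(4) by (simp add: closed_segment_commute)
  have v2: "cmod (contour_integral (linepath ?q ?u) f) \<le> K * pi / D"
    by (rule vertical_segment_integral_bound[OF c(2) D K Y leb])
  have h1: "cmod (contour_integral (linepath ?p ?q) f) \<le> K / Y\<^sup>2 * (b - a)"
    using h[OF _ c(1)] Y ab by simp
  have h2: "cmod (contour_integral (linepath ?u ?v) f) \<le> K / Y\<^sup>2 * (b - a)"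
    using h[OF _ c(3)] Y ab by simp
  have "cmod (contour_integral (rectpath ?p ?u) f) \<le> K / Y\<^sup>2 * (b - a) + K * pi / D + K / Y\<^sup>2 * (b - a) + K * pi / D"
    using norm_triangle_ineq[of "contour_integral (linepath ?p ?q) f + contour_integral (linepath ?q ?u) f
        + contour_integral (linepath ?u ?v) f" "contour_integral (linepath ?v ?p) f"]
      norm_triangle_ineq[of "contour_integral (linepath ?p ?q) f + contour_integral (linepath ?q ?u) f"
        "contour_integral (linepath ?u ?v) f"]
      norm_triangle_ineq[of "contour_integral (linepath ?p ?q) f" "contour_integral (linepath ?q ?u) f"]
      h1 h2 v1 v2 unfolding eq by linarith
  then show ?thesis by (simp add: algebra_simps)
qed

section \<open>Riesz projections\<close>

text \<open>The Riesz formula for an arbitrary integrand, so that both resolvents, their difference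
  and their compressions by \<open>L i\<close> can be treated alike.\<close>

definition riesz_integral :: "(complex \<Rightarrow> 'a::complex_normed_vector) \<Rightarrow> complex \<Rightarrow> real \<Rightarrow> 'a"
  where "riesz_integral F c \<rho> = (- 1 / (2 * of_real pi * \<i>)) *\<^sub>C line_integral F (circlepath c \<rho>) {0..1}"

lemma riesz_projection_eq: "riesz_projection H c \<rho> = riesz_integral (resolvent H) c \<rho>"
  by (simp add: riesz_projection_def riesz_integral_def)

text \<open>Instances of \<open>h\<close> below are evaluation at a vector, matrix elements,
  multiplication of a scalar into a fixed vector, and composition with \<open>L i\<close> on either
  side.\<close>

lemma riesz_integral_linear:
  fixes F :: "complex \<Rightarrow> 'a::{complex_normed_vector,banach}" and h :: "'a \<Rightarrow> 'b::{complex_normed_vector,banach}"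
  assumes "0 \<le> \<rho>" "continuous_on (sphere c \<rho>) F" and h: "bounded_linear h" "\<And>a T. h (a *\<^sub>C T) = a *\<^sub>C h T"
  shows "h (riesz_integral F c \<rho>) = riesz_integral (\<lambda>z. h (F z)) c \<rho>"
  unfolding riesz_integral_def h(2) line_integral_circle_linear[OF assms] ..

lemma norm_riesz_integral_le:
  fixes F :: "complex \<Rightarrow> 'a::{complex_normed_vector,banach}"
  assumes "0 \<le> \<rho>" "continuous_on (sphere c \<rho>) F" "\<And>z. z \<in> sphere c \<rho> \<Longrightarrow> norm (F z) \<le> B"
  shows "norm (riesz_integral F c \<rho>) \<le> \<rho> * B"
proof -
  have "norm (riesz_integral F c \<rho>) = 1 / (2 * pi) * norm (line_integral F (circlepath c \<rho>) {0..1})"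
    by (simp add: riesz_integral_def norm_scaleC norm_divide norm_mult)
  also have "\<dots> \<le> 1 / (2 * pi) * (2 * pi * \<rho> * B)"
    by (intro mult_left_mono norm_line_integral_circle_le assms) auto
  finally show ?thesis by simp
qed

lemma riesz_integral_complex:
  "riesz_integral f c \<rho> = - (contour_integral (circlepath c \<rho>) f / (2 * pi * \<i>))"
  by (simp add: riesz_integral_def line_integral_complex scaleC_complex_def)

lemma riesz_integral_scaleC_right:
  fixes v :: "'a::{complex_normed_vector,banach}"
  assumes "0 \<le> \<rho>" "continuous_on (sphere c \<rho>) \<phi>"
  shows "riesz_integral (\<lambda>z. \<phi> z *\<^sub>C v) c \<rho> = riesz_integral \<phi> c \<rho> *\<^sub>C v"
  by (rule riesz_integral_linear[OF assms, of "\<lambda>a. a *\<^sub>C v", symmetric])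
    (auto simp: scaleC.bounded_linear_left scaleC_scaleC scaleC_complex_def)

lemma riesz_integral_apply:
  fixes F :: "complex \<Rightarrow> 'a::{complex_normed_vector,banach} \<Rightarrow>\<^sub>L 'a"
  assumes "0 \<le> \<rho>" "continuous_on (sphere c \<rho>) F"
  shows "riesz_integral F c \<rho> x = riesz_integral (\<lambda>z. F z x) c \<rho>"
  by (rule riesz_integral_linear[OF assms, of "\<lambda>T. T x"])
    (auto simp: scaleC_blinfun.rep_eq)

section \<open>Domain of the Neumann argument and Riesz projections of the unperturbed
  operator\<close>

context perturbed_diagonal
begin

text \<open>A margin \<open>d\<close> common to all eigenvalues, rather than pointwise distances
  above \<open>norm X\<close>, makes the set open: half of the slack \<open>d - norm X\<close> is
  the radius of a ball inside it.\<close>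

definition \<Omega> :: "complex set"
  where "\<Omega> = {z. \<exists>d > norm X. separated d z}"

lemma separated_\<Omega>: "separated d z \<Longrightarrow> norm X < d \<Longrightarrow> z \<in> \<Omega>"
  unfolding \<Omega>_def by blast

lemma not_in_\<Omega>:
  assumes "w \<notin> \<Omega>" "norm X < d"
  shows "\<exists>j\<ge>1. cmod (of_real (lam j) - w) < d"
proof (rule ccontr)
  assume "\<not> ?thesis"
  moreover have "0 < d" using assms(2) norm_ge_zero[of X] by linarith
  ultimately have "separated d w" unfolding separated_def by force
  then show False using assms separated_\<Omega> by blast
qed

lemma separated_near:
  assumes "separated d z" "cmod (z - w) \<le> e" "e < d"
  shows "separated (d - e) w"
  unfolding separated_def
proof (intro conjI allI impI)
  fix j :: nat assume "j \<ge> 1"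
  then have "d \<le> cmod (of_real (lam j) - z)" using assms(1) unfolding separated_def by blast
  also have "\<dots> \<le> cmod (of_real (lam j) - w) + cmod (z - w)"
    using norm_triangle_ineq4[of "of_real (lam j) - w" "z - w"] by simp
  finally show "d - e \<le> cmod (of_real (lam j) - w)" using assms(2) by linarith
qed (use assms in simp)

lemma open_\<Omega>: "open \<Omega>"
  unfolding open_contains_ball
proof
  fix z assume "z \<in> \<Omega>"
  then obtain d where d: "norm X < d" "separated d z" unfolding \<Omega>_def by blast
  define e where "e = (d - norm X) / 2"
  have e: "0 < e" "norm X < d - e" "e < d"
    using d(1) le_less_trans[OF norm_ge_zero d(1)] by (simp_all add: e_def field_simps add_pos_nonneg)
  have "ball z e \<subseteq> \<Omega>"
    using separated_near[OF d(2) _ e(3)] separated_\<Omega> e(2) by (force simp: dist_norm)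
  then show "\<exists>e>0. ball z e \<subseteq> \<Omega>" using e(1) by blast
qed

lemma \<Omega>_is_resolvent:
  assumes "z \<in> \<Omega>"
  shows "is_resolvent A z (RA z)" "is_resolvent (op_add A X) z (RH z)"
  using assms RA_is_resolvent RH_is_resolvent unfolding \<Omega>_def by blast+

lemma continuous_on_RA: "U \<subseteq> \<Omega> \<Longrightarrow> continuous_on U RA"
  by (intro continuous_at_imp_continuous_on ballI isCont_resolvent[OF open_\<Omega>, of _ A] \<Omega>_is_resolvent) auto

lemma continuous_on_RH: "U \<subseteq> \<Omega> \<Longrightarrow> continuous_on U RH"
  by (intro continuous_at_imp_continuous_on ballI isCont_resolvent[OF open_\<Omega>, of _ "op_add A X"] \<Omega>_is_resolvent) auto

lemma holomorphic_RH_diff: "(\<lambda>z. cinner ((RH z - RA z) x) y) holomorphic_on \<Omega>"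
  unfolding blinfun.diff_left cinner.diff_left
  by (intro holomorphic_on_diff holomorphic_resolvent[OF open_\<Omega> \<Omega>_is_resolvent(2)]
      holomorphic_resolvent[OF open_\<Omega> \<Omega>_is_resolvent(1)])

text \<open>The difference contains two resolvent factors, hence decays quadratically;
  \<open>2 * norm X < d\<close> makes the perturbed factor at most twice the bound
  \<open>1 / d\<close>.\<close>

lemma norm_RH_diff_le:
  assumes "separated d z" "2 * norm X < d"
  shows "norm (RH z - RA z) \<le> 2 * norm X / d\<^sup>2"
proof -
  have d: "norm X < d" "0 < d" using assms norm_ge_zero[of X] unfolding separated_def by linarith+
  have "RH z - RA z = - (RA z o\<^sub>L X o\<^sub>L RH z)" 
    using arg_cong[OF RH_left[OF assms(1) d(1)], of "\<lambda>S. S - RA z"] by simp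
  then have "norm (RH z - RA z) = norm (RA z o\<^sub>L X o\<^sub>L RH z)" by (simp only: norm_minus_cancel)
  also have "\<dots> \<le> norm (RA z) * norm X * norm (RH z)"
    by (rule order_trans[OF norm_blinfun_compose mult_right_mono[OF norm_blinfun_compose]]) simp
  also have "\<dots> \<le> 1 / d * norm X * (1 / (d - norm X))"
    using d by (intro mult_mono norm_RA[OF assms(1)] norm_RH[OF assms(1) d(1)]) auto
  also have "\<dots> \<le> 1 / d * norm X * (2 / d)"
  proof (rule mult_left_mono)
    have "1 / (d - norm X) \<le> 1 / (d / 2)" by (rule divide_left_mono) (use assms(2) d in auto)
    then show "1 / (d - norm X) \<le> 2 / d" by simp
  qed (use d in simp)
  finally show ?thesis by (simp add: power2_eq_square mult.commute)
qed

lemma blinfun_eq_on_P: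
  fixes S T :: "'b \<Rightarrow>\<^sub>L 'b"
  assumes "\<And>k x. S (P k x) = T (P k x)"
  shows "S = T"
proof (rule blinfun_eqI)
  fix x
  have "((\<lambda>k. S (P k x)) has_sum S x) UNIV"
    by (rule has_sum_bounded_linear[OF blinfun.bounded_linear_right has_sum_P])
  moreover have "((\<lambda>k. S (P k x)) has_sum T x) UNIV"
    unfolding assms by (rule has_sum_bounded_linear[OF blinfun.bounded_linear_right has_sum_P])
  ultimately show "S x = T x" by (rule has_sum_unique)
qed

text \<open>On the range of \<open>P k\<close> the integrand is the scalar
  \<open>symbol z k\<close>. The minus sign of the Riesz formula turns 1 / (lam k - z) into the
  Cauchy kernel, so the integral is the winding number of the circle about
  \<open>lam k\<close>.\<close>

lemma riesz_integral_RA: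
  assumes \<rho>: "0 \<le> \<rho>" and F: "finite F" "0 \<notin> F" and s: "sphere c \<rho> \<subseteq> \<Omega>"
    and "in": "\<And>j. j \<in> F \<Longrightarrow> of_real (lam j) \<in> ball c \<rho>"
    and out: "\<And>j. j \<ge> 1 \<Longrightarrow> j \<notin> F \<Longrightarrow> of_real (lam j) \<notin> cball c \<rho>"
  shows "riesz_integral RA c \<rho> = (\<Sum>j\<in>F. P j)"
proof (rule blinfun_eq_on_P)
  fix k x
  have symb: "RA z (P k x) = symbol z k *\<^sub>C P k x" if "z \<in> sphere c \<rho>" for z
    using that s RA_P unfolding \<Omega>_def by blast
  have sum: "(\<Sum>j\<in>F. P j) (P k x) = (if k \<in> F then P k x else 0)"
    using F(1) by (simp add: blinfun.sum_left P_P)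
  show "riesz_integral RA c \<rho> (P k x) = (\<Sum>j\<in>F. P j) (P k x)"
  proof (cases "k = 0")
    case True
    then show ?thesis by (simp add: P_0 blinfun.zero_right)
  next
    case False
    have ns: "of_real (lam k) \<notin> sphere c \<rho>"
      using "in"[of k] out[of k] False by (cases "k \<in> F") auto
    have cs: "continuous_on (sphere c \<rho>) (\<lambda>z. symbol z k)"
      unfolding symbol_def using ns False by (auto intro!: continuous_intros)
    have "riesz_integral RA c \<rho> (P k x) = riesz_integral (\<lambda>z. RA z (P k x)) c \<rho>"
      by (rule riesz_integral_apply[OF \<rho> continuous_on_RA[OF s]])
    also have "\<dots> = riesz_integral (\<lambda>z. symbol z k *\<^sub>C P k x) c \<rho>"
      unfolding riesz_integral_def line_integral_def
      using symb[OF circlepath_in_sphere[OF \<rho>]] by simp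
    also have "\<dots> = riesz_integral (\<lambda>z. symbol z k) c \<rho> *\<^sub>C P k x"
      by (rule riesz_integral_scaleC_right[OF \<rho> cs])
    also have "riesz_integral (\<lambda>z. symbol z k) c \<rho> = winding_number (circlepath c \<rho>) (of_real (lam k))"
    proof -
      have "(\<lambda>z. symbol z k) = (\<lambda>z. - (1 / (z - of_real (lam k))))"
        using False unfolding symbol_def by (auto simp: fun_eq_iff) (metis minus_diff_eq minus_divide_right)
      moreover have "of_real (lam k) \<notin> path_image (circlepath c \<rho>)"
        using ns \<rho> by (simp add: path_image_circlepath_nonneg)
      ultimately show ?thesis
        by (simp add: riesz_integral_complex winding_number_valid_path contour_integral_neg)
    qed
    also have "\<dots> = (if k \<in> F then 1 else 0)"
    proof (cases "k \<in> F")
      case True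
      then show ?thesis using "in"[OF True]
        by (simp add: winding_number_circlepath dist_norm norm_minus_commute)
    next
      case kF: False
      then show ?thesis using out[of k] False \<rho>
        by (auto intro!: winding_number_zero_outside[of _ "cball c \<rho>"] simp: path_image_circlepath_nonneg)
    qed
    finally show ?thesis by (simp add: sum)
  qed
qed

end

section \<open>Convergence of the Riesz projections\<close>

locale gap_perturbation = perturbed_diagonal P A lam X
  for P :: "nat \<Rightarrow> 'b::complex_hilbert \<Rightarrow>\<^sub>L 'b" and A lam X +
  fixes r :: real and i0 :: nat
  assumes lam_mono: "strict_mono_on {1..} lam"
    and i0: "2 \<le> i0"
    and gap: "\<And>i. i \<ge> i0 \<Longrightarrow> lam i - lam (i - 1) > 2 * r"
    and r: "2 * norm X < r"
begin

text \<open>The index 0 stands for the circle around the first \<open>i0 - 1\<close> eigenvalues.\<close>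

definition ctr :: "nat \<Rightarrow> real"
  where "ctr i = (if i = 0 then (lam 1 + lam (i0 - 1)) / 2 else lam i)"

definition rad :: "nat \<Rightarrow> real"
  where "rad i = (if i = 0 then (lam (i0 - 1) - lam 1) / 2 + r else r)"

definition block :: "nat \<Rightarrow> nat set"
  where "block i = (if i = 0 then {1..<i0} else {i})"

definition Q :: "nat \<Rightarrow> 'b \<Rightarrow>\<^sub>L 'b"
  where "Q i = riesz_projection (op_add A X) (of_real (ctr i)) (rad i)"

definition indices :: "nat set"
  where "indices = {0} \<union> {i0..}"

lemma r_pos: "0 < r" "norm X < r"
  using r norm_ge_zero[of X] by - (linarith+)

lemma lam_le: "1 \<le> i \<Longrightarrow> i \<le> j \<Longrightarrow> lam i \<le> lam j"
  using lam_mono by (cases "i = j") (auto simp: strict_mono_on_def less_imp_le)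

lemma indices_cases:
  assumes "i \<in> indices"
  obtains "i = 0" | "i \<ge> i0" "i \<noteq> 0"
  using assms i0 unfolding indices_def by fastforce

text \<open>Together with \<open>block_outside\<close> this leaves a margin \<open>r\<close> on both
  sides of the circle. Hence the circle keeps distance \<open>r\<close> from every eigenvalue, and a
  point closer than \<open>r\<close> to an eigenvalue lies on the same side of the circle as that
  eigenvalue.\<close>

lemma block_inside:
  assumes "i \<in> indices" "j \<in> block i"
  shows "\<bar>lam j - ctr i\<bar> \<le> rad i - r" "j \<ge> 1"
proof -
  show "j \<ge> 1" using assms unfolding block_def by (auto split: if_splits)
  show "\<bar>lam j - ctr i\<bar> \<le> rad i - r"
    using assms(1)
  proof (cases rule: indices_cases)
    case 1
    then have "1 \<le> j" "j \<le> i0 - 1" using assms(2) unfolding block_def by auto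
    from lam_le[OF order_refl this(1)] lam_le[OF this] show ?thesis
      unfolding ctr_def rad_def 1 by (simp add: field_simps abs_le_iff)
  qed (use assms(2) in \<open>simp add: block_def ctr_def rad_def\<close>)
qed

lemma block_outside:
  assumes "i \<in> indices" "j \<notin> block i" "j \<ge> 1"
  shows "rad i + r < \<bar>lam j - ctr i\<bar>"
  using assms(1)
proof (cases rule: indices_cases)
  case 1
  then have "i0 \<le> j" using assms(2,3) unfolding block_def by auto
  with i0 have "lam i0 \<le> lam j" by (intro lam_le) auto
  moreover have "lam 1 \<le> lam (i0 - 1)" using i0 by (intro lam_le) auto
  ultimately have "(lam (i0 - 1) - lam 1) / 2 + r + r < lam j - (lam 1 + lam (i0 - 1)) / 2"
    using gap[OF order_refl] by (simp add: field_simps)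
  then show ?thesis unfolding ctr_def rad_def 1 if_P[OF refl] by (rule less_le_trans[OF _ abs_ge_self])
next
  case 2
  then have "j \<noteq> i" using assms(2) unfolding block_def by auto
  then consider "j \<le> i - 1" | "j \<ge> i + 1" by linarith
  then show ?thesis
  proof cases
    case 1
    then have "lam j \<le> lam (i - 1)" using assms(3) by (intro lam_le)
    then show ?thesis using gap[of i] 2 unfolding ctr_def rad_def by simp
  next
    case 2
    then have "lam (i + 1) \<le> lam j" by (intro lam_le) auto
    then show ?thesis using gap[of "i + 1"] \<open>i \<ge> i0\<close> \<open>i \<noteq> 0\<close> unfolding ctr_def rad_def by simp
  qed
qed

lemma rad_pos: "0 < rad i"
proof -
  have "lam 1 \<le> lam (i0 - 1)" using i0 by (intro lam_le) auto
  then show ?thesis using r_pos by (simp add: rad_def add_nonneg_pos)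
qed

lemma separated_sphere:
  assumes i: "i \<in> indices" and z: "z \<in> sphere (of_real (ctr i)) (rad i)"
  shows "separated r z"
  unfolding separated_def
proof (intro conjI allI impI r_pos)
  fix j :: nat assume j: "j \<ge> 1"
  have c: "cmod (of_real (lam j) - of_real (ctr i)) = \<bar>lam j - ctr i\<bar>"
    by (metis norm_of_real of_real_diff)
  have z': "cmod (z - of_real (ctr i)) = rad i" using z by (simp add: dist_norm norm_minus_commute)
  show "r \<le> cmod (of_real (lam j) - z)"
  proof (cases "j \<in> block i")
    case True
    have "cmod (z - of_real (ctr i)) \<le> cmod (of_real (lam j) - z) + cmod (of_real (lam j) - of_real (ctr i))"
      using norm_triangle_ineq4[of "of_real (lam j) - of_real (ctr i)" "of_real (lam j) - z"] by simp
    then show ?thesis using block_inside(1)[OF i True] c z' by linarith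
  next
    case False
    have "cmod (of_real (lam j) - of_real (ctr i)) \<le> cmod (of_real (lam j) - z) + cmod (z - of_real (ctr i))"
      using norm_triangle_ineq[of "of_real (lam j) - z" "z - of_real (ctr i)"] by simp
    then show ?thesis using block_outside[OF i False j] c z' by linarith
  qed
qed

lemma sphere_subset_\<Omega>: "i \<in> indices \<Longrightarrow> sphere (of_real (ctr i)) (rad i) \<subseteq> \<Omega>"
  using separated_sphere separated_\<Omega> r_pos by blast

text \<open>Points outside \<open>\<Omega>\<close> are closer than \<open>r\<close> to some
  eigenvalue; this computes the winding numbers that \<open>Cauchy_theorem_loops\<close> asks for at
  such points.\<close>

lemma winding_number_circle:
  assumes i: "i \<in> indices" and j: "j \<ge> 1" "cmod (of_real (lam j) - w) < r"
  shows "winding_number (circlepath (of_real (ctr i)) (rad i)) w = (if j \<in> block i then 1 else 0)"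
proof (cases "j \<in> block i")
  case True
  have "cmod (w - of_real (ctr i)) \<le> cmod (of_real (lam j) - w) + cmod (of_real (lam j) - of_real (ctr i))"
    using norm_triangle_ineq4[of "of_real (lam j) - of_real (ctr i)" "of_real (lam j) - w"] by simp
  also have "cmod (of_real (lam j) - of_real (ctr i)) = \<bar>lam j - ctr i\<bar>"
    by (metis norm_of_real of_real_diff)
  finally have "cmod (w - of_real (ctr i)) < rad i" using block_inside(1)[OF i True] j(2) by linarith
  then show ?thesis using True by (simp add: winding_number_circlepath)
next
  case False
  have "cmod (of_real (lam j) - of_real (ctr i)) \<le> cmod (of_real (lam j) - w) + cmod (w - of_real (ctr i))"
    using norm_triangle_ineq[of "of_real (lam j) - w" "w - of_real (ctr i)"] by simp
  moreover have "cmod (of_real (lam j) - of_real (ctr i)) = \<bar>lam j - ctr i\<bar>"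
    by (metis norm_of_real of_real_diff)
  ultimately have "rad i < cmod (w - of_real (ctr i))" using block_outside[OF i False j(1)] j(2) by linarith
  then have "w \<notin> cball (of_real (ctr i)) (rad i)" by (simp add: dist_norm norm_minus_commute)
  then show ?thesis using False less_imp_le[OF rad_pos[of i]]
    by (auto intro!: winding_number_zero_outside[of _ "cball (of_real (ctr i)) (rad i)"]
        simp: path_image_circlepath_nonneg)
qed

lemma riesz_RA: "i \<in> indices \<Longrightarrow> riesz_integral RA (of_real (ctr i)) (rad i) = (\<Sum>j\<in>block i. P j)"
proof (rule riesz_integral_RA[OF less_imp_le[OF rad_pos] _ _ sphere_subset_\<Omega>])
  assume i: "i \<in> indices"
  show "0 \<notin> block i" using block_inside(2)[OF i] by force
  have c: "dist (of_real (ctr i)) (of_real (lam j) :: complex) = \<bar>lam j - ctr i\<bar>" for j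
    unfolding dist_norm by (metis norm_minus_commute norm_of_real of_real_diff)
  show "of_real (lam j) \<in> ball (of_real (ctr i) :: complex) (rad i)" if "j \<in> block i" for j
    using block_inside(1)[OF i that] r_pos c by simp
  show "of_real (lam j) \<notin> cball (of_real (ctr i) :: complex) (rad i)" if "j \<ge> 1" "j \<notin> block i" for j
    using block_outside[OF i that(2,1)] r_pos c by simp
qed (auto simp: block_def)

lemma Q_eq: "Q i = riesz_integral RH (of_real (ctr i)) (rad i)"
  by (simp add: Q_def riesz_projection_eq RH_def)

lemma Q_diff_eq:
  assumes i: "i \<in> indices"
  shows "Q i - (\<Sum>j\<in>block i. P j) = riesz_integral (\<lambda>z. RH z - RA z) (of_real (ctr i)) (rad i)"
proof -
  note c = continuous_on_RH[OF sphere_subset_\<Omega>[OF i]] continuous_on_RA[OF sphere_subset_\<Omega>[OF i]]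
  note int = integrable_continuous_interval[OF continuous_on_circle_integrand[OF less_imp_le[OF rad_pos]]]
  show ?thesis
    unfolding riesz_RA[OF i, symmetric] Q_eq riesz_integral_def line_integral_def scaleC.diff_right
    by (simp add: Henstock_Kurzweil_Integration.integral_diff[OF int int] c scaleC.diff_right)
qed

lemma cinner_Q_diff:
  assumes i: "i \<in> indices"
  shows "cinner ((Q i - (\<Sum>j\<in>block i. P j)) x) y =
    - (contour_integral (circlepath (of_real (ctr i)) (rad i)) (\<lambda>z. cinner ((RH z - RA z) x) y) / (2 * of_real pi * \<i>))"
proof -
  have c: "continuous_on (sphere (of_real (ctr i)) (rad i)) (\<lambda>z. RH z - RA z)"
    by (intro continuous_on_diff continuous_on_RH continuous_on_RA sphere_subset_\<Omega> i)
  have "bounded_linear (\<lambda>T :: 'b \<Rightarrow>\<^sub>L 'b. cinner (T x) y)"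
    by (rule bounded_linear_compose[OF cinner.bounded_linear_left bounded_linear_apply_blinfun])
  from riesz_integral_linear[OF less_imp_le[OF rad_pos] c this]
  have "cinner (riesz_integral (\<lambda>z. RH z - RA z) (of_real (ctr i)) (rad i) x) y =
      riesz_integral (\<lambda>z. cinner ((RH z - RA z) x) y) (of_real (ctr i)) (rad i)"
    by (simp add: scaleC_blinfun.rep_eq cinner_scaleC_left scaleC_complex_def)
  then show ?thesis unfolding Q_diff_eq[OF i] riesz_integral_complex by simp
qed

section \<open>Comparison of partial sums by a rectangular contour\<close>

lemma separated_shift_real:
  assumes "separated d (of_real e)"
  shows "separated d (Complex e y)"
  using assms unfolding separated_def
proof (elim conjE, intro conjI allI impI)
  fix j :: nat assume "\<forall>j\<ge>1. d \<le> cmod (of_real (lam j) - of_real e)" "j \<ge> 1"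
  then have "d \<le> cmod (of_real (lam j) - of_real e)" by blast
  also have "\<dots> = \<bar>Re (of_real (lam j) - Complex e y)\<bar>" by (simp flip: of_real_diff)
  also have "\<dots> \<le> cmod (of_real (lam j) - Complex e y)" by (rule abs_Re_le_cmod)
  finally show "d \<le> cmod (of_real (lam j) - Complex e y)" .
qed

lemma separated_Im:
  assumes "\<bar>y\<bar> \<ge> d" "d > 0"
  shows "separated d (Complex x y)"
  unfolding separated_def
proof (intro conjI allI impI assms)
  fix j :: nat
  have "d \<le> \<bar>Im (of_real (lam j) - Complex x y)\<bar>" using assms by simp
  also have "\<dots> \<le> cmod (of_real (lam j) - Complex x y)" by (rule abs_Im_le_cmod)
  finally show "d \<le> cmod (of_real (lam j) - Complex x y)" .
qed

text \<open>The vertical lines through the right-most points of the circles avoid the spectrum.\<close>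

lemma circle_base_point_connected:
  assumes i: "i \<in> indices" and Y: "r \<le> Y"
  shows "\<exists>p. valid_path p \<and> path_image p \<subseteq> \<Omega> \<and> pathstart p = Complex a (- Y) \<and>
    pathfinish p = pathstart (circlepath (of_real (ctr i)) (rad i))"
proof -
  define e where "e = ctr i + rad i"
  have "of_real e \<in> sphere (of_real (ctr i) :: complex) (rad i)"
    using rad_pos[of i] by (simp add: e_def dist_norm)
  then have e: "separated r (Complex e y)" for y
    by (intro separated_shift_real separated_sphere[OF i])
  define p where "p = linepath (Complex a (- Y)) (Complex e (- Y)) +++ linepath (Complex e (- Y)) (Complex e 0)"
  have "closed_segment (Complex a (- Y)) (Complex e (- Y)) \<subseteq> \<Omega>"
  proof
    fix z assume "z \<in> closed_segment (Complex a (- Y)) (Complex e (- Y))"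
    then have "z = Complex (Re z) (- Y)" by (auto simp: closed_segment_def complex_eq_iff algebra_simps)
    moreover have "separated r (Complex (Re z) (- Y))" using Y r_pos by (intro separated_Im) auto
    ultimately show "z \<in> \<Omega>" using separated_\<Omega> r_pos by metis
  qed
  moreover have "closed_segment (Complex e (- Y)) (Complex e 0) \<subseteq> \<Omega>"
  proof
    fix z assume "z \<in> closed_segment (Complex e (- Y)) (Complex e 0)"
    then have "z = Complex e (Im z)" by (auto simp: closed_segment_def complex_eq_iff algebra_simps)
    then show "z \<in> \<Omega>" using e separated_\<Omega> r_pos by metis
  qed
  ultimately have "valid_path p" "path_image p \<subseteq> \<Omega>" "pathstart p = Complex a (- Y)" "pathfinish p = Complex e 0"
    unfolding p_def by (auto simp: path_image_join intro!: valid_path_join)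
  moreover have "Complex e 0 = pathstart (circlepath (of_real (ctr i)) (rad i))"
    by (simp add: e_def complex_eq_iff)
  ultimately show ?thesis by metis
qed

text \<open>Squaring this distance produces the majorant 1 / (d^2 + y^2), which is integrable along
  the whole line.\<close>

lemma separated_vertical:
  assumes "\<And>j. j \<ge> 1 \<Longrightarrow> d \<le> \<bar>lam j - a\<bar>" "d > 0"
  shows "separated (sqrt (d\<^sup>2 + y\<^sup>2)) (Complex a y)"
  unfolding separated_def
proof (intro conjI allI impI)
  show "0 < sqrt (d\<^sup>2 + y\<^sup>2)" using assms(2) by (simp add: add_pos_nonneg)
  fix j :: nat assume "j \<ge> 1"
  then have "d\<^sup>2 \<le> (lam j - a)\<^sup>2" using assms by (metis power2_abs power_mono less_imp_le)
  then show "sqrt (d\<^sup>2 + y\<^sup>2) \<le> cmod (of_real (lam j) - Complex a y)"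
    by (simp add: cmod_def)
qed

lemma cmod_cinner_RH_diff_le:
  assumes "separated d z" "2 * norm X < d"
  shows "cmod (cinner ((RH z - RA z) x) y) \<le> 2 * norm X * norm x * norm y / d\<^sup>2"
proof -
  have "cmod (cinner ((RH z - RA z) x) y) \<le> norm (RH z - RA z) * norm x * norm y"
    by (rule order_trans[OF cmod_cinner_le mult_right_mono[OF norm_blinfun]]) simp
  also have "\<dots> \<le> 2 * norm X / d\<^sup>2 * norm x * norm y"
    by (intro mult_right_mono norm_RH_diff_le assms) auto
  finally show ?thesis by simp
qed

lemma sum_winding_circles:
  assumes n: "i0 \<le> n" and j: "j \<ge> 1" "cmod (of_real (lam j) - w) < r"
  shows "(\<Sum>i\<in>insert 0 {i0..n}. winding_number (circlepath (of_real (ctr i)) (rad i)) w) = (if j \<le> n then 1 else 0)"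
proof -
  have "(\<Sum>i\<in>insert 0 {i0..n}. winding_number (circlepath (of_real (ctr i)) (rad i)) w)
      = (\<Sum>i\<in>insert 0 {i0..n}. if j \<in> block i then 1 else 0)"
    by (intro sum.cong refl winding_number_circle j) (auto simp: indices_def)
  \<comment> \<open>The blocks are disjoint, so only one index can contribute: 0 if \<open>j\<close>
    is below \<open>i0\<close>, and \<open>j\<close> itself otherwise.\<close>
  also have "\<dots> = (\<Sum>i\<in>insert 0 {i0..n}. if i = (if j < i0 then 0 else j) then 1 else 0)"
    by (intro sum.cong refl) (use j(1) i0 in \<open>auto simp: block_def\<close>)
  also have "\<dots> = (if j \<le> n then 1 else 0)"
    using n i0 j(1) by (auto simp: sum.delta)
  finally show ?thesis .
qed

lemma norm_partial_sum_diff: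
  assumes n: "i0 \<le> n" and d: "d = (lam (n + 1) - lam n) / 2"
  shows "norm (\<Sum>i\<in>insert 0 {i0..n}. Q i - (\<Sum>j\<in>block i. P j)) \<le> 4 * norm X / d"
proof -
  have two_d: "lam (n + 1) = lam n + 2 * d" using d by simp
  have dr: "d > r" using gap[of "n + 1"] n by (simp add: d)
  then have d0: "d > 0" using r_pos by simp
  \<comment> \<open>The left side is put at distance \<open>d\<close> below the first eigenvalue, so
    that both vertical sides have the same distance \<open>d\<close> to the eigenvalues.\<close>
  define a b where "a = lam 1 - d" and "b = lam n + d"
  \<comment> \<open>A height above the width \<open>b - a\<close> and above \<open>d\<close> keeps
    the horizontal sides, of total size at most 2 K (b - a) / Y^2, below 2 K / d. Thus a fixed
    rectangle suffices and no limit in the height is taken.\<close>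
  define Y where "Y = (b - a) + d"
  have "lam 1 \<le> lam n" using n i0 by (intro lam_le) auto
  then have ab: "a < b" and Yd: "d < Y" using d0 by (auto simp: a_def b_def Y_def)
  define G where "G = rectpath (Complex a (- Y)) (Complex b Y)"
  have lam_b: "\<bar>lam j - b\<bar> \<ge> d" and lam_a: "\<bar>lam j - a\<bar> \<ge> d" if "j \<ge> 1" for j
  proof -
    have "lam j \<le> lam n \<or> lam (n + 1) \<le> lam j"
      using that by (cases "j \<le> n") (auto intro!: lam_le)
    moreover have "lam (n + 1) = lam n + 2 * d" by (rule two_d)
    ultimately show "\<bar>lam j - b\<bar> \<ge> d" unfolding b_def by linarith
    have "lam 1 \<le> lam j" using that by (intro lam_le) auto
    then show "\<bar>lam j - a\<bar> \<ge> d" unfolding a_def by linarith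
  qed
  have vert: "separated (sqrt (d\<^sup>2 + y\<^sup>2)) (Complex a y)" "separated (sqrt (d\<^sup>2 + y\<^sup>2)) (Complex b y)" for y
    using separated_vertical[OF _ d0] lam_a lam_b by blast+
  have big: "2 * norm X < sqrt (d\<^sup>2 + y\<^sup>2)" for y
  proof -
    have "d \<le> sqrt (d\<^sup>2 + y\<^sup>2)" by (rule real_le_rsqrt) simp
    then show ?thesis using dr r by linarith
  qed
  have horiz: "separated Y (Complex x y)" if "\<bar>y\<bar> = Y" for x y
    using that Yd d0 by (intro separated_Im) auto
  have YX: "2 * norm X < Y" using Yd dr r by linarith
  have G\<Omega>: "path_image G \<subseteq> \<Omega>"
  proof
    fix z assume "z \<in> path_image G"
    then have "Re z \<in> {a, b} \<or> Im z \<in> {- Y, Y}"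
      unfolding G_def using ab Yd d0 by (subst (asm) path_image_rectpath) auto
    then have "z = Complex a (Im z) \<or> z = Complex b (Im z) \<or> (\<bar>Im z\<bar> = Y \<and> z = Complex (Re z) (Im z))"
      using Yd d0 by (auto simp: complex_eq_iff)
    moreover have "norm X < sqrt (d\<^sup>2 + (Im z)\<^sup>2)" "norm X < Y"
      using big[of "Im z"] YX norm_ge_zero[of X] by - (linarith+)
    ultimately show "z \<in> \<Omega>" using vert[of "Im z"] horiz separated_\<Omega> by metis
  qed
  \<comment> \<open>A point outside \<open>\<Omega>\<close> is within \<open>r\<close> of some
    \<open>lam j\<close>, and \<open>d > r\<close> places it inside or outside the rectangle
    according to whether \<open>j \<le> n\<close>.\<close>
  have wind: "(\<Sum>i\<in>insert 0 {i0..n}. winding_number (circlepath (of_real (ctr i)) (rad i)) w) = winding_number G w"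
    if w: "w \<notin> \<Omega>" for w
  proof -
    obtain j where j: "j \<ge> 1" "cmod (of_real (lam j) - w) < r" using not_in_\<Omega>[OF w r_pos(2)] by blast
    have Re: "\<bar>lam j - Re w\<bar> < r" using abs_Re_le_cmod[of "of_real (lam j) - w"] j(2) by simp
    have Im: "\<bar>Im w\<bar> < r" using abs_Im_le_cmod[of "of_real (lam j) - w"] j(2) by simp
    have "winding_number G w = (if j \<le> n then 1 else 0)"
    proof (cases "j \<le> n")
      case True
      have "lam 1 \<le> lam j" "lam j \<le> lam n" using True j(1) by (auto intro!: lam_le)
      then have "a < Re w" "Re w < b" "- Y < Im w" "Im w < Y"
        using Re Im dr Yd unfolding a_def b_def by linarith+
      then have "w \<in> box (Complex a (- Y)) (Complex b Y)" by (simp add: in_box_complex_iff)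
      then show ?thesis using True unfolding G_def by (simp add: winding_number_rectpath)
    next
      case False
      then have "lam (n + 1) \<le> lam j" by (intro lam_le) auto
      moreover have "lam (n + 1) = lam n + 2 * d" by (rule two_d)
      ultimately have "Re w > b" using Re dr unfolding b_def by linarith
      then have "w \<notin> cbox (Complex a (- Y)) (Complex b Y)" by (simp add: in_cbox_complex_iff)
      then show ?thesis using False ab Yd d0 unfolding G_def
        by (simp add: winding_number_rectpath_outside)
    qed
    then show ?thesis using sum_winding_circles[OF n j] by simp
  qed
  define T where "T = (\<Sum>i\<in>insert 0 {i0..n}. Q i - (\<Sum>j\<in>block i. P j))"
  have idx: "i \<in> indices" if "i \<in> insert 0 {i0..n}" for i using that by (auto simp: indices_def)
  have main: "cmod (cinner (T x) y) \<le> 4 * norm X / d * norm x * norm y" for x y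
  proof -
    define f where "f z = cinner ((RH z - RA z) x) y" for z
    define K where "K = 2 * norm X * norm x * norm y"
    have hol: "f holomorphic_on \<Omega>" unfolding f_def by (rule holomorphic_RH_diff)
    have "cinner (T x) y = (\<Sum>i\<in>insert 0 {i0..n}. cinner ((Q i - (\<Sum>j\<in>block i. P j)) x) y)"
      unfolding T_def by (simp only: blinfun.sum_left cinner.sum_left)
    also have "\<dots> = (\<Sum>i\<in>insert 0 {i0..n}.
        - (contour_integral (circlepath (of_real (ctr i)) (rad i)) f / (2 * of_real pi * \<i>)))"
      unfolding f_def by (intro sum.cong refl cinner_Q_diff idx)
    also have "\<dots> = - ((\<Sum>i\<in>insert 0 {i0..n}. contour_integral (circlepath (of_real (ctr i)) (rad i)) f)
        / (2 * of_real pi * \<i>))"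
      by (simp only: sum_negf sum_divide_distrib)
    also have "(\<Sum>i\<in>insert 0 {i0..n}. contour_integral (circlepath (of_real (ctr i)) (rad i)) f) = contour_integral G f"
    proof (rule Cauchy_theorem_loops[OF open_\<Omega> hol])
      fix i assume "i \<in> insert 0 {i0..n}"
      then have i: "i \<in> indices" by (rule idx)
      show "valid_path (circlepath (of_real (ctr i)) (rad i)) \<and> path_image (circlepath (of_real (ctr i)) (rad i)) \<subseteq> \<Omega> \<and>
          pathfinish (circlepath (of_real (ctr i)) (rad i)) = pathstart (circlepath (of_real (ctr i)) (rad i))"
        using sphere_subset_\<Omega>[OF i] less_imp_le[OF rad_pos[of i]] by (simp add: path_image_circlepath_nonneg)
      show "\<exists>p. valid_path p \<and> path_image p \<subseteq> \<Omega> \<and> pathstart p = pathstart G \<and>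
          pathfinish p = pathstart (circlepath (of_real (ctr i)) (rad i))"
        using circle_base_point_connected[OF i, of Y a] dr Yd by (simp add: G_def)
    qed (use G\<Omega> wind in \<open>auto simp: G_def valid_path_rectpath\<close>)
    finally have "cmod (cinner (T x) y) = cmod (contour_integral G f) / (2 * pi)"
      by (simp add: norm_divide norm_mult)
    also have "cmod (contour_integral G f) \<le> 2 * K * pi / d + 2 * K * (b - a) / Y\<^sup>2"
      unfolding G_def
    proof (rule rectpath_integral_bound)
      show "continuous_on (path_image (rectpath (Complex a (- Y)) (Complex b Y))) f"
        using holomorphic_on_imp_continuous_on[OF hol] G\<Omega> continuous_on_subset unfolding G_def by blast
      show "cmod (f (Complex a t)) \<le> K / (d\<^sup>2 + t\<^sup>2)" for t
        using cmod_cinner_RH_diff_le[OF vert(1) big] unfolding f_def K_def by simp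
      show "cmod (f (Complex b t)) \<le> K / (d\<^sup>2 + t\<^sup>2)" for t
        using cmod_cinner_RH_diff_le[OF vert(2) big] unfolding f_def K_def by simp
      show "cmod (f (Complex s t)) \<le> K / Y\<^sup>2" if "\<bar>t\<bar> = Y" for s t
        using cmod_cinner_RH_diff_le[OF horiz[OF that] YX] unfolding f_def K_def .
    qed (use d0 ab Yd in \<open>auto simp: K_def\<close>)
    also have "2 * K * (b - a) / Y\<^sup>2 \<le> 2 * K * pi / d"
    proof -
      have "(b - a) / Y\<^sup>2 \<le> Y / Y\<^sup>2" using d0 by (intro divide_right_mono) (auto simp: Y_def)
      also have "\<dots> = 1 / Y" by (simp add: power2_eq_square)
      also have "\<dots> \<le> 1 / d" using Yd d0 by (intro divide_left_mono) auto
      also have "\<dots> \<le> pi / d" using d0 pi_gt3 by (intro divide_right_mono) auto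
      finally have "2 * K * ((b - a) / Y\<^sup>2) \<le> 2 * K * (pi / d)" by (intro mult_left_mono) (auto simp: K_def)
      then show ?thesis by simp
    qed
    \<comment> \<open>The vertical sides give 2 K pi / d and the horizontal ones at most as much;
      division by 2 pi leaves 2 K / d with K containing \<open>2 * norm X\<close>, whence the
      constant 4.\<close>
    finally have "cmod (cinner (T x) y) \<le> (2 * K * pi / d + 2 * K * pi / d) / (2 * pi)"
      by (simp add: divide_right_mono)
    then show ?thesis by (simp add: K_def algebra_simps)
  qed
  have "norm T \<le> 4 * norm X / d"
  proof (rule norm_blinfun_bound)
    show "norm (T x) \<le> 4 * norm X / d * norm x" for x
      by (rule norm_le_of_cinner_le[OF _ main]) (use d0 in simp)
  qed (use d0 in simp)
  then show ?thesis by (simp add: T_def)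
qed

end

text \<open>Needed because the bound in \<open>norm_L_Q_le\<close> mixes terms of different degree
  in \<open>x\<close> and is therefore summed on the unit ball.\<close>

lemma norm_blinfun_le_unit:
  fixes T :: "'a::real_normed_vector \<Rightarrow>\<^sub>L 'b::real_normed_vector"
  assumes "0 \<le> C" "\<And>x. norm x \<le> 1 \<Longrightarrow> norm (T x) \<le> C"
  shows "norm T \<le> C"
proof (rule norm_blinfun_bound[OF assms(1)])
  fix x :: 'a
  show "norm (T x) \<le> C * norm x"
  proof (cases "x = 0")
    case False
    have "norm (T ((1 / norm x) *\<^sub>R x)) \<le> C" using False by (intro assms(2)) simp
    then show ?thesis using False by (simp add: blinfun.scaleR_right field_simps)
  qed (simp add: blinfun.zero_right)
qed

section \<open>Strong limit and estimates for single circles\<close>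

context gap_perturbation
begin

lemma sum_blocks:
  assumes "i0 \<le> n"
  shows "(\<Sum>i\<in>insert 0 {i0..n}. \<Sum>j\<in>block i. P j) = (\<Sum>j\<le>n. P j)"
proof -
  have "(\<Sum>i\<in>insert 0 {i0..n}. \<Sum>j\<in>block i. P j) = (\<Sum>j\<in>{1..<i0}. P j) + (\<Sum>i\<in>{i0..n}. \<Sum>j\<in>block i. P j)"
    using i0 by (simp add: block_def)
  also have "(\<Sum>i\<in>{i0..n}. \<Sum>j\<in>block i. P j) = (\<Sum>j\<in>{i0..n}. P j)"
    using i0 by (intro sum.cong refl) (simp add: block_def)
  also have "(\<Sum>j\<in>{1..<i0}. P j) + (\<Sum>j\<in>{i0..n}. P j) = (\<Sum>j\<in>{1..<i0} \<union> {i0..n}. P j)"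
    by (rule sum.union_disjoint[symmetric]) auto
  also have "{1..<i0} \<union> {i0..n} = {..n} - {0}" using assms i0 by auto
  also have "(\<Sum>j\<in>{..n} - {0}. P j) = (\<Sum>j\<le>n. P j)"
    by (rule sum.mono_neutral_left) (auto simp: P_0)
  finally show ?thesis .
qed

lemma partial_sums_tendsto:
  assumes "filterlim (\<lambda>i. lam (Suc i) - lam i) at_top sequentially"
  shows "(\<lambda>n. (\<Sum>i\<in>insert 0 {i0..n}. Q i) x) \<longlonglongrightarrow> x"
proof -
  define T where "T n = (\<Sum>i\<in>insert 0 {i0..n}. Q i - (\<Sum>j\<in>block i. P j))" for n
  have lim0: "(\<lambda>n. 8 * norm X * norm x / (lam (Suc n) - lam n)) \<longlonglongrightarrow> 0"
    by (rule tendsto_divide_0[OF tendsto_const]) (rule filterlim_at_top_imp_at_infinity[OF assms])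
  have "(\<lambda>n. T n x) \<longlonglongrightarrow> 0"
  proof (rule Lim_null_comparison[OF _ lim0])
    have "norm (T n x) \<le> 8 * norm X * norm x / (lam (Suc n) - lam n)" if "i0 \<le> n" for n
    proof -
      have "norm (T n x) \<le> norm (T n) * norm x" by (rule norm_blinfun)
      also have "\<dots> \<le> 4 * norm X / ((lam (n + 1) - lam n) / 2) * norm x"
        unfolding T_def by (intro mult_right_mono norm_partial_sum_diff[OF that refl]) simp
      finally show ?thesis by simp
    qed
    then show "\<forall>\<^sub>F n in sequentially. norm (T n x) \<le> 8 * norm X * norm x / (lam (Suc n) - lam n)"
      unfolding eventually_sequentially by blast
  qed
  moreover have "(\<lambda>n. (\<Sum>j\<le>n. P j) x) \<longlonglongrightarrow> x"
    using has_sum_imp_sums[OF has_sum_P[of x]] unfolding sums_def_le by (simp add: blinfun.sum_left)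
  ultimately have "(\<lambda>n. T n x + (\<Sum>j\<le>n. P j) x) \<longlonglongrightarrow> 0 + x" by (rule tendsto_add)
  moreover have "\<forall>\<^sub>F n in sequentially. T n x + (\<Sum>j\<le>n. P j) x = (\<Sum>i\<in>insert 0 {i0..n}. Q i) x"
    unfolding eventually_sequentially
  proof (intro exI[of _ i0] allI impI)
    fix n assume n: "i0 \<le> n"
    have "T n + (\<Sum>j\<le>n. P j) = (\<Sum>i\<in>insert 0 {i0..n}. Q i)"
      unfolding T_def sum_subtractf sum_blocks[OF n] by simp
    then show "T n x + (\<Sum>j\<le>n. P j) x = (\<Sum>i\<in>insert 0 {i0..n}. Q i) x"
      by (metis blinfun.add_left)
  qed
  ultimately show ?thesis by (simp add: Lim_transform_eventually)
qed

text \<open>The quantity \<delta>_i: by monotonicity the two neighbours are the nearest eigenvalues.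
  It has this meaning for \<open>i \<ge> 2\<close>; at smaller indices \<open>lam 0\<close> would
  enter.\<close>

definition nn_gap :: "nat \<Rightarrow> real"
  where "nn_gap i = min (lam i - lam (i - 1)) (lam (i + 1) - lam i)"

lemma nn_gap_gt: "i \<ge> i0 \<Longrightarrow> 2 * r < nn_gap i"
  using gap[of i] gap[of "i + 1"] by (simp add: nn_gap_def)

lemma L_scaleC: "L i (c *\<^sub>C x) = c *\<^sub>C L i x"
  by (simp add: L_def blinfun.diff_left P_scaleC scaleC.diff_right)

text \<open>Each \<open>RA z\<close> adjacent to \<open>L i\<close> costs only 2 / \<delta>_i, while
  \<open>X\<close> times \<open>RH z\<close> has norm at most 1. In the last estimate the resolvent
  difference equals \<open>- (RA z o\<^sub>L X o\<^sub>L RH z)\<close>, so both outer factors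
  \<open>L i\<close> act and the decay is quadratic.\<close>

lemma circle_estimates:
  assumes i: "i \<ge> i0" and z: "z \<in> sphere (of_real (lam i)) r"
  shows "norm (RH z) \<le> 2 / r"
    and "norm (L i o\<^sub>L RH z) \<le> 4 / nn_gap i"
    and "norm (RH z o\<^sub>L L i) \<le> 4 / nn_gap i"
    and "norm (L i o\<^sub>L (RH z - RA z) o\<^sub>L L i) \<le> 4 * r / (nn_gap i)\<^sup>2"
proof -
  have ii: "i \<in> indices" "i \<noteq> 0" using i i0 by (auto simp: indices_def)
  then have s: "separated r z" using separated_sphere[OF ii(1), of z] z by (simp add: ctr_def rad_def)
  define \<delta> where "\<delta> = nn_gap i"
  have \<delta>: "2 * r < \<delta>" "0 < \<delta>" using nn_gap_gt[OF i] r_pos unfolding \<delta>_def by auto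
  \<comment> \<open>The circle has radius \<open>r\<close>, less than half of
    \<open>\<delta>\<close>, so it uses up less than half of the distance to any other
    eigenvalue.\<close>
  have far: "\<delta> / 2 \<le> cmod (of_real (lam j) - z)" if j: "j \<ge> 1" "j \<noteq> i" for j
  proof -
    have "\<delta> \<le> \<bar>lam j - lam i\<bar>"
    proof (cases "j < i")
      case True
      then have "lam j \<le> lam (i - 1)" using j by (intro lam_le) auto
      then show ?thesis unfolding \<delta>_def nn_gap_def by linarith
    next
      case False
      then have "lam (i + 1) \<le> lam j" using j by (intro lam_le) auto
      then show ?thesis unfolding \<delta>_def nn_gap_def by linarith
    qed
    also have "\<dots> = cmod (of_real (lam j) - of_real (lam i))" by (metis norm_of_real of_real_diff)
    also have "\<dots> \<le> cmod (of_real (lam j) - z) + cmod (z - of_real (lam i))"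
      using norm_triangle_ineq[of "of_real (lam j) - z" "z - of_real (lam i)"] by simp
    also have "cmod (z - of_real (lam i)) = r" using z by (simp add: dist_norm norm_minus_commute)
    finally show ?thesis using \<delta>(1) by simp
  qed
  have LRA: "norm (L i o\<^sub>L RA z) \<le> 2 / \<delta>"
    using norm_L_RA[OF s _ far] \<delta>(2) by simp
  have X: "norm X \<le> r / 2" "norm X * 2 \<le> r" using r by simp_all
  have RHn: "norm (RH z) \<le> 2 / r"
  proof -
    have "norm (RH z) \<le> 1 / (r - norm X)" by (rule norm_RH[OF s r_pos(2)])
    also have "\<dots> \<le> 1 / (r / 2)" using X r_pos by (intro divide_left_mono) auto
    finally show ?thesis by simp
  qed
  then show "norm (RH z) \<le> 2 / r" .
  have XR: "norm X * norm (RH z) \<le> 1"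
  proof -
    have "norm X * norm (RH z) \<le> r / 2 * (2 / r)" using X RHn r_pos by (intro mult_mono) auto
    then show ?thesis using r_pos by simp
  qed
  have "L i o\<^sub>L RH z = (L i o\<^sub>L RA z) - (L i o\<^sub>L RA z o\<^sub>L (X o\<^sub>L RH z))"
    using arg_cong[OF RH_left[OF s r_pos(2)], of "\<lambda>S. L i o\<^sub>L S"]
    by (auto intro!: blinfun_eqI simp: blinfun.diff_right blinfun.diff_left dest: arg_cong[of _ _ blinfun_apply] fun_cong)
  then have "norm (L i o\<^sub>L RH z) \<le> norm (L i o\<^sub>L RA z) + norm (L i o\<^sub>L RA z o\<^sub>L (X o\<^sub>L RH z))"
    using norm_triangle_ineq4 by metis
  also have "norm (L i o\<^sub>L RA z o\<^sub>L (X o\<^sub>L RH z)) \<le> norm (L i o\<^sub>L RA z) * 1"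
    by (rule order_trans[OF norm_blinfun_compose mult_left_mono[OF order_trans[OF norm_blinfun_compose XR]]]) simp
  finally show "norm (L i o\<^sub>L RH z) \<le> 4 / nn_gap i" using LRA unfolding \<delta>_def by simp
  have "RH z o\<^sub>L L i = (L i o\<^sub>L RA z) - (RH z o\<^sub>L X o\<^sub>L (L i o\<^sub>L RA z))"
    unfolding RA_L[OF s, symmetric]
    using arg_cong[OF RH_right[OF s r_pos(2)], of "\<lambda>S. S o\<^sub>L L i"]
    by (auto intro!: blinfun_eqI simp: blinfun.diff_right blinfun.diff_left dest: arg_cong[of _ _ blinfun_apply] fun_cong)
  then have "norm (RH z o\<^sub>L L i) \<le> norm (L i o\<^sub>L RA z) + norm (RH z o\<^sub>L X o\<^sub>L (L i o\<^sub>L RA z))"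
    using norm_triangle_ineq4 by metis
  also have "norm (RH z o\<^sub>L X o\<^sub>L (L i o\<^sub>L RA z)) \<le> 1 * norm (L i o\<^sub>L RA z)"
    by (rule order_trans[OF norm_blinfun_compose mult_right_mono[OF order_trans[OF norm_blinfun_compose]]])
      (use XR in \<open>simp_all add: mult.commute\<close>)
  finally show RHL: "norm (RH z o\<^sub>L L i) \<le> 4 / nn_gap i" using LRA unfolding \<delta>_def by simp
  have "L i o\<^sub>L (RH z - RA z) o\<^sub>L L i = - (L i o\<^sub>L RA z o\<^sub>L X o\<^sub>L (RH z o\<^sub>L L i))"
  proof -
    have "RH z - RA z = - (RA z o\<^sub>L X o\<^sub>L RH z)"
      using arg_cong[OF RH_left[OF s r_pos(2)], of "\<lambda>S. S - RA z"] by simp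
    then show ?thesis by (auto intro!: blinfun_eqI simp: blinfun.minus_left blinfun.minus_right)
  qed
  then have "norm (L i o\<^sub>L (RH z - RA z) o\<^sub>L L i) = norm (L i o\<^sub>L RA z o\<^sub>L X o\<^sub>L (RH z o\<^sub>L L i))"
    by (simp only: norm_minus_cancel)
  also have "\<dots> \<le> norm (L i o\<^sub>L RA z) * norm X * norm (RH z o\<^sub>L L i)"
    by (rule order_trans[OF norm_blinfun_compose mult_right_mono[OF norm_blinfun_compose]]) simp
  also have "\<dots> \<le> 2 / \<delta> * (r / 2) * (4 / \<delta>)"
    using LRA X RHL \<delta>(2) r_pos unfolding \<delta>_def[symmetric] by (intro mult_mono) auto
  finally show "norm (L i o\<^sub>L (RH z - RA z) o\<^sub>L L i) \<le> 4 * r / (nn_gap i)\<^sup>2"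
    unfolding \<delta>_def by (simp add: power2_eq_square mult.commute)
qed

lemma Q_estimates:
  assumes i: "i \<ge> i0"
  shows "norm (Q i) \<le> 2"
    and "norm (L i o\<^sub>L Q i) \<le> 4 * r / nn_gap i"
    and "norm (Q i o\<^sub>L L i) \<le> 4 * r / nn_gap i"
    and "norm (L i o\<^sub>L Q i o\<^sub>L L i) \<le> 4 * r\<^sup>2 / (nn_gap i)\<^sup>2"
proof -
  have ii: "i \<in> indices" "i \<noteq> 0" using i i0 by (auto simp: indices_def)
  have S: "sphere (of_real (lam i)) r \<subseteq> \<Omega>"
    using sphere_subset_\<Omega>[OF ii(1)] ii(2) by (simp add: ctr_def rad_def)
  have Q: "Q i = riesz_integral RH (of_real (lam i)) r"
    using ii(2) by (simp add: Q_eq ctr_def rad_def)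
  have Qd: "Q i - P i = riesz_integral (\<lambda>z. RH z - RA z) (of_real (lam i)) r"
    using Q_diff_eq[OF ii(1)] ii(2) by (simp add: ctr_def rad_def block_def)
  have r0: "0 \<le> r" using r_pos by simp
  note cH = continuous_on_RH[OF S]
  have cD: "continuous_on (sphere (of_real (lam i)) r) (\<lambda>z. RH z - RA z)"
    by (intro continuous_on_diff cH continuous_on_RA[OF S])
  note comp = bounded_bilinear_blinfun_compose
  have le: "norm (riesz_integral F (of_real (lam i)) r) \<le> r * B"
    if "continuous_on (sphere (of_real (lam i)) r) F" "\<And>z. z \<in> sphere (of_real (lam i)) r \<Longrightarrow> norm (F z) \<le> B"
    for F :: "complex \<Rightarrow> 'b \<Rightarrow>\<^sub>L 'b" and B
    by (rule norm_riesz_integral_le[OF r0 that])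
  show "norm (Q i) \<le> 2"
    using le[OF cH circle_estimates(1)[OF i]] r_pos by (simp add: Q)
  have "L i o\<^sub>L Q i = riesz_integral (\<lambda>z. L i o\<^sub>L RH z) (of_real (lam i)) r"
    unfolding Q
    by (rule riesz_integral_linear[OF r0 cH bounded_bilinear.bounded_linear_right[OF comp]])
      (auto intro!: blinfun_eqI simp: scaleC_blinfun.rep_eq L_scaleC)
  then show "norm (L i o\<^sub>L Q i) \<le> 4 * r / nn_gap i"
    using le[OF bounded_bilinear.continuous_on[OF comp continuous_on_const cH] circle_estimates(2)[OF i]]
    by (simp add: mult.commute)
  have "Q i o\<^sub>L L i = riesz_integral (\<lambda>z. RH z o\<^sub>L L i) (of_real (lam i)) r"
    unfolding Q
    by (rule riesz_integral_linear[OF r0 cH bounded_bilinear.bounded_linear_left[OF comp]])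
      (auto intro!: blinfun_eqI simp: scaleC_blinfun.rep_eq)
  then show "norm (Q i o\<^sub>L L i) \<le> 4 * r / nn_gap i"
    using le[OF bounded_bilinear.continuous_on[OF comp cH continuous_on_const] circle_estimates(3)[OF i]]
    by (simp add: mult.commute)
  \<comment> \<open>\<open>L i\<close> annihilates \<open>P i\<close>, so subtracting
    \<open>P i\<close> costs nothing. This brings in the resolvent difference and with it the
    quadratic decay.\<close>
  have "L i o\<^sub>L Q i o\<^sub>L L i = L i o\<^sub>L (Q i - P i) o\<^sub>L L i"
    by (rule blinfun_eqI) (simp add: L_def blinfun.diff_left blinfun.diff_right P_P)
  also have "\<dots> = riesz_integral (\<lambda>z. L i o\<^sub>L (RH z - RA z) o\<^sub>L L i) (of_real (lam i)) r"
    unfolding Qd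
  proof (rule riesz_integral_linear[OF r0 cD])
    show "bounded_linear (\<lambda>T. L i o\<^sub>L T o\<^sub>L L i)"
      by (rule bounded_linear_compose[OF bounded_bilinear.bounded_linear_left[OF comp]
            bounded_bilinear.bounded_linear_right[OF comp]])
  qed (auto intro!: blinfun_eqI simp: scaleC_blinfun.rep_eq L_scaleC)
  also have "norm \<dots> \<le> r * (4 * r / (nn_gap i)\<^sup>2)"
    by (rule le[OF bounded_bilinear.continuous_on[OF comp
            bounded_bilinear.continuous_on[OF comp continuous_on_const cD] continuous_on_const]
          circle_estimates(4)[OF i]])
  finally show "norm (L i o\<^sub>L Q i o\<^sub>L L i) \<le> 4 * r\<^sup>2 / (nn_gap i)\<^sup>2"
    by (simp add: power2_eq_square mult.commute mult.left_commute)
qed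

text \<open>Split \<open>x\<close> into \<open>P i x\<close> and \<open>L i x\<close>: the first
  part is square summable over \<open>i\<close> by Bessel and the bound 2 on \<open>Q i\<close>, the
  second through the gaps. The constants come from (a + b)^2 \<le> 2 a^2 + 2 b^2.\<close>

lemma norm_P_Q_sq_le:
  assumes i: "i \<ge> i0"
  shows "(norm (P i (Q i x)))\<^sup>2 \<le> 8 * (norm (P i x))\<^sup>2 + 32 * r\<^sup>2 * (norm x)\<^sup>2 * (1 / (nn_gap i)\<^sup>2)"
proof -
  have "Q i x = Q i (P i x) + (Q i o\<^sub>L L i) x"
    by (simp add: L_def blinfun.diff_left blinfun.diff_right)
  then have "norm (Q i x) \<le> norm (Q i (P i x)) + norm ((Q i o\<^sub>L L i) x)"
    using norm_triangle_ineq by metis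
  also have "norm (Q i (P i x)) \<le> 2 * norm (P i x)"
    by (rule order_trans[OF norm_blinfun mult_right_mono[OF Q_estimates(1)[OF i]]]) simp
  also have "norm ((Q i o\<^sub>L L i) x) \<le> 4 * r / nn_gap i * norm x"
    by (rule order_trans[OF norm_blinfun mult_right_mono[OF Q_estimates(3)[OF i]]]) simp
  finally have "norm (P i (Q i x)) \<le> 2 * norm (P i x) + 4 * r / nn_gap i * norm x"
    using norm_P_le[of i "Q i x"] by simp
  then have "(norm (P i (Q i x)))\<^sup>2 \<le> (2 * norm (P i x) + 4 * r / nn_gap i * norm x)\<^sup>2"
    by (rule power_mono) simp
  also have "\<dots> \<le> 2 * (2 * norm (P i x))\<^sup>2 + 2 * (4 * r / nn_gap i * norm x)\<^sup>2"
    using sum_squares_bound[of "2 * norm (P i x)" "4 * r / nn_gap i * norm x"] by (simp add: power2_sum)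
  finally show ?thesis by (simp add: power_mult_distrib power_divide)
qed

text \<open>The same splitting. The part from \<open>P i x\<close> is a product of two square
  summable quantities and is separated by u v \<le> u^2 + v^2; the part from \<open>L i x\<close> is
  already quadratic in the inverse gap.\<close>

lemma norm_L_Q_le:
  assumes i: "i \<ge> i0"
  shows "norm (L i (Q i x)) \<le> (norm (P i x))\<^sup>2 + (16 * r\<^sup>2 + 4 * r\<^sup>2 * norm x) * (1 / (nn_gap i)\<^sup>2)"
proof -
  have "L i (Q i x) = (L i o\<^sub>L Q i) (P i x) + (L i o\<^sub>L Q i o\<^sub>L L i) x"
    by (simp add: L_def blinfun.diff_left blinfun.diff_right)
  then have "norm (L i (Q i x)) \<le> norm ((L i o\<^sub>L Q i) (P i x)) + norm ((L i o\<^sub>L Q i o\<^sub>L L i) x)"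
    using norm_triangle_ineq by metis
  also have "norm ((L i o\<^sub>L Q i) (P i x)) \<le> 4 * r / nn_gap i * norm (P i x)"
    by (rule order_trans[OF norm_blinfun mult_right_mono[OF Q_estimates(2)[OF i]]]) simp
  also have "norm ((L i o\<^sub>L Q i o\<^sub>L L i) x) \<le> 4 * r\<^sup>2 / (nn_gap i)\<^sup>2 * norm x"
    by (rule order_trans[OF norm_blinfun mult_right_mono[OF Q_estimates(4)[OF i]]]) simp
  also have "4 * r / nn_gap i * norm (P i x) \<le> (4 * r / nn_gap i)\<^sup>2 + (norm (P i x))\<^sup>2"
  proof -
    have "0 \<le> 4 * r / nn_gap i * norm (P i x)" using nn_gap_gt[OF i] r_pos by simp
    moreover have "u * v \<le> u\<^sup>2 + v\<^sup>2" if "0 \<le> u * v" for u v :: real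
      using sum_squares_bound[of u v] that by simp
    ultimately show ?thesis by blast
  qed
  finally show ?thesis by (simp add: power_divide power_mult_distrib algebra_simps)
qed

section \<open>Unconditional convergence and uniform bounds\<close>

context
  assumes sq: "(\<lambda>i. 1 / (nn_gap i)\<^sup>2) summable_on {i0..}"
begin

lemma Q_summable: "(\<lambda>i. Q i x) summable_on indices"
proof -
  have sqP: "(\<lambda>i. (norm (P i x))\<^sup>2) summable_on {i0..}" by (rule square_summable)
  have "(\<lambda>i. P i (Q i x)) summable_on {i0..}"
  proof (rule orthogonal_summable_on)
    show "cinner (P i (Q i x)) (P j (Q j x)) = 0" if "i \<noteq> j" for i j by (rule P_orthogonal[OF that])
    show "(\<lambda>i. (norm (P i (Q i x)))\<^sup>2) summable_on {i0..}"
      by (rule summable_on_comparison_test[OF summable_on_add[OF summable_on_cmult_right[OF sqP]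
              summable_on_cmult_right[OF sq]] norm_P_Q_sq_le]) auto
  qed
  moreover have "(\<lambda>i. L i (Q i x)) summable_on {i0..}"
    by (rule abs_summable_summable,
        rule summable_on_comparison_test[OF summable_on_add[OF sqP summable_on_cmult_right[OF sq]] norm_L_Q_le]) auto
  ultimately have "(\<lambda>i. P i (Q i x) + L i (Q i x)) summable_on {i0..}" by (rule summable_on_add)
  then have "(\<lambda>i. Q i x) summable_on {i0..}" by (simp add: L_def blinfun.diff_left)
  then show ?thesis unfolding indices_def
    by (rule summable_on_Un_disjoint[rotated]) (use i0 in auto)
qed

text \<open>Summability alone does not identify the sum. The sets \<open>insert 0 {i0..n}\<close>
  exhaust \<open>indices\<close>, so the unordered sum must agree with the limit of the ordered
  partial sums.\<close>

lemma Q_has_sum: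
  assumes lim: "filterlim (\<lambda>i. lam (Suc i) - lam i) at_top sequentially"
  shows "((\<lambda>i. Q i x) has_sum x) indices"
proof -
  obtain s where s: "((\<lambda>i. Q i x) has_sum s) indices" using Q_summable unfolding summable_on_def by blast
  have "filterlim (\<lambda>n. insert 0 {i0..n}) (finite_subsets_at_top indices) sequentially"
    unfolding filterlim_finite_subsets_at_top
  proof (intro allI impI)
    fix F assume F: "finite F \<and> F \<subseteq> indices"
    then obtain N where N: "\<And>i. i \<in> F \<Longrightarrow> i \<le> N" using finite_nat_set_iff_bounded_le by meson
    show "\<forall>\<^sub>F n in sequentially. finite (insert 0 {i0..n}) \<and> F \<subseteq> insert 0 {i0..n} \<and> insert 0 {i0..n} \<subseteq> indices"
      unfolding eventually_sequentially
    proof (intro exI[of _ N] allI impI conjI)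
      fix n assume "N \<le> n"
      show "F \<subseteq> insert 0 {i0..n}"
      proof
        fix i assume "i \<in> F"
        then show "i \<in> insert 0 {i0..n}"
          using F N[of i] \<open>N \<le> n\<close> unfolding indices_def by auto
      qed
    qed (auto simp: indices_def)
  qed
  with s have "(\<lambda>n. \<Sum>i\<in>insert 0 {i0..n}. Q i x) \<longlonglongrightarrow> s"
    unfolding has_sum_def by (rule filterlim_compose)
  moreover have "(\<lambda>n. \<Sum>i\<in>insert 0 {i0..n}. Q i x) \<longlonglongrightarrow> x"
    using partial_sums_tendsto[OF lim, of x] by (simp only: blinfun.sum_left)
  ultimately have "s = x" by (rule LIMSEQ_unique)
  then show ?thesis using s by simp
qed

lemma Q_sums_bounded: "\<exists>C. \<forall>I. finite I \<and> I \<subseteq> indices \<longrightarrow> norm (\<Sum>i\<in>I. Q i) \<le> C"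
proof -
  define M where "M = (\<Sum>\<^sub>\<infinity>i\<in>{i0..}. 1 / (nn_gap i)\<^sup>2)"
  have M: "(\<Sum>i\<in>F. 1 / (nn_gap i)\<^sup>2) \<le> M" if "finite F" "F \<subseteq> {i0..}" for F
    unfolding M_def by (rule finite_sum_le_infsum[OF sq that]) auto
  have M0: "0 \<le> M" using M[of "{}"] by simp
  \<comment> \<open>For \<open>x\<close> in the unit ball, the square root bounds the orthogonal
    terms \<open>P i (Q i x)\<close>; the rest bounds the absolutely summable terms
    \<open>L i (Q i x)\<close>, with 20 = 16 + 4 from \<open>norm_L_Q_le\<close> and the summand 1
    from Bessel.\<close>
  define C where "C = sqrt (8 + 32 * r\<^sup>2 * M) + (1 + 20 * r\<^sup>2 * M)"
  have C0: "0 \<le> C" unfolding C_def using M0 by simp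
  have main: "norm (\<Sum>i\<in>F. Q i) \<le> C" if F: "finite F" "F \<subseteq> {i0..}" for F
  proof (rule norm_blinfun_le_unit[OF C0])
    fix x :: 'b assume x: "norm x \<le> 1"
    have x2: "(norm x)\<^sup>2 \<le> 1" using x by (simp add: power_le_one)
    have bess: "(\<Sum>i\<in>F. (norm (P i x))\<^sup>2) \<le> 1" using bessel[OF F(1), of x] x2 by simp
    have "(norm (\<Sum>i\<in>F. P i (Q i x)))\<^sup>2 = (\<Sum>i\<in>F. (norm (P i (Q i x)))\<^sup>2)"
      by (rule norm_sum_sq_orthogonal[OF F(1) P_orthogonal])
    also have "\<dots> \<le> (\<Sum>i\<in>F. 8 * (norm (P i x))\<^sup>2 + 32 * r\<^sup>2 * (norm x)\<^sup>2 * (1 / (nn_gap i)\<^sup>2))"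
      by (rule sum_mono, rule norm_P_Q_sq_le) (use F in auto)
    also have "\<dots> = 8 * (\<Sum>i\<in>F. (norm (P i x))\<^sup>2) + 32 * r\<^sup>2 * (norm x)\<^sup>2 * (\<Sum>i\<in>F. 1 / (nn_gap i)\<^sup>2)"
      by (simp only: sum.distrib sum_distrib_left)
    also have "\<dots> \<le> 8 * 1 + 32 * r\<^sup>2 * 1 * M"
      by (intro add_mono mult_mono mult_left_mono bess M F x2 mult_nonneg_nonneg sum_nonneg) auto
    finally have A: "norm (\<Sum>i\<in>F. P i (Q i x)) \<le> sqrt (8 + 32 * r\<^sup>2 * M)"
      by (simp add: real_le_rsqrt)
    have "norm (\<Sum>i\<in>F. L i (Q i x)) \<le> (\<Sum>i\<in>F. norm (L i (Q i x)))" by (rule norm_sum)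
    also have "\<dots> \<le> (\<Sum>i\<in>F. (norm (P i x))\<^sup>2 + (16 * r\<^sup>2 + 4 * r\<^sup>2 * norm x) * (1 / (nn_gap i)\<^sup>2))"
      by (rule sum_mono, rule norm_L_Q_le) (use F in auto)
    also have "\<dots> = (\<Sum>i\<in>F. (norm (P i x))\<^sup>2) + (16 * r\<^sup>2 + 4 * r\<^sup>2 * norm x) * (\<Sum>i\<in>F. 1 / (nn_gap i)\<^sup>2)"
      by (simp only: sum.distrib sum_distrib_left)
    also have "\<dots> \<le> 1 + (16 * r\<^sup>2 + 4 * r\<^sup>2 * 1) * M"
      by (intro add_mono mult_mono mult_left_mono bess M F x order_refl add_nonneg_nonneg mult_nonneg_nonneg sum_nonneg) auto
    also have "\<dots> = 1 + 20 * r\<^sup>2 * M" by simp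
    finally have B: "norm (\<Sum>i\<in>F. L i (Q i x)) \<le> 1 + 20 * r\<^sup>2 * M" .
    have "(\<Sum>i\<in>F. Q i) x = (\<Sum>i\<in>F. P i (Q i x)) + (\<Sum>i\<in>F. L i (Q i x))"
      by (simp add: blinfun.sum_left sum.distrib[symmetric] L_def blinfun.diff_left)
    then show "norm ((\<Sum>i\<in>F. Q i) x) \<le> C"
      unfolding C_def using norm_triangle_mono[OF A B] by simp
  qed
  \<comment> \<open>The gap estimates concern circles around a single eigenvalue. The circle of
    index 0 occurs at most once and is paid for by \<open>norm (Q 0)\<close>.\<close>
  have "norm (\<Sum>i\<in>I. Q i) \<le> norm (Q 0) + C" if I: "finite I" "I \<subseteq> indices" for I
  proof -
    have sub: "I - {0} \<subseteq> {i0..}" using I by (auto simp: indices_def)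
    have "norm (\<Sum>i\<in>I \<inter> {0}. Q i) \<le> norm (Q 0)" by (cases "0 \<in> I") auto
    moreover have "norm (\<Sum>i\<in>I - {0}. Q i) \<le> C" by (rule main[OF _ sub]) (use I in simp)
    moreover have "(\<Sum>i\<in>I. Q i) = (\<Sum>i\<in>I \<inter> {0}. Q i) + (\<Sum>i\<in>I - {0}. Q i)"
      by (rule sum.Int_Diff[OF I(1)])
    ultimately show ?thesis using norm_triangle_mono by metis
  qed
  then show ?thesis by blast
qed

end

end

section \<open>Eigenprojections\<close>

lemma eigenvectors_orthogonal:
  assumes A: "self_adjoint A" and e: "(e, s *\<^sub>R e) \<in> A" and f: "(f, t *\<^sub>R f) \<in> A" and st: "s \<noteq> t"
  shows "cinner e f = 0"
proof -
  have "s *\<^sub>R cinner e f = t *\<^sub>R cinner e f"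
    using self_adjoint_symmetric[OF A e f] by (simp only: cinner.scaleR_left cinner.scaleR_right)
  then show ?thesis using st by simp
qed

text \<open>Each eigenspace is used as a closed subspace, whatever its multiplicity, and
  completeness comes from \<open>eigenvectors_complete\<close>. The componentwise description says
  that \<open>A\<close> is the maximal diagonal operator with these eigenvalues.\<close>

lemma eigenprojections_exist:
  fixes A :: "'a::complex_hilbert graph" and lam :: "nat \<Rightarrow> real"
  assumes A: "self_adjoint A" and co: "compact_resolvent A" and sb: "semibounded_below A"
    and inj: "inj_on lam {1..}" and lam: "lam ` {1..} = {t. eigenvalue A (of_real t)}"
  shows "\<exists>P. orthogonal_resolution P \<and> P 0 = 0 \<and>
    (\<forall>x y. (x, y) \<in> A \<longleftrightarrow> (\<forall>j. P j y = lam j *\<^sub>R P j x))"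
proof -
  \<comment> \<open>The zero subspace at index 0 fills the gap left by numbering the eigenvalues
    from 1.\<close>
  define M where "M j = (if j = 0 then {0} else {x. (x, lam j *\<^sub>R x) \<in> A})" for j
  have sub: "subspace (M j)" for j
  proof (cases "j = 0")
    case False
    have "(0, 0) \<in> A" by (rule self_adjoint_memI[OF A]) simp
    moreover have "(x + y, lam j *\<^sub>R (x + y)) \<in> A"
      if "(x, lam j *\<^sub>R x) \<in> A" "(y, lam j *\<^sub>R y) \<in> A" for x y
      using self_adjoint_add[OF A that] by (simp add: scaleR_add_right)
    moreover have "(c *\<^sub>R x, lam j *\<^sub>R c *\<^sub>R x) \<in> A" if "(x, lam j *\<^sub>R x) \<in> A" for c x
      using self_adjoint_scaleR[OF A that, of c] by (simp add: mult.commute)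
    ultimately show ?thesis using False unfolding M_def subspace_def by auto
  qed (simp add: M_def)
  have clo: "closed (M j)" for j
  proof (cases "j = 0")
    case False
    have "a \<in> M j" if "\<And>n. x n \<in> M j" "x \<longlonglongrightarrow> a" for x a
    proof -
      have "(x n, lam j *\<^sub>R x n) \<in> A" for n using that(1)[of n] False by (simp add: M_def)
      then have "(a, lam j *\<^sub>R a) \<in> A"
        by (rule self_adjoint_closed[OF A _ that(2)]) (intro tendsto_intros that(2))
      then show ?thesis using False by (simp add: M_def)
    qed
    then show ?thesis unfolding closed_sequential_limits by blast
  qed (simp add: M_def)
  have sc: "c *\<^sub>C x \<in> M j" if "x \<in> M j" for c x j
    using that self_adjoint_scaleC[OF A, of x "lam j *\<^sub>R x" c]
    by (auto simp: M_def scaleR_scaleC split: if_splits)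
  have "\<forall>j. \<exists>P :: 'a \<Rightarrow>\<^sub>L 'a. complex_linear P \<and> (\<forall>x. P x \<in> M j) \<and> (\<forall>x\<in>M j. P x = x) \<and>
      (\<forall>x. \<forall>y\<in>M j. cinner (x - P x) y = 0)"
    using orthogonal_projector_exists[OF sub clo sc] by blast
  then obtain P :: "nat \<Rightarrow> 'a \<Rightarrow>\<^sub>L 'a" where P: "\<And>j. complex_linear (P j)" "\<And>j x. P j x \<in> M j"
    "\<And>j x. x \<in> M j \<Longrightarrow> P j x = x" "\<And>j x y. y \<in> M j \<Longrightarrow> cinner (x - P j x) y = 0"
    by metis
  have P0: "P 0 = 0" using P(2)[of 0] by (intro blinfun_eqI) (simp add: M_def)
  have PA: "(P j x, lam j *\<^sub>R P j x) \<in> A" if "j \<noteq> 0" for j x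
    using P(2)[of j x] that by (simp add: M_def)
  have sym': "cinner (P j x) (P j y) = cinner x (P j y)" for j x y
    using P(4)[OF P(2)[of j y], of x] by (simp add: cinner.diff_left)
  have sym: "cinner (P j x) y = cinner x (P j y)" for j x y
    using sym'[of j x y] sym'[of j y x] by (metis cinner_commute)
  have PP: "P j (P k x) = (if j = k then P j x else 0)" for j k x
  proof (cases "j = k")
    case False
    have "cinner (P j y) (P k x) = 0" for y
    proof (cases "j = 0 \<or> k = 0")
      case nz: False
      then have "lam j \<noteq> lam k" using False inj by (auto simp: inj_on_def)
      then show ?thesis using nz by (intro eigenvectors_orthogonal[OF A PA PA]) auto
    qed (auto simp: P0)
    then have "cinner (P j (P k x)) (P j (P k x)) = 0"
      by (simp only: sym'[of j "P k x" "P k x"] cinner_eq_0_swap[of "P k x"])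
    then show ?thesis using False by (simp add: cinner_self)
  qed (simp add: P(2,3))
  have complete: "x = 0" if "\<And>j. P j x = 0" for x
  proof (rule eigenvectors_complete[OF A co sb])
    fix s e assume e: "(e, s *\<^sub>R e) \<in> A"
    show "cinner x e = 0"
    proof (cases "e = 0")
      case False
      then have "eigenvalue A (of_real s)" using e unfolding eigenvalue_def scaleC_of_real by blast
      then obtain j where "j \<ge> 1" "s = lam j" using lam by blast
      then have "e \<in> M j" using e by (simp add: M_def)
      then show ?thesis using P(4)[of e j x] that[of j] by simp
    qed simp
  qed
  interpret orthogonal_resolution P
  proof
    show "P j (c *\<^sub>C x) = c *\<^sub>C P j x" for j c x using P(1)[of j] by (simp add: complex_linear_def)
  qed (fact sym PP complete)+
  have "(x, y) \<in> A \<longleftrightarrow> (\<forall>j. P j y = lam j *\<^sub>R P j x)" for x y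
  proof (intro iffI allI)
    fix j assume xy: "(x, y) \<in> A"
    show "P j y = lam j *\<^sub>R P j x"
    proof (cases "j = 0")
      case False
      define v where "v = P j y - lam j *\<^sub>R P j x"
      have "cinner y (P j v) = lam j *\<^sub>R cinner x (P j v)"
        using self_adjoint_symmetric[OF A xy PA[OF False, of v]] by (simp add: cinner.scaleR_right)
      then have "cinner v v = 0"
        by (subst v_def) (simp add: cinner.diff_left cinner.scaleR_left sym)
      then show ?thesis by (simp add: v_def cinner_self)
    qed (simp add: P0)
  next
    assume eq: "\<forall>j. P j y = lam j *\<^sub>R P j x"
    show "(x, y) \<in> A"
    \<comment> \<open>By maximality it is enough to test symmetry against the graph. The two inner
      products agree in every component, and summing over \<open>j\<close> gives their
      equality.\<close>
    proof (rule self_adjoint_memI[OF A])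
      fix u w assume uw: "(u, w) \<in> A"
      have "cinner (P j w) x = cinner (P j u) y" for j
      proof (cases "j = 0")
        case False
        have "cinner w (P j x) = cinner u (lam j *\<^sub>R P j x)"
          by (rule self_adjoint_symmetric[OF A uw PA[OF False]])
        then show ?thesis using eq by (simp add: sym)
      qed (simp add: P0)
      moreover have "((\<lambda>j. cinner (P j w) x) has_sum cinner w x) UNIV"
        by (rule has_sum_bounded_linear[OF cinner.bounded_linear_left has_sum_P])
      moreover have "((\<lambda>j. cinner (P j u) y) has_sum cinner u y) UNIV"
        by (rule has_sum_bounded_linear[OF cinner.bounded_linear_left has_sum_P])
      ultimately show "cinner w x = cinner u y" by (simp add: has_sum_unique)
    qed
  qed
  then show ?thesis using orthogonal_resolution_axioms P0 by blast
qed

section \<open>Passage to the hypotheses of the theorem\<close>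

lemma norm_basic_solution_le:
  assumes "is_basic_solution A0 A1 K m \<Delta> D DK X" "\<exists>G. admissible_contour A0 A1 K m \<Delta> D DK G"
  shows "norm X \<le> r_zero A0 A1 K m \<Delta> D DK"
  unfolding r_zero_def
  by (rule cINF_greatest) (use assms in \<open>auto simp: is_basic_solution_def\<close>)

text \<open>The inverse square of a minimum is at most the sum of both inverse squares, so every gap
  is counted at most twice. Here \<open>g (i - 2)\<close> belongs to the gap below
  \<open>lam i\<close> and \<open>g (i - 1)\<close> to the gap above.\<close>

lemma (in gap_perturbation) nn_gap_summable:
  assumes "summable (\<lambda>i. 1 / (lam (i + 2) - lam (i + 1))\<^sup>2)"
  shows "(\<lambda>i. 1 / (nn_gap i)\<^sup>2) summable_on {i0..}"
proof -
  define g where "g i = 1 / (lam (i + 2) - lam (i + 1))\<^sup>2" for i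
  have g: "summable g" using assms unfolding g_def .
  \<comment> \<open>The shift by 2 resolves the truncated subtractions before the finitely many
    initial terms are restored.\<close>
  have "summable (\<lambda>i. g (i + 2 - 2) + g (i + 2 - 1))"
    using summable_add[OF g summable_ignore_initial_segment[OF g, of 1]] by simp
  then have "summable (\<lambda>i. g (i - 2) + g (i - 1))"
    by (subst summable_iff_shift[of _ 2, symmetric])
  then have "(\<lambda>i. g (i - 2) + g (i - 1)) summable_on UNIV"
    by (rule summable_nonneg_imp_summable_on) (simp add: g_def)
  then have "(\<lambda>i. g (i - 2) + g (i - 1)) summable_on {i0..}"
    by (rule summable_on_subset_banach) simp
  then show ?thesis
  proof (rule summable_on_comparison_test)
    fix i assume "i \<in> {i0..}"
    then have "i \<ge> 2" using i0 by simp
    then obtain k where k: "i = k + 2" using le_Suc_ex by (metis add.commute)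
    show "1 / (nn_gap i)\<^sup>2 \<le> g (i - 2) + g (i - 1)"
      unfolding nn_gap_def g_def k by (simp add: min_def)
  qed simp
qed

theorem theorem9:
  fixes A0 :: "'a::complex_hilbert graph" and A1 :: "'b::complex_hilbert graph"
    and B01 :: "'b \<Rightarrow>\<^sub>L 'a" and B10 :: "'a \<Rightarrow>\<^sub>L 'b"
    and E0 :: "real set \<Rightarrow> 'a \<Rightarrow>\<^sub>L 'a" and K :: "real set \<Rightarrow> 'b \<Rightarrow>\<^sub>L 'b"
    and m :: nat and \<mu>1 \<mu>2 :: "nat \<Rightarrow> ereal" and \<Delta> :: "nat \<Rightarrow> real set"
    and Dm D :: "nat \<Rightarrow> complex set" and DK :: "nat \<Rightarrow> complex \<Rightarrow> 'b \<Rightarrow>\<^sub>L 'b"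
    and l :: "nat \<Rightarrow> int" and X :: "'b \<Rightarrow>\<^sub>L 'b"
    and lam :: "nat \<Rightarrow> real" and r :: real and i0 :: nat and Q :: "nat \<Rightarrow> 'b \<Rightarrow>\<^sub>L 'b"
  assumes separable0: "separable_space (euclidean :: 'a topology)"
    and separable1: "separable_space (euclidean :: 'b topology)"
    and sa0: "self_adjoint A0"
    and sa1: "self_adjoint A1"
    and B01: "complex_linear B01"
    and B10: "is_adjoint B01 B10"
    and E0: "is_spectral_measure A0 E0"
    and K: "K = K_measure B10 E0 B01"
    and spectral: "spectral_assumptions A0 A1 m \<mu>1 \<mu>2 \<Delta>"
    and analyticity: "analyticity_assumptions K m \<Delta> Dm DK"
    and l: "\<forall>k\<in>{1..m}. l k = 1 \<or> l k = - 1"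
    and D: "D = signed_domain Dm l"
    and contour: "\<exists>G. admissible_contour A0 A1 K m \<Delta> D DK G"
    and X: "is_basic_solution A0 A1 K m \<Delta> D DK X"
    and compact: "compact_resolvent A1"
    and semibounded: "semibounded_below A1"
    and infinite: "infinite (of_real ` (\<Union>k\<in>{1..m}. \<Delta> k) \<inter> spectrum A1)"
    and lam_mono: "strict_mono_on {1..} lam"
    and lam_eigenvalues: "lam ` {1..} = {t. eigenvalue A1 (of_real t)}"
    and lam_gaps: "filterlim (\<lambda>i. lam (Suc i) - lam i) at_top sequentially"
    and i0: "2 \<le> i0"
    and gap_r: "\<forall>i\<ge>i0. lam i - lam (i - 1) > 2 * r"
    and r: "2 * r > 4 * r_zero A0 A1 K m \<Delta> D DK"
    and Q0: "Q 0 = riesz_projection (op_add A1 X)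
                     (of_real ((lam 1 + lam (i0 - 1)) / 2)) ((lam (i0 - 1) - lam 1) / 2 + r)"
    and Qi: "\<forall>i\<ge>i0. Q i = riesz_projection (op_add A1 X) (of_real (lam i)) r"
  shows "strongly_converges (\<lambda>n. Q 0 + (\<Sum>i=i0..n. Q i)) id_blinfun \<and>
    (summable (\<lambda>i. 1 / (lam (i + 2) - lam (i + 1))\<^sup>2) \<longrightarrow>
      (\<forall>\<pi>. bij_betw \<pi> UNIV ({0} \<union> {i0..}) \<longrightarrow>
         strongly_converges (\<lambda>n. \<Sum>j<n. Q (\<pi> j)) id_blinfun) \<and>
      (\<exists>C. \<forall>I. finite I \<and> I \<subseteq> {0} \<union> {i0..} \<longrightarrow> norm (\<Sum>i\<in>I. Q i) \<le> C))"
proof -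
  \<comment> \<open>The norm of \<open>X\<close> is below \<open>r_min\<close> for every admissible
    contour, and such contours exist, so it is at most the infimum; halving the hypothesis on
    \<open>r\<close> then gives the claim.\<close>
  have "2 * norm X < r" using norm_basic_solution_le[OF X contour] r by simp
  obtain P where P: "orthogonal_resolution P" "P 0 = 0"
    and A1: "\<And>x y. (x, y) \<in> A1 \<longleftrightarrow> (\<forall>j. P j y = lam j *\<^sub>R P j x)"
    using eigenprojections_exist[OF sa1 compact semibounded strict_mono_on_imp_inj_on[OF lam_mono] lam_eigenvalues]
    by blast
  interpret G: gap_perturbation P A1 lam X r i0
  proof (intro gap_perturbation.intro perturbed_diagonal.intro P(1) perturbed_diagonal_axioms.intro
      gap_perturbation_axioms.intro)
    show "complex_linear X" using X by (simp add: is_basic_solution_def)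
  qed (use P(2) A1 lam_mono i0 gap_r \<open>2 * norm X < r\<close> in auto)
  \<comment> \<open>Away from the listed indices \<open>Q\<close> is arbitrary, so agreement is
    available on \<open>G.indices\<close> only.\<close>
  have Q: "Q i = G.Q i" if "i \<in> G.indices" for i
    using that
  proof (cases rule: G.indices_cases)
    case 1
    then show ?thesis by (simp add: Q0 G.Q_def G.ctr_def G.rad_def)
  next
    case 2
    then show ?thesis using Qi by (simp add: G.Q_def G.ctr_def G.rad_def)
  qed
  have strong: "(\<lambda>n. (Q 0 + (\<Sum>i=i0..n. Q i)) x) \<longlonglongrightarrow> x" for x
  proof -
    have "(\<Sum>i\<in>insert 0 {i0..n}. G.Q i) = Q 0 + (\<Sum>i=i0..n. Q i)" for n
    proof -
      have "(\<Sum>i\<in>insert 0 {i0..n}. G.Q i) = (\<Sum>i\<in>insert 0 {i0..n}. Q i)"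
        by (intro sum.cong refl Q[symmetric]) (auto simp: G.indices_def)
      then show ?thesis using i0 by simp
    qed
    then show ?thesis using G.partial_sums_tendsto[OF lam_gaps, of x] by simp
  qed
  have part2: "(\<forall>\<pi>. bij_betw \<pi> UNIV ({0} \<union> {i0..}) \<longrightarrow>
         strongly_converges (\<lambda>n. \<Sum>j<n. Q (\<pi> j)) id_blinfun) \<and>
      (\<exists>C. \<forall>I. finite I \<and> I \<subseteq> {0} \<union> {i0..} \<longrightarrow> norm (\<Sum>i\<in>I. Q i) \<le> C)"
    if sm: "summable (\<lambda>i. 1 / (lam (i + 2) - lam (i + 1))\<^sup>2)"
  proof (intro conjI allI impI)
    note sq = G.nn_gap_summable[OF sm]
    fix \<pi> :: "nat \<Rightarrow> nat" assume \<pi>: "bij_betw \<pi> UNIV ({0} \<union> {i0..})"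
    show "strongly_converges (\<lambda>n. \<Sum>j<n. Q (\<pi> j)) id_blinfun"
      unfolding strongly_converges_def
    proof
      fix x
      \<comment> \<open>An unordered sum is invariant under bijections of the index set, and along
        the natural numbers it yields the ordered series of the renumbered projections.\<close>
      have "((\<lambda>j. G.Q (\<pi> j) x) has_sum x) UNIV"
        using G.Q_has_sum[OF sq lam_gaps, of x]
        by (subst has_sum_reindex_bij_betw[OF \<pi>]) (simp add: G.indices_def)
      then have "(\<lambda>j. G.Q (\<pi> j) x) sums x" by (rule has_sum_imp_sums)
      moreover have "G.Q (\<pi> j) = Q (\<pi> j)" for j
        using bij_betwE[OF \<pi>] Q unfolding G.indices_def by auto
      ultimately show "(\<lambda>n. (\<Sum>j<n. Q (\<pi> j)) x) \<longlonglongrightarrow> id_blinfun x"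
        by (simp add: sums_def blinfun.sum_left)
    qed
  next
    obtain C where C: "\<And>I. finite I \<Longrightarrow> I \<subseteq> G.indices \<Longrightarrow> norm (\<Sum>i\<in>I. G.Q i) \<le> C"
      using G.Q_sums_bounded[OF G.nn_gap_summable[OF sm]] by blast
    have "norm (\<Sum>i\<in>I. Q i) \<le> C" if "finite I" "I \<subseteq> {0} \<union> {i0..}" for I
    proof -
      have "I \<subseteq> G.indices" using that(2) by (simp add: G.indices_def)
      moreover from this have "(\<Sum>i\<in>I. Q i) = (\<Sum>i\<in>I. G.Q i)" using Q by (intro sum.cong) auto
      ultimately show ?thesis using C[OF that(1)] by simp
    qed
    then show "\<exists>C. \<forall>I. finite I \<and> I \<subseteq> {0} \<union> {i0..} \<longrightarrow> norm (\<Sum>i\<in>I. Q i) \<le> C" by blast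
  qed
  show ?thesis
    using strong part2 unfolding strongly_converges_def by simp
qed

end
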